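(* Let $G$ be a discrete subgroup of the unitary group $\mathcal U(M_d)$, let $\tilde\phi$ be a $C^*$-finitely correlated state on $\mathfrak B=\bigotimes_{i\in\mathbb Z}M_d(\mathbb C)$ generated by a triplet $(M_d,E,\rho)$ where $E$ satisfies the $G$-covariance condition $$E\big((g\otimes g)(A\otimes B)(g\otimes g)^*\big)=gE(A\otimes B)g^*\qquad(A,B\in M_d,\ g\in G),$$ and let $\phi=\tilde\phi|\mathfrak A$ be the generalized Markov chain on the gauge-invariant algebra $\mathfrak A$ generated by $E$ and $\rho$. If $\tilde\phi$ is faithful and is a factor state, then $\phi$ is a factor state; that is, writing $(\mathcal H,\pi,\xi)$ for the GNS representation of $\mathfrak B$ associated with $\tilde\phi$, the von Neumann algebra $\pi(\mathfrak A)''$ is a factor.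
   Context: $M_d=M_d(\mathbb C)$; $\mathfrak B=\bigotimes_{i\in\mathbb Z}\mathfrak B_i$ is the infinite $C^*$-tensor product with $\mathfrak B_i=M_d$; $\mathfrak B_{[-n,m]}=\bigotimes_{i=-n}^m\mathfrak B_i$. A state $\tilde\phi$ on $\mathfrak B$ is a $C^*$-finitely correlated state generated by $(M_d,E,\rho)$ if $E:M_d\otimes M_d\to M_d$ is completely positive, $\rho$ is a state on $M_d$ with $\rho(E(I\otimes C))=\rho(C)$ for all $C\in M_d$, and $\tilde\phi(A_1\otimes\cdots\otimes A_n)=\rho(E(A_1\otimes E(A_2\otimes\cdots\otimes E(A_n\otimes I)\cdots)))$ for all $A_1,\dots,A_n\in M_d$, where $A_1\otimes\cdots\otimes A_n$ is placed on any $n$ consecutive sites. For $g\in G$, $\alpha_g$ is the automorphism of $\mathfrak B$ acting as $\mathrm{Ad}\,g$ on every tensor factor. $\mathfrak A_{[-n,m]}=\{B\in\mathfrak B_{[-n,m]}:\alpha_g(B)=B\text{ for all }g\in G\}$ and $\mathfrak A=\overline{\bigcup_{n\ge1}\mathfrak A_{[-n,n]}}$ (norm closure). "$\tilde\phi$ is faithful" means that its normal extension $\langle\xi,\,\cdot\,\xi\rangle$ to $\pi(\mathfrak B)''$ is faithful, i.e. $\xi$ is separating for $\pi(\mathfrak B)''$. A state is a factor state if the von Neumann algebra generated by its GNS representation is a factor. *)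

theory Defs
  imports "HOL-Analysis.Analysis"
begin

section \<open>Complex Hilbert spaces\<close>

text \<open>The inner product is linear in the \<^emph>\<open>second\<close> argument. Positive definiteness is contained
  in \<open>norm_eq_sqrt_cinner\<close>, since \<open>sqrt\<close> is strictly increasing on all reals.\<close>

class complex_hilbert = banach +
  fixes scaleC :: "complex \<Rightarrow> 'a \<Rightarrow> 'a" (infixr \<open>*\<^sub>C\<close> 75)
    and cinner :: "'a \<Rightarrow> 'a \<Rightarrow> complex"
  assumes scaleC_add_right: "c *\<^sub>C (x + y) = c *\<^sub>C x + c *\<^sub>C y"
    and scaleC_add_left: "(c + d) *\<^sub>C x = c *\<^sub>C x + d *\<^sub>C x"
    and scaleC_scaleC: "c *\<^sub>C d *\<^sub>C x = (c * d) *\<^sub>C x"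
    and scaleR_scaleC: "r *\<^sub>R x = complex_of_real r *\<^sub>C x"
    and cinner_commute: "cinner x y = cnj (cinner y x)"
    and cinner_add_right: "cinner x (y + z) = cinner x y + cinner x z"
    and cinner_scaleC_right: "cinner x (c *\<^sub>C y) = c * cinner x y"
    and norm_eq_sqrt_cinner: "norm x = sqrt (Re (cinner x x))"


section \<open>The Hilbert space \<open>\<ell>\<^sup>2\<close>\<close>

definition square_summable :: "('a \<Rightarrow> complex) \<Rightarrow> bool" where
  "square_summable f \<longleftrightarrow> (\<lambda>x. (cmod (f x))\<^sup>2) summable_on UNIV"

typedef 'a ell2 = "{f :: 'a \<Rightarrow> complex. square_summable f}"
  morphisms ell2_fun Abs_ell2
  by (rule exI[of _ "\<lambda>_. 0"]) (simp add: square_summable_def)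

lemma square_summable_iff:
  "square_summable f \<longleftrightarrow> (\<exists>c. \<forall>F. finite F \<longrightarrow> L2_set (\<lambda>x. cmod (f x)) F \<le> c)"
proof
  assume s: "square_summable f"
  have "L2_set (\<lambda>x. cmod (f x)) F \<le> sqrt (\<Sum>\<^sub>\<infinity>x. (cmod (f x))\<^sup>2)" if "finite F" for F
    unfolding L2_set_def using s that
    by (intro real_sqrt_le_mono finite_sum_le_infsum) (auto simp: square_summable_def)
  then show "\<exists>c. \<forall>F. finite F \<longrightarrow> L2_set (\<lambda>x. cmod (f x)) F \<le> c" by blast
next
  assume "\<exists>c. \<forall>F. finite F \<longrightarrow> L2_set (\<lambda>x. cmod (f x)) F \<le> c"
  then obtain c where c: "\<And>F. finite F \<Longrightarrow> L2_set (\<lambda>x. cmod (f x)) F \<le> c" by blast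
  have "(\<Sum>x\<in>F. (cmod (f x))\<^sup>2) \<le> c\<^sup>2" if "finite F" for F
  proof -
    have "(L2_set (\<lambda>x. cmod (f x)) F)\<^sup>2 \<le> c\<^sup>2"
      by (rule power_mono[OF c[OF that]]) simp
    then show ?thesis by (simp add: L2_set_def sum_nonneg)
  qed
  then show "square_summable f" unfolding square_summable_def
    by (intro nonneg_bdd_above_summable_on) (auto simp: bdd_above_def)
qed

lemma square_summable_0: "square_summable (\<lambda>_. 0)"
  by (simp add: square_summable_def)

lemma square_summable_add:
  assumes "square_summable f" "square_summable g"
  shows "square_summable (\<lambda>x. f x + g x)"
proof -
  obtain c d where c: "\<And>F. finite F \<Longrightarrow> L2_set (\<lambda>x. cmod (f x)) F \<le> c"
    and d: "\<And>F. finite F \<Longrightarrow> L2_set (\<lambda>x. cmod (g x)) F \<le> d"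
    using assms unfolding square_summable_iff by blast
  have "L2_set (\<lambda>x. cmod (f x + g x)) F \<le> c + d" if "finite F" for F
  proof -
    have "L2_set (\<lambda>x. cmod (f x + g x)) F \<le> L2_set (\<lambda>x. cmod (f x) + cmod (g x)) F"
      by (intro L2_set_mono norm_triangle_ineq norm_ge_zero)
    also have "\<dots> \<le> L2_set (\<lambda>x. cmod (f x)) F + L2_set (\<lambda>x. cmod (g x)) F"
      by (rule L2_set_triangle_ineq)
    also have "\<dots> \<le> c + d" using c d that by (intro add_mono)
    finally show ?thesis .
  qed
  then show ?thesis unfolding square_summable_iff by blast
qed

lemma square_summable_mult:
  assumes "square_summable f"
  shows "square_summable (\<lambda>x. c * f x)"
  using assms unfolding square_summable_def
  by (simp add: norm_mult power_mult_distrib summable_on_cmult_right)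

lemma square_summable_sum:
  assumes "\<And>s. s \<in> S \<Longrightarrow> square_summable (f s)"
  shows "square_summable (\<lambda>x. \<Sum>s\<in>S. f s x)"
  using assms by (induction S rule: infinite_finite_induct)
    (auto simp: square_summable_0 intro: square_summable_add)

instantiation ell2 :: (type) real_normed_vector
begin

definition zero_ell2 :: "'a ell2" where "0 = Abs_ell2 (\<lambda>_. 0)"
definition plus_ell2 :: "'a ell2 \<Rightarrow> 'a ell2 \<Rightarrow> 'a ell2" where
  "x + y = Abs_ell2 (\<lambda>a. ell2_fun x a + ell2_fun y a)"
definition scaleR_ell2 :: "real \<Rightarrow> 'a ell2 \<Rightarrow> 'a ell2" where
  "r *\<^sub>R x = Abs_ell2 (\<lambda>a. complex_of_real r * ell2_fun x a)"
definition uminus_ell2 :: "'a ell2 \<Rightarrow> 'a ell2" where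
  "- x = (- 1) *\<^sub>R (x :: 'a ell2)"
definition minus_ell2 :: "'a ell2 \<Rightarrow> 'a ell2 \<Rightarrow> 'a ell2" where "x - y = x + (- y :: 'a ell2)"
definition norm_ell2 :: "'a ell2 \<Rightarrow> real" where
  "norm (x :: 'a ell2) = sqrt (\<Sum>\<^sub>\<infinity>a. (cmod (ell2_fun x a))\<^sup>2)"
definition dist_ell2 :: "'a ell2 \<Rightarrow> 'a ell2 \<Rightarrow> real" where "dist x y = norm (x - y :: 'a ell2)"
definition sgn_ell2 :: "'a ell2 \<Rightarrow> 'a ell2" where
  "sgn x = inverse (norm x) *\<^sub>R (x :: 'a ell2)"
definition uniformity_ell2 :: "('a ell2 \<times> 'a ell2) filter" where
  "uniformity_ell2 = (INF e\<in>{0 <..}. principal {(x, y). dist x y < e})"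
definition open_ell2 :: "'a ell2 set \<Rightarrow> bool" where
  "open_ell2 S = (\<forall>x\<in>S. \<forall>\<^sub>F (x', y) in uniformity. x' = x \<longrightarrow> y \<in> S)"

lemma ell2_fun_square_summable: "square_summable (ell2_fun x)"
  using ell2_fun by auto

lemma ell2_fun_0 [simp]: "ell2_fun 0 a = 0"
  by (simp add: zero_ell2_def Abs_ell2_inverse square_summable_0)

lemma ell2_fun_add [simp]: "ell2_fun (x + y) a = ell2_fun x a + ell2_fun y a"
  by (simp add: plus_ell2_def Abs_ell2_inverse square_summable_add ell2_fun_square_summable)

lemma ell2_fun_scaleR [simp]: "ell2_fun (r *\<^sub>R x) a = complex_of_real r * ell2_fun x a"
  by (simp add: scaleR_ell2_def Abs_ell2_inverse square_summable_mult ell2_fun_square_summable)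

lemma ell2_fun_uminus [simp]: "ell2_fun (- x) a = - ell2_fun x a"
  by (simp add: uminus_ell2_def)

lemma ell2_fun_minus [simp]: "ell2_fun (x - y) a = ell2_fun x a - ell2_fun y a"
  by (simp add: minus_ell2_def)

lemma ell2_eqI: "(\<And>a. ell2_fun x a = ell2_fun y a) \<Longrightarrow> x = y"
  by (metis ell2_fun_inject ext)

lemma L2_set_le_norm_ell2:
  assumes "finite F" shows "L2_set (\<lambda>a. cmod (ell2_fun x a)) F \<le> norm x"
  unfolding L2_set_def norm_ell2_def
  using ell2_fun_square_summable[of x] assms
  by (intro real_sqrt_le_mono finite_sum_le_infsum) (auto simp: square_summable_def)

lemma norm_ell2_le:
  assumes "\<And>F. finite F \<Longrightarrow> L2_set (\<lambda>a. cmod (ell2_fun x a)) F \<le> c"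
  shows "norm x \<le> c"
proof -
  have c: "0 \<le> c" using assms[of "{}"] by simp
  have "(\<Sum>\<^sub>\<infinity>a. (cmod (ell2_fun x a))\<^sup>2) \<le> c\<^sup>2"
  proof (rule infsum_le_finite_sums)
    show "(\<lambda>a. (cmod (ell2_fun x a))\<^sup>2) summable_on UNIV"
      using ell2_fun_square_summable[of x] by (simp add: square_summable_def)
    fix F :: "'a set" assume "finite F"
    then have "(L2_set (\<lambda>a. cmod (ell2_fun x a)) F)\<^sup>2 \<le> c\<^sup>2"
      by (intro power_mono assms) simp_all
    then show "(\<Sum>a\<in>F. (cmod (ell2_fun x a))\<^sup>2) \<le> c\<^sup>2"
      by (simp add: L2_set_def sum_nonneg)
  qed
  then show ?thesis unfolding norm_ell2_def using c by (rule real_le_lsqrt[rotated])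
qed

lemma cmod_le_norm_ell2: "cmod (ell2_fun x a) \<le> norm x"
  using L2_set_le_norm_ell2[of "{a}" x] by simp

instance
proof
  fix x y z :: "'a ell2" and r s :: real
  show "x + y + z = x + (y + z)" by (rule ell2_eqI) simp
  show "x + y = y + x" by (rule ell2_eqI) simp
  show "0 + x = x" by (rule ell2_eqI) simp
  show "- x + x = 0" by (rule ell2_eqI) simp
  show "x - y = x + - y" by (rule ell2_eqI) simp
  show "r *\<^sub>R (x + y) = r *\<^sub>R x + r *\<^sub>R y" by (rule ell2_eqI) (simp add: algebra_simps)
  show "(r + s) *\<^sub>R x = r *\<^sub>R x + s *\<^sub>R x" by (rule ell2_eqI) (simp add: algebra_simps)
  show "r *\<^sub>R s *\<^sub>R x = (r * s) *\<^sub>R x" by (rule ell2_eqI) simp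
  show "1 *\<^sub>R x = x" by (rule ell2_eqI) simp
  show "dist x y = norm (x - y)" by (rule dist_ell2_def)
  show "sgn x = inverse (norm x) *\<^sub>R x" by (rule sgn_ell2_def)
  show "uniformity = (INF e\<in>{0<..}. principal {(x, y :: 'a ell2). dist x y < e})"
    by (rule uniformity_ell2_def)
  show "open S = (\<forall>x\<in>S. \<forall>\<^sub>F (x', y) in uniformity. x' = x \<longrightarrow> y \<in> S)" for S :: "'a ell2 set"
    by (rule open_ell2_def)
  show "(norm x = 0) = (x = 0)"
  proof
    assume "norm x = 0"
    then have "cmod (ell2_fun x a) = 0" for a
      using cmod_le_norm_ell2[of x a] by simp
    then show "x = 0" by (intro ell2_eqI) simp
  qed (simp add: norm_ell2_def)
  show "norm (x + y) \<le> norm x + norm y"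
  proof (rule norm_ell2_le)
    fix F :: "'a set" assume F: "finite F"
    have "L2_set (\<lambda>a. cmod (ell2_fun (x + y) a)) F
        \<le> L2_set (\<lambda>a. cmod (ell2_fun x a) + cmod (ell2_fun y a)) F"
      by (intro L2_set_mono) (auto intro: norm_triangle_ineq)
    also have "\<dots> \<le> L2_set (\<lambda>a. cmod (ell2_fun x a)) F + L2_set (\<lambda>a. cmod (ell2_fun y a)) F"
      by (rule L2_set_triangle_ineq)
    also have "\<dots> \<le> norm x + norm y" using F by (intro add_mono L2_set_le_norm_ell2)
    finally show "L2_set (\<lambda>a. cmod (ell2_fun (x + y) a)) F \<le> norm x + norm y" .
  qed
  show "norm (r *\<^sub>R x) = \<bar>r\<bar> * norm x"
    by (simp add: norm_ell2_def norm_mult power_mult_distrib infsum_cmult_right' real_sqrt_mult)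
qed

end

lemma ell2_complete:
  fixes X :: "nat \<Rightarrow> 'a ell2"
  assumes cau: "\<And>e. e > 0 \<Longrightarrow> \<exists>N. \<forall>m\<ge>N. \<forall>n\<ge>N. norm (X m - X n) < e"
  shows "\<exists>L. \<forall>e>0. \<exists>N. \<forall>n\<ge>N. norm (X n - L) \<le> e"
proof -
  have "Cauchy (\<lambda>n. ell2_fun (X n) a)" for a
  proof (rule metric_CauchyI)
    fix e :: real assume "e > 0"
    then obtain N where N: "\<forall>m\<ge>N. \<forall>n\<ge>N. norm (X m - X n) < e" using cau by blast
    have "dist (ell2_fun (X m) a) (ell2_fun (X n) a) < e" if "m \<ge> N" "n \<ge> N" for m n
      using cmod_le_norm_ell2[of "X m - X n" a] N that by (fastforce simp: dist_norm)
    then show "\<exists>M. \<forall>m\<ge>M. \<forall>n\<ge>M. dist (ell2_fun (X m) a) (ell2_fun (X n) a) < e" by blast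
  qed
  then have "\<exists>l. (\<lambda>n. ell2_fun (X n) a) \<longlonglongrightarrow> l" for a
    using Cauchy_convergent convergent_def by blast
  then obtain l where l: "\<And>a. (\<lambda>n. ell2_fun (X n) a) \<longlonglongrightarrow> l a" by metis
  have bound: "L2_set (\<lambda>a. cmod (ell2_fun (X n) a - l a)) F \<le> e"
    if N: "\<forall>m\<ge>N. \<forall>n\<ge>N. norm (X m - X n) < e" and n: "n \<ge> N" and "finite F" for e N n F
  proof (rule LIMSEQ_le_const2)
    show "(\<lambda>m. L2_set (\<lambda>a. cmod (ell2_fun (X n) a - ell2_fun (X m) a)) F)
        \<longlonglongrightarrow> L2_set (\<lambda>a. cmod (ell2_fun (X n) a - l a)) F"
      unfolding L2_set_def by (intro tendsto_intros l)
    have "L2_set (\<lambda>a. cmod (ell2_fun (X n) a - ell2_fun (X m) a)) F \<le> e" if "m \<ge> N" for m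
    proof -
      have "norm (X n - X m) < e" using N n that by blast
      with L2_set_le_norm_ell2[OF \<open>finite F\<close>, of "X n - X m"] show ?thesis by simp
    qed
    then show "\<exists>M. \<forall>m\<ge>M. L2_set (\<lambda>a. cmod (ell2_fun (X n) a - ell2_fun (X m) a)) F \<le> e"
      by blast
  qed
  obtain N1 where N1: "\<forall>m\<ge>N1. \<forall>n\<ge>N1. norm (X m - X n) < 1" using cau[of 1] by auto
  have "square_summable (\<lambda>a. ell2_fun (X N1) a - l a)"
    unfolding square_summable_iff using bound[OF N1 order_refl] by blast
  from square_summable_add[OF ell2_fun_square_summable[of "X N1"] square_summable_mult[OF this, of "-1"]]
  have "square_summable l" by simp
  then have L: "ell2_fun (Abs_ell2 l) = l" by (simp add: Abs_ell2_inverse)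
  have "\<exists>N. \<forall>n\<ge>N. norm (X n - Abs_ell2 l) \<le> e" if e: "e > 0" for e
  proof -
    obtain N where N: "\<forall>m\<ge>N. \<forall>n\<ge>N. norm (X m - X n) < e" using cau[OF e] by blast
    have "norm (X n - Abs_ell2 l) \<le> e" if "n \<ge> N" for n
      by (rule norm_ell2_le) (use bound[OF N that] L in simp)
    then show ?thesis by blast
  qed
  then show ?thesis by blast
qed

instance ell2 :: (type) banach
proof
  fix X :: "nat \<Rightarrow> 'a ell2" assume C: "Cauchy X"
  have dist: "dist x y = norm (x - y)" for x y :: "'a ell2" by (rule dist_ell2_def)
  have "\<exists>N. \<forall>m\<ge>N. \<forall>n\<ge>N. norm (X m - X n) < e" if "e > 0" for e
    using metric_CauchyD[OF C that] by (simp add: dist)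
  from ell2_complete[OF this] obtain L
    where L: "\<And>e. e > 0 \<Longrightarrow> \<exists>N. \<forall>n\<ge>N. norm (X n - L) \<le> e" by blast
  have "X \<longlonglongrightarrow> L"
  proof (rule metric_LIMSEQ_I)
    fix e :: real assume "e > 0"
    then obtain N where "\<forall>n\<ge>N. norm (X n - L) \<le> e / 2" using L[of "e / 2"] by auto
    then have "\<forall>n\<ge>N. dist (X n) L < e" using \<open>e > 0\<close> by (force simp: dist)
    then show "\<exists>N. \<forall>n\<ge>N. dist (X n) L < e" by blast
  qed
  then show "convergent X" by (rule convergentI)
qed

instantiation ell2 :: (type) complex_hilbert
begin

definition scaleC_ell2 :: "complex \<Rightarrow> 'a ell2 \<Rightarrow> 'a ell2" where
  "c *\<^sub>C x = Abs_ell2 (\<lambda>a. c * ell2_fun x a)"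
definition cinner_ell2 :: "'a ell2 \<Rightarrow> 'a ell2 \<Rightarrow> complex" where
  "cinner x y = (\<Sum>\<^sub>\<infinity>a. cnj (ell2_fun x a) * ell2_fun y a)"

lemma ell2_fun_scaleC [simp]: "ell2_fun (c *\<^sub>C x) a = c * ell2_fun x a"
  by (simp add: scaleC_ell2_def Abs_ell2_inverse square_summable_mult ell2_fun_square_summable)

lemma cinner_ell2_summable: "(\<lambda>a. cnj (ell2_fun x a) * ell2_fun y a) summable_on UNIV"
proof -
  have "(\<lambda>a. norm (cnj (ell2_fun x a) * ell2_fun y a)) summable_on UNIV"
    using abs_summable_product[of "\<lambda>a. cnj (ell2_fun x a)" UNIV "ell2_fun y"]
      ell2_fun_square_summable[of x] ell2_fun_square_summable[of y]
    by (simp add: square_summable_def norm_power norm_mult power2_eq_square)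
  then show ?thesis by (rule abs_summable_summable)
qed

instance
proof
  fix x y z :: "'a ell2" and c d :: complex and r :: real
  show "c *\<^sub>C (x + y) = c *\<^sub>C x + c *\<^sub>C y" by (rule ell2_eqI) (simp add: algebra_simps)
  show "(c + d) *\<^sub>C x = c *\<^sub>C x + d *\<^sub>C x" by (rule ell2_eqI) (simp add: algebra_simps)
  show "c *\<^sub>C d *\<^sub>C x = (c * d) *\<^sub>C x" by (rule ell2_eqI) simp
  show "r *\<^sub>R x = complex_of_real r *\<^sub>C x" by (rule ell2_eqI) simp
  show "cinner x y = cnj (cinner y x)"
    by (simp add: cinner_ell2_def flip: infsum_cnj) (simp add: mult.commute)
  show "cinner x (y + z) = cinner x y + cinner x z"
    by (simp add: cinner_ell2_def distrib_left infsum_add cinner_ell2_summable)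
  show "cinner x (c *\<^sub>C y) = c * cinner x y"
    by (simp add: cinner_ell2_def mult.left_commute infsum_cmult_right')
  have "cinner x x = (\<Sum>\<^sub>\<infinity>a. complex_of_real ((cmod (ell2_fun x a))\<^sup>2))"
    unfolding cinner_ell2_def by (simp only: complex_norm_square mult.commute)
  also have "\<dots> = complex_of_real (\<Sum>\<^sub>\<infinity>a. (cmod (ell2_fun x a))\<^sup>2)"
    using ell2_fun_square_summable[of x]
    by (intro infsumI has_sum_of_real has_sum_infsum) (simp add: square_summable_def)
  finally show "norm x = sqrt (Re (cinner x x))" by (simp add: norm_ell2_def)
qed

end


section \<open>Operators and von Neumann algebras\<close>

definition bounded_clinear :: "('a::complex_hilbert \<Rightarrow> 'b::complex_hilbert) \<Rightarrow> bool" where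
  "bounded_clinear T \<longleftrightarrow> bounded_linear T \<and> (\<forall>c x. T (c *\<^sub>C x) = c *\<^sub>C T x)"

definition hadj :: "('a::complex_hilbert \<Rightarrow> 'a) \<Rightarrow> 'a \<Rightarrow> 'a" where
  "hadj T = (THE S. bounded_clinear S \<and> (\<forall>x y. cinner (T x) y = cinner x (S y)))"

definition commutant :: "('a::complex_hilbert \<Rightarrow> 'a) set \<Rightarrow> ('a \<Rightarrow> 'a) set" where
  "commutant S = {T. bounded_clinear T \<and> (\<forall>A\<in>S. T \<circ> A = A \<circ> T)}"

definition bicommutant :: "('a::complex_hilbert \<Rightarrow> 'a) set \<Rightarrow> ('a \<Rightarrow> 'a) set" where
  "bicommutant S = commutant (commutant S)"

definition von_neumann_algebra :: "('a::complex_hilbert \<Rightarrow> 'a) set \<Rightarrow> bool" where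
  "von_neumann_algebra N \<longleftrightarrow>
     (\<forall>T\<in>N. bounded_clinear T \<and> hadj T \<in> N) \<and> bicommutant N = N"

definition factor :: "('a::complex_hilbert \<Rightarrow> 'a) set \<Rightarrow> bool" where
  "factor N \<longleftrightarrow> von_neumann_algebra N \<and> N \<inter> commutant N = range (\<lambda>c x. c *\<^sub>C x)"

definition separating :: "'a::complex_hilbert \<Rightarrow> ('a \<Rightarrow> 'a) set \<Rightarrow> bool" where
  "separating \<xi> N \<longleftrightarrow> (\<forall>T\<in>N. T \<xi> = 0 \<longrightarrow> T = (\<lambda>_. 0))"

definition op_closure :: "('a::complex_hilbert \<Rightarrow> 'a) set \<Rightarrow> ('a \<Rightarrow> 'a) set" where
  "op_closure S = {T. bounded_clinear T \<and> (\<forall>e>0. \<exists>A\<in>S. onorm (\<lambda>x. T x - A x) < e)}"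


section \<open>States and GNS representations\<close>

text \<open>Here \<open>\<AA>\<close> is a unital \<open>C\<^sup>*\<close>-algebra of operators on a Hilbert space, with composition as
  product. Only the values on \<open>\<AA>\<close> of a functional or a representation matter.\<close>

definition state_on :: "('a::complex_hilbert \<Rightarrow> 'a) set \<Rightarrow> (('a \<Rightarrow> 'a) \<Rightarrow> complex) \<Rightarrow> bool" where
  "state_on \<AA> \<phi> \<longleftrightarrow>
     (\<forall>S\<in>\<AA>. \<forall>T\<in>\<AA>. \<phi> (\<lambda>x. S x + T x) = \<phi> S + \<phi> T) \<and>
     (\<forall>c. \<forall>T\<in>\<AA>. \<phi> (\<lambda>x. c *\<^sub>C T x) = c * \<phi> T) \<and>
     (\<forall>T\<in>\<AA>. \<phi> (hadj T \<circ> T) \<in> \<real>\<^sub>\<ge>\<^sub>0) \<and>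
     \<phi> id = 1"

definition representation_on ::
    "('a::complex_hilbert \<Rightarrow> 'a) set \<Rightarrow> (('a \<Rightarrow> 'a) \<Rightarrow> ('h::complex_hilbert \<Rightarrow> 'h)) \<Rightarrow> bool" where
  "representation_on \<AA> \<pi> \<longleftrightarrow>
     (\<forall>T\<in>\<AA>. bounded_clinear (\<pi> T)) \<and>
     (\<forall>S\<in>\<AA>. \<forall>T\<in>\<AA>. \<pi> (\<lambda>x. S x + T x) = (\<lambda>y. \<pi> S y + \<pi> T y)) \<and>
     (\<forall>c. \<forall>T\<in>\<AA>. \<pi> (\<lambda>x. c *\<^sub>C T x) = (\<lambda>y. c *\<^sub>C \<pi> T y)) \<and>
     (\<forall>S\<in>\<AA>. \<forall>T\<in>\<AA>. \<pi> (S \<circ> T) = \<pi> S \<circ> \<pi> T) \<and>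
     (\<forall>T\<in>\<AA>. \<pi> (hadj T) = hadj (\<pi> T)) \<and>
     \<pi> id = id"

text \<open>The GNS triple is determined only up to unitary equivalence; its Hilbert space is the
  type \<open>'h\<close>.\<close>

definition gns_triple ::
    "('a::complex_hilbert \<Rightarrow> 'a) set \<Rightarrow> (('a \<Rightarrow> 'a) \<Rightarrow> complex) \<Rightarrow>
     (('a \<Rightarrow> 'a) \<Rightarrow> ('h::complex_hilbert \<Rightarrow> 'h)) \<Rightarrow> 'h \<Rightarrow> bool" where
  "gns_triple \<AA> \<phi> \<pi> \<xi> \<longleftrightarrow>
     representation_on \<AA> \<pi> \<and>
     (\<forall>T\<in>\<AA>. \<phi> T = cinner \<xi> (\<pi> T \<xi>)) \<and>
     closure ((\<lambda>T. \<pi> T \<xi>) ` \<AA>) = UNIV"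

text \<open>The type argument names the Hilbert space on which GNS triples are considered, since a
  definition cannot quantify over types.\<close>

definition factor_state ::
    "'h::complex_hilbert itself \<Rightarrow> ('a::complex_hilbert \<Rightarrow> 'a) set \<Rightarrow>
     (('a \<Rightarrow> 'a) \<Rightarrow> complex) \<Rightarrow> bool" where
  "factor_state _ \<AA> \<phi> \<longleftrightarrow> state_on \<AA> \<phi> \<and>
     (\<forall>(\<pi> :: ('a \<Rightarrow> 'a) \<Rightarrow> 'h \<Rightarrow> 'h) \<xi>. gns_triple \<AA> \<phi> \<pi> \<xi> \<longrightarrow> factor (bicommutant (\<pi> ` \<AA>)))"


section \<open>Matrix algebras\<close>

type_synonym 'd cmat = "complex^'d^'d"

definition cadj :: "'d::finite cmat \<Rightarrow> 'd cmat" where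
  "cadj A = (\<chi> i j. cnj (A $ j $ i))"

definition cscale :: "complex \<Rightarrow> 'd::finite cmat \<Rightarrow> 'd cmat" where
  "cscale c A = (\<chi> i j. c * A $ i $ j)"

text \<open>\<open>M\<^sub>d \<otimes> M\<^sub>d\<close> is realised as the matrices indexed by pairs.\<close>

definition kron :: "'d::finite cmat \<Rightarrow> 'd cmat \<Rightarrow> ('d \<times> 'd) cmat" (infixr \<open>\<otimes>\<^sub>m\<close> 70) where
  "A \<otimes>\<^sub>m B = (\<chi> p q. A $ fst p $ fst q * B $ snd p $ snd q)"

definition unitary_mat :: "'d::finite cmat \<Rightarrow> bool" where
  "unitary_mat g \<longleftrightarrow> cadj g ** g = mat 1 \<and> g ** cadj g = mat 1"

definition discrete_unitary_subgroup :: "'d::finite cmat set \<Rightarrow> bool" where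
  "discrete_unitary_subgroup G \<longleftrightarrow>
     (\<forall>g\<in>G. unitary_mat g) \<and> mat 1 \<in> G \<and> (\<forall>g\<in>G. \<forall>h\<in>G. g ** h \<in> G) \<and>
     (\<forall>g\<in>G. cadj g \<in> G) \<and> discrete G"

definition mat_state :: "('d::finite cmat \<Rightarrow> complex) \<Rightarrow> bool" where
  "mat_state \<rho> \<longleftrightarrow>
     (\<forall>A B. \<rho> (A + B) = \<rho> A + \<rho> B) \<and> (\<forall>c A. \<rho> (cscale c A) = c * \<rho> A) \<and>
     (\<forall>A. \<rho> (cadj A ** A) \<in> \<real>\<^sub>\<ge>\<^sub>0) \<and> \<rho> (mat 1) = 1"

text \<open>Positivity of the \<open>n \<times> n\<close> matrix \<open>(X p q)\<close> over \<open>M\<^sub>m\<close>, acting on the \<open>n\<close>-fold direct sum of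
  \<open>\<complex>\<^sup>m\<close>.\<close>

definition block_positive :: "nat \<Rightarrow> (nat \<Rightarrow> nat \<Rightarrow> 'm::finite cmat) \<Rightarrow> bool" where
  "block_positive n X \<longleftrightarrow> (\<forall>v :: nat \<Rightarrow> complex^'m.
     (\<Sum>p<n. \<Sum>q<n. \<Sum>i\<in>UNIV. \<Sum>j\<in>UNIV. cnj (v p $ i) * X p q $ i $ j * v q $ j) \<in> \<real>\<^sub>\<ge>\<^sub>0)"

definition completely_positive :: "('m::finite cmat \<Rightarrow> 'k::finite cmat) \<Rightarrow> bool" where
  "completely_positive E \<longleftrightarrow>
     (\<forall>A B. E (A + B) = E A + E B) \<and> (\<forall>c A. E (cscale c A) = cscale c (E A)) \<and>
     (\<forall>n X. block_positive n X \<longrightarrow> block_positive n (\<lambda>p q. E (X p q)))"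


section \<open>The infinite tensor product of matrix algebras over the integers\<close>

text \<open>The local algebra is represented faithfully on \<open>\<ell>\<^sup>2\<close> of \<^emph>\<open>all\<close> configurations
  \<open>\<int> \<rightarrow> {1,\<dots>,d}\<close>, a matrix at site \<open>i\<close> acting on the \<open>i\<close>-th coordinate. On finitely many sites this is
  a multiple of the defining representation of \<open>M\<^sub>d \<otimes> \<dots> \<otimes> M\<^sub>d\<close>, so the operator norm
  is the \<open>C\<^sup>*\<close>-norm of the finite tensor product, and the norm closure of the local algebra is the
  infinite \<open>C\<^sup>*\<close>-tensor product.\<close>

type_synonym 'd chain = "(int \<Rightarrow> 'd) ell2"

definition site_op :: "int \<Rightarrow> 'd::finite cmat \<Rightarrow> 'd chain \<Rightarrow> 'd chain" where
  "site_op i A \<psi> = Abs_ell2 (\<lambda>\<sigma>. \<Sum>s\<in>UNIV. A $ \<sigma> i $ s * ell2_fun \<psi> (\<sigma>(i := s)))"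

text \<open>\<open>A\<^sub>1 \<otimes> \<dots> \<otimes> A\<^sub>n\<close> placed on the sites \<open>k, \<dots>, k + n - 1\<close>:\<close>

primrec tensor_at :: "int \<Rightarrow> 'd::finite cmat list \<Rightarrow> 'd chain \<Rightarrow> 'd chain" where
  "tensor_at k [] = id"
| "tensor_at k (A # As) = site_op k A \<circ> tensor_at (k + 1) As"

text \<open>The subalgebra of the sites \<open>a, \<dots>, b\<close>, i.e. the linear span of its elementary tensors:\<close>

definition local_alg :: "int \<Rightarrow> int \<Rightarrow> ('d::finite chain \<Rightarrow> 'd chain) set" where
  "local_alg a b = {T. \<exists>(N::nat) c As. (\<forall>k<N. length (As k) = nat (b - a + 1)) \<and>
     T = (\<lambda>\<psi>. \<Sum>k<N. c k *\<^sub>C tensor_at a (As k) \<psi>)}"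

definition chain_alg :: "('d::finite chain \<Rightarrow> 'd chain) set" where
  "chain_alg = op_closure (\<Union>n::nat. local_alg (- int n) (int n))"


section \<open>The gauge action and the gauge-invariant algebra\<close>

text \<open>For \<open>g\<close> unitary, \<open>gauge_aut g T\<close> is the limit of the conjugates of \<open>T\<close> by \<open>g \<otimes> \<dots> \<otimes> g\<close> on the
  sites \<open>-n, \<dots>, n\<close>. The sequence is eventually constant for local \<open>T\<close>, hence norm convergent for
  every \<open>T\<close> in \<open>chain_alg\<close>.\<close>

definition gauge_aut ::
    "'d::finite cmat \<Rightarrow> ('d chain \<Rightarrow> 'd chain) \<Rightarrow> ('d chain \<Rightarrow> 'd chain)" where
  "gauge_aut g T = (\<lambda>\<psi>. lim (\<lambda>n.
     (tensor_at (- int n) (replicate (2 * n + 1) g) \<circ> T \<circ>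
      tensor_at (- int n) (replicate (2 * n + 1) (cadj g))) \<psi>))"

definition gauge_local ::
    "'d::finite cmat set \<Rightarrow> int \<Rightarrow> int \<Rightarrow> ('d chain \<Rightarrow> 'd chain) set" where
  "gauge_local G a b = {B \<in> local_alg a b. \<forall>g\<in>G. gauge_aut g B = B}"

definition gauge_alg :: "'d::finite cmat set \<Rightarrow> ('d chain \<Rightarrow> 'd chain) set" where
  "gauge_alg G = op_closure (\<Union>n\<in>{1::nat..}. gauge_local G (- int n) (int n))"


section \<open>Finitely correlated states\<close>

definition finitely_correlated_state ::
    "(('d \<times> 'd) cmat \<Rightarrow> 'd::finite cmat) \<Rightarrow> ('d cmat \<Rightarrow> complex) \<Rightarrow>
     (('d chain \<Rightarrow> 'd chain) \<Rightarrow> complex) \<Rightarrow> bool" where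
  "finitely_correlated_state E \<rho> \<phi> \<longleftrightarrow>
     state_on chain_alg \<phi> \<and> completely_positive E \<and> mat_state \<rho> \<and>
     (\<forall>C. \<rho> (E (mat 1 \<otimes>\<^sub>m C)) = \<rho> C) \<and>
     (\<forall>k As. \<phi> (tensor_at k As) = \<rho> (foldr (\<lambda>A C. E (A \<otimes>\<^sub>m C)) As (mat 1)))"

definition gauge_covariant ::
    "'d::finite cmat set \<Rightarrow> (('d \<times> 'd) cmat \<Rightarrow> 'd cmat) \<Rightarrow> bool" where
  "gauge_covariant G E \<longleftrightarrow> (\<forall>g\<in>G. \<forall>A B.
     E ((g \<otimes>\<^sub>m g) ** (A \<otimes>\<^sub>m B) ** cadj (g \<otimes>\<^sub>m g)) = g ** E (A \<otimes>\<^sub>m B) ** cadj g)"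


section \<open>Consistency of the site operators and the gauge action\<close>

lemma square_summable_site:
  fixes f :: "(int \<Rightarrow> 'd::finite) \<Rightarrow> complex"
  assumes "square_summable f"
  shows "square_summable (\<lambda>\<sigma>. \<Sum>s\<in>UNIV. A $ \<sigma> i $ s * f (\<sigma>(i := s)))"
proof (rule square_summable_sum)
  fix s :: 'd
  define M where "M = (\<Sum>t\<in>UNIV. cmod (A $ t $ s))"
  have M: "cmod (A $ t $ s) \<le> M" for t
    unfolding M_def by (rule member_le_sum) auto
  let ?h = "\<lambda>\<sigma>. (cmod (f (\<sigma>(i := s))))\<^sup>2"
  have "?h summable_on {\<sigma>. \<sigma> i = t}" for t
  proof -
    have inj: "inj_on (\<lambda>\<sigma>. \<sigma>(i := s)) {\<sigma>. \<sigma> i = t}"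
      by (rule inj_onI) (metis (mono_tags, lifting) fun_upd_triv fun_upd_upd mem_Collect_eq)
    have "(\<lambda>\<sigma>. (cmod (f \<sigma>))\<^sup>2) summable_on (\<lambda>\<sigma>. \<sigma>(i := s)) ` {\<sigma>. \<sigma> i = t}"
      using assms unfolding square_summable_def
      by (rule summable_on_subset_banach) auto
    then show ?thesis by (simp add: summable_on_reindex[OF inj] o_def)
  qed
  then have "?h summable_on (\<Union>t\<in>UNIV. {\<sigma>. \<sigma> i = t})"
    by (intro summable_on_finite_union_disjoint) auto
  moreover have "(\<Union>t\<in>UNIV. {\<sigma>. \<sigma> i = t}) = (UNIV :: (int \<Rightarrow> 'd) set)" by auto
  ultimately have "(\<lambda>\<sigma>. M\<^sup>2 * ?h \<sigma>) summable_on UNIV"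
    by (simp add: summable_on_cmult_right)
  then have "(\<lambda>\<sigma>. (cmod (A $ \<sigma> i $ s * f (\<sigma>(i := s))))\<^sup>2) summable_on UNIV"
    by (rule summable_on_comparison_test)
      (auto simp: norm_mult power_mult_distrib intro!: mult_right_mono power_mono M)
  then show "square_summable (\<lambda>\<sigma>. A $ \<sigma> i $ s * f (\<sigma>(i := s)))"
    by (simp add: square_summable_def)
qed

lemma ell2_fun_site_op:
  "ell2_fun (site_op i A \<psi>) \<sigma> = (\<Sum>s\<in>UNIV. A $ \<sigma> i $ s * ell2_fun \<psi> (\<sigma>(i := s)))"
  by (simp add: site_op_def Abs_ell2_inverse square_summable_site ell2_fun_square_summable)

lemma site_op_mult: "site_op i A \<circ> site_op i B = site_op i (A ** B)"
proof (rule ext, rule ell2_eqI)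
  fix \<psi> :: "'a chain" and \<sigma>
  have "ell2_fun ((site_op i A \<circ> site_op i B) \<psi>) \<sigma>
      = (\<Sum>s\<in>UNIV. \<Sum>t\<in>UNIV. A $ \<sigma> i $ s * B $ s $ t * ell2_fun \<psi> (\<sigma>(i := t)))"
    by (simp add: ell2_fun_site_op sum_distrib_left mult.assoc)
  also have "\<dots> = (\<Sum>t\<in>UNIV. \<Sum>s\<in>UNIV. A $ \<sigma> i $ s * B $ s $ t * ell2_fun \<psi> (\<sigma>(i := t)))"
    by (rule sum.swap)
  also have "\<dots> = ell2_fun (site_op i (A ** B) \<psi>) \<sigma>"
    by (simp add: ell2_fun_site_op matrix_matrix_mult_def sum_distrib_right)
  finally show "ell2_fun ((site_op i A \<circ> site_op i B) \<psi>) \<sigma> = ell2_fun (site_op i (A ** B) \<psi>) \<sigma>" .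
qed

lemma site_op_1: "site_op i (mat 1) = id"
proof (rule ext, rule ell2_eqI)
  fix \<psi> :: "'a chain" and \<sigma>
  have "ell2_fun (site_op i (mat 1) \<psi>) \<sigma>
      = (\<Sum>s\<in>UNIV. if \<sigma> i = s then ell2_fun \<psi> (\<sigma>(i := s)) else 0)"
    unfolding ell2_fun_site_op by (rule sum.cong) (auto simp: mat_def)
  then show "ell2_fun (site_op i (mat 1) \<psi>) \<sigma> = ell2_fun (id \<psi>) \<sigma>" by simp
qed

lemma site_op_commute:
  assumes "i \<noteq> j" shows "site_op i A \<circ> site_op j B = site_op j B \<circ> site_op i A"
proof (rule ext, rule ell2_eqI)
  fix \<psi> :: "'a chain" and \<sigma>
  have "ell2_fun ((site_op i A \<circ> site_op j B) \<psi>) \<sigma>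
      = (\<Sum>s\<in>UNIV. \<Sum>t\<in>UNIV. A $ \<sigma> i $ s * (B $ \<sigma> j $ t * ell2_fun \<psi> (\<sigma>(i := s, j := t))))"
    using assms by (simp add: ell2_fun_site_op sum_distrib_left)
  also have "\<dots> = (\<Sum>t\<in>UNIV. \<Sum>s\<in>UNIV. A $ \<sigma> i $ s * (B $ \<sigma> j $ t * ell2_fun \<psi> (\<sigma>(i := s, j := t))))"
    by (rule sum.swap)
  also have "\<dots> = ell2_fun ((site_op j B \<circ> site_op i A) \<psi>) \<sigma>"
    using assms
    by (simp add: ell2_fun_site_op sum_distrib_left mult.left_commute fun_upd_twist)
  finally show "ell2_fun ((site_op i A \<circ> site_op j B) \<psi>) \<sigma>
      = ell2_fun ((site_op j B \<circ> site_op i A) \<psi>) \<sigma>" .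
qed

lemma tensor_at_conj:
  assumes "unitary_mat g"
  shows "tensor_at k (replicate N g) \<circ> site_op i A \<circ> tensor_at k (replicate N (cadj g))
    = site_op i (if k \<le> i \<and> i < k + int N then g ** A ** cadj g else A)"
proof (induction N arbitrary: k A)
  case (Suc N)
  have comm: "tensor_at (k + 1) (replicate N h) \<circ> site_op k B
      = site_op k B \<circ> tensor_at (k + 1) (replicate N h)" for h B
  proof -
    have "tensor_at l (replicate N h) \<circ> site_op k B = site_op k B \<circ> tensor_at l (replicate N h)"
      if "l > k" for l using that
    proof (induction N arbitrary: l)
      case (Suc N)
      have "tensor_at l (replicate (Suc N) h) \<circ> site_op k B
          = site_op l h \<circ> (tensor_at (l + 1) (replicate N h) \<circ> site_op k B)"
        by (simp add: o_assoc)
      also have "\<dots> = (site_op l h \<circ> site_op k B) \<circ> tensor_at (l + 1) (replicate N h)"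
      proof -
        have "tensor_at (l + 1) (replicate N h) \<circ> site_op k B
            = site_op k B \<circ> tensor_at (l + 1) (replicate N h)"
          by (rule Suc.IH) (use Suc.prems in simp)
        then show ?thesis by (simp only: o_assoc)
      qed
      also have "\<dots> = site_op k B \<circ> tensor_at l (replicate (Suc N) h)"
        using site_op_commute[of l k h B] Suc.prems by (simp add: o_assoc)
      finally show ?case .
    qed simp
    then show ?thesis by simp
  qed
  have "tensor_at k (replicate (Suc N) g) \<circ> site_op i A \<circ> tensor_at k (replicate (Suc N) (cadj g))
      = site_op k g \<circ> (tensor_at (k + 1) (replicate N g) \<circ> site_op i A \<circ>
          tensor_at (k + 1) (replicate N (cadj g))) \<circ> site_op k (cadj g)"
    using comm[of "cadj g" "cadj g"] by (simp add: o_assoc[symmetric])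
  also have "\<dots> = site_op k g \<circ> site_op i (if k + 1 \<le> i \<and> i < k + 1 + int N
      then g ** A ** cadj g else A) \<circ> site_op k (cadj g)"
    by (simp only: Suc.IH)
  also have "\<dots> = site_op i (if k \<le> i \<and> i < k + int (Suc N) then g ** A ** cadj g else A)"
  proof (cases "i = k")
    case True
    then show ?thesis by (simp add: site_op_mult)
  next
    case False
    have "site_op k g \<circ> site_op i B \<circ> site_op k (cadj g) = site_op i B" for B
    proof -
      have "site_op k g \<circ> site_op i B \<circ> site_op k (cadj g)
          = site_op i B \<circ> (site_op k g \<circ> site_op k (cadj g))"
        using site_op_commute[of k i g B] False by (simp add: o_assoc)
      then show ?thesis using assms by (simp add: site_op_mult unitary_mat_def site_op_1)
    qed
    then show ?thesis using False by simp
  qed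
  finally show ?case .
qed auto

lemma gauge_aut_site_op:
  assumes "unitary_mat g"
  shows "gauge_aut g (site_op i A) = site_op i (g ** A ** cadj g)"
proof
  fix \<psi>
  have "\<forall>\<^sub>F n in sequentially. (tensor_at (- int n) (replicate (2 * n + 1) g) \<circ> site_op i A \<circ>
      tensor_at (- int n) (replicate (2 * n + 1) (cadj g))) \<psi> = site_op i (g ** A ** cadj g) \<psi>"
    unfolding tensor_at_conj[OF assms]
    by (rule eventually_sequentiallyI[of "nat \<bar>i\<bar>"]) auto
  then show "gauge_aut g (site_op i A) \<psi> = site_op i (g ** A ** cadj g) \<psi>"
    unfolding gauge_aut_def by (intro limI tendsto_eventually)
qed

end

theory Submission
  imports Defs
begin

text \<open>The algebra \<open>gauge_alg G\<close> contains all transpositions of two sites, since \<open>\<Sum> e\<^sub>a\<^sub>b \<otimes> e\<^sub>b\<^sub>a\<close> commutes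
  with \<open>g \<otimes> g\<close> for every unitary \<open>g\<close>. Let \<open>M\<close> be the factor generated by the chain and let \<open>z \<in> M\<close>
  commute with the transpositions. The state is translation invariant; because \<open>M\<close> is a factor and
  the shift is asymptotically abelian, the mean ergodic theorem shows that far translates of an
  observable average to its expectation. If \<open>x\<^sub>k\<close> denotes \<open>x\<close> placed at distance \<open>k\<close>, then multiplying
  \<open>z (\<Sum> e\<^sub>a\<^sub>b (e\<^sub>b\<^sub>a)\<^sub>k) = (\<Sum> e\<^sub>a\<^sub>b (e\<^sub>b\<^sub>a)\<^sub>k) z\<close> from the left by \<open>x\<^sub>k\<close> and averaging over \<open>k\<close> shows that \<open>z\<close>
  commutes with \<open>\<Sum> \<phi>(x e\<^sub>b\<^sub>a) e\<^sub>a\<^sub>b\<close>. Faithfulness makes these slices exhaust \<open>M\<^sub>d\<close> as \<open>x\<close> varies, so \<open>z\<close>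
  commutes with every site and is a scalar. Averaging under \<open>z\<close> is possible because \<open>M' \<xi>\<close> is dense:
  \<open>y\<^sub>k \<xi>\<close> is approximated, uniformly in \<open>k\<close>, by vectors \<open>y'\<^sub>k \<xi>\<close> with \<open>y'\<^sub>k \<in> M'\<close>, which passes through \<open>z\<close>.\<close>


section \<open>Geometry of complex Hilbert spaces\<close>

text \<open>The swaps yield more than a trivial centre: every element of the bicommutant of the
  represented chain algebra that commutes with the gauge-invariant algebra is a scalar. This
  stronger form is needed because a GNS triple of the restricted state lives on a Hilbert space of
  its own, which corresponds only to the closure of the gauge-invariant algebra applied to
  \<open>\<xi>\<close>, in general a proper subspace. A central element there is lifted to an
  operator on the large space, and the lift is recognised as a scalar by its commutation alone.

  Boundedness of the lift, like contractivity of representations, is a positivity argument: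
  \<open>r^2 - hadj T T\<close> is written as a square inside a norm-closed algebra, obtained by a
  fixed point in place of a functional calculus.

  The averaging is carried out on the local algebra and not on its norm closure, because local
  operators commute exactly with all sufficiently distant translates. About \<open>z\<close>, which
  lies only in the bicommutant, no such commutation is known; this is what forces the detour through
  the commutant.\<close>

lemma scaleC_one [simp]: "1 *\<^sub>C x = (x :: 'a::complex_hilbert)"
  using scaleR_scaleC[of 1 x] by simp

lemma scaleC_zero_left [simp]: "0 *\<^sub>C x = (0 :: 'a::complex_hilbert)"
  using scaleR_scaleC[of 0 x] by simp

lemma scaleC_zero_right [simp]: "c *\<^sub>C 0 = (0 :: 'a::complex_hilbert)"
  using scaleC_add_right[of c 0 "0 :: 'a"] by simp

lemma scaleC_minus_right [simp]: "c *\<^sub>C (- x) = - (c *\<^sub>C (x :: 'a::complex_hilbert))"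
  using scaleC_add_right[of c x "- x"] by (simp add: eq_neg_iff_add_eq_0 add.commute)

lemma scaleC_minus_left [simp]: "(- c) *\<^sub>C x = - (c *\<^sub>C (x :: 'a::complex_hilbert))"
  using scaleC_add_left[of c "- c" x] by (simp add: eq_neg_iff_add_eq_0 add.commute)

lemma scaleC_diff_right: "c *\<^sub>C (x - y) = c *\<^sub>C x - c *\<^sub>C (y :: 'a::complex_hilbert)"
  using scaleC_add_right[of c x "- y"] by simp

lemma scaleC_left_commute: "a *\<^sub>C b *\<^sub>C (x :: 'a::complex_hilbert) = b *\<^sub>C a *\<^sub>C x"
  by (simp add: scaleC_scaleC mult.commute)

lemma cinner_add_left: "cinner (x + y) z = cinner x z + cinner (y :: 'a::complex_hilbert) z"
  by (metis cinner_add_right cinner_commute complex_cnj_add)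

lemma cinner_scaleC_left: "cinner (c *\<^sub>C x) y = cnj c * cinner (x :: 'a::complex_hilbert) y"
  by (metis cinner_scaleC_right cinner_commute complex_cnj_mult)

lemma cinner_zero_right [simp]: "cinner x (0 :: 'a::complex_hilbert) = 0"
  using cinner_scaleC_right[of x 0 0] by simp

lemma cinner_zero_left [simp]: "cinner (0 :: 'a::complex_hilbert) x = 0"
  by (metis cinner_commute cinner_zero_right complex_cnj_zero)

lemma cinner_minus_right: "cinner x (- y) = - cinner x (y :: 'a::complex_hilbert)"
  using cinner_add_right[of x y "- y"] by (simp add: eq_neg_iff_add_eq_0 add.commute)

lemma cinner_minus_left: "cinner (- x) y = - cinner (x :: 'a::complex_hilbert) y"
  by (metis cinner_minus_right cinner_commute complex_cnj_minus)

lemma cinner_diff_right: "cinner x (y - z) = cinner x y - cinner (x :: 'a::complex_hilbert) z"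
  using cinner_add_right[of x y "- z"] by (simp add: cinner_minus_right)

lemma cinner_diff_left: "cinner (x - y) z = cinner x z - cinner (y :: 'a::complex_hilbert) z"
  using cinner_add_left[of x "- y" z] by (simp add: cinner_minus_left)

lemma Re_cinner_self_nonneg: "0 \<le> Re (cinner x (x :: 'a::complex_hilbert))"
  using norm_ge_zero[of x] unfolding norm_eq_sqrt_cinner[of x] by simp

lemma cinner_self: "cinner x (x :: 'a::complex_hilbert) = complex_of_real ((norm x)\<^sup>2)"
proof -
  have "Im (cinner x x) = 0"
    using cinner_commute[of x x] by (simp add: complex_eq_iff)
  then show ?thesis
    using Re_cinner_self_nonneg[of x] by (simp add: norm_eq_sqrt_cinner complex_eq_iff)
qed

lemma norm_power2: "(norm (x :: 'a::complex_hilbert))\<^sup>2 = Re (cinner x x)"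
  by (simp add: cinner_self)

lemma norm_scaleC: "norm (c *\<^sub>C (x :: 'a::complex_hilbert)) = cmod c * norm x"
proof -
  have "cinner (c *\<^sub>C x) (c *\<^sub>C x) = (c * cnj c) * cinner x x"
    by (simp add: cinner_scaleC_left cinner_scaleC_right mult_ac)
  also have "\<dots> = complex_of_real ((cmod c * norm x)\<^sup>2)"
    by (simp only: complex_norm_square[symmetric] cinner_self power_mult_distrib of_real_mult)
  finally have "(norm (c *\<^sub>C x))\<^sup>2 = (cmod c * norm x)\<^sup>2"
    by (simp only: cinner_self of_real_eq_iff)
  then show ?thesis by simp
qed

lemma cinner_eq_norm: "cinner x x = cinner y y \<Longrightarrow> norm (x :: 'a::complex_hilbert) = norm (y :: 'b::complex_hilbert)"
  by (simp add: norm_eq_sqrt_cinner)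

text \<open>Pythagoras for the part of \<open>y\<close> orthogonal to \<open>x\<close>. The equality
  serves twice: nonnegativity of the left side is Cauchy-Schwarz, and the strict decrease for
  nonzero \<open>cinner x y\<close> shows that a nearest point is an orthogonal projection.\<close>

lemma norm_minus_component:
  fixes x y :: "'a::complex_hilbert"
  assumes "x \<noteq> 0"
  shows "(norm (y - (cinner x y / complex_of_real ((norm x)\<^sup>2)) *\<^sub>C x))\<^sup>2
    = (norm y)\<^sup>2 - (cmod (cinner x y))\<^sup>2 / (norm x)\<^sup>2"
proof -
  define N where "N = (norm x)\<^sup>2"
  define a where "a = cinner x y"
  define c where "c = a / complex_of_real N"
  have N: "N > 0" using assms by (simp add: N_def)
  have yx: "cinner y x = cnj a" using cinner_commute[of y x] by (simp add: a_def)
  have "cinner (y - c *\<^sub>C x) (y - c *\<^sub>C x)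
      = cinner y y - c * cnj a - cnj c * a + c * cnj c * cinner x x"
    by (simp add: cinner_diff_left cinner_diff_right cinner_scaleC_left cinner_scaleC_right yx
        a_def[symmetric] algebra_simps)
  also have "\<dots> = cinner y y - (a * cnj a) / complex_of_real N"
    using N by (simp add: cinner_self N_def[symmetric] c_def field_simps del: of_real_power)
  also have "\<dots> = complex_of_real ((norm y)\<^sup>2 - (cmod a)\<^sup>2 / N)"
    by (simp only: cinner_self complex_norm_square[symmetric] of_real_diff of_real_divide)
  finally have "(norm (y - c *\<^sub>C x))\<^sup>2 = (norm y)\<^sup>2 - (cmod a)\<^sup>2 / N"
    by (simp only: cinner_self of_real_eq_iff)
  then show ?thesis by (simp only: c_def a_def N_def)
qed

lemma Cauchy_Schwarz_cinner: "cmod (cinner x y) \<le> norm x * norm (y :: 'a::complex_hilbert)"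
proof (cases "x = 0")
  case False
  have "(cmod (cinner x y))\<^sup>2 / (norm x)\<^sup>2 \<le> (norm y)\<^sup>2"
    using norm_minus_component[OF False, of y]
      zero_le_power2[of "norm (y - (cinner x y / complex_of_real ((norm x)\<^sup>2)) *\<^sub>C x)"] by linarith
  then have "(cmod (cinner x y))\<^sup>2 \<le> (norm x * norm y)\<^sup>2"
    using False by (simp add: divide_le_eq power_mult_distrib mult.commute)
  then show ?thesis by (rule power2_le_imp_le) simp
qed simp

lemma bounded_bilinear_cinner: "bounded_bilinear (cinner :: 'a::complex_hilbert \<Rightarrow> 'a \<Rightarrow> complex)"
proof
  show "\<exists>K. \<forall>a b :: 'a. norm (cinner a b) \<le> norm a * norm b * K"
    by (rule exI[of _ 1]) (simp add: Cauchy_Schwarz_cinner)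
qed (simp_all add: cinner_add_left cinner_add_right scaleR_scaleC cinner_scaleC_left
    cinner_scaleC_right scaleR_conv_of_real)

lemmas tendsto_cinner = bounded_bilinear.tendsto[OF bounded_bilinear_cinner]

lemma cinner_sum_right: "cinner x (\<Sum>i\<in>I. f i) = (\<Sum>i\<in>I. cinner x (f i :: 'a::complex_hilbert))"
  by (induction I rule: infinite_finite_induct) (simp_all add: cinner_add_right)

lemma cinner_extI: "(\<And>z. cinner z x = cinner z y) \<Longrightarrow> x = (y :: 'a::complex_hilbert)"
proof -
  assume *: "\<And>z. cinner z x = cinner z y"
  have "cinner (x - y) (x - y) = 0" using *[of "x - y"] by (simp add: cinner_diff_right)
  then show ?thesis by (simp add: cinner_self)
qed

lemma cinner_extI': "(\<And>z. cinner x z = cinner y z) \<Longrightarrow> x = (y :: 'a::complex_hilbert)"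
  by (rule cinner_extI) (metis cinner_commute)

lemma parallelogram:
  "(norm (x + y))\<^sup>2 + (norm (x - y))\<^sup>2 = 2 * (norm x)\<^sup>2 + 2 * (norm (y :: 'a::complex_hilbert))\<^sup>2"
  by (simp add: norm_power2 cinner_add_left cinner_add_right cinner_diff_left cinner_diff_right)


subsection \<open>Orthogonal projections\<close>

definition csubspace :: "'a::complex_hilbert set \<Rightarrow> bool" where
  "csubspace S \<longleftrightarrow> 0 \<in> S \<and> (\<forall>x\<in>S. \<forall>y\<in>S. x + y \<in> S) \<and> (\<forall>c. \<forall>x\<in>S. c *\<^sub>C x \<in> S)"

lemma csubspaceD:
  assumes "csubspace S"
  shows csubspace_zero: "0 \<in> S"
    and csubspace_add: "\<lbrakk>x \<in> S; y \<in> S\<rbrakk> \<Longrightarrow> x + y \<in> S"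
    and csubspace_scaleC: "x \<in> S \<Longrightarrow> c *\<^sub>C x \<in> S"
  using assms by (auto simp: csubspace_def)

lemma csubspace_diff: "csubspace S \<Longrightarrow> x \<in> S \<Longrightarrow> y \<in> S \<Longrightarrow> x - y \<in> S"
  using csubspace_add[of S x "(-1) *\<^sub>C y"] csubspace_scaleC[of S y "-1"] by simp

lemma tendsto_scaleC:
  "(f \<longlongrightarrow> l) F \<Longrightarrow> ((\<lambda>x. c *\<^sub>C f x) \<longlongrightarrow> c *\<^sub>C (l :: 'a::complex_hilbert)) F"
proof -
  have "bounded_linear (\<lambda>x :: 'a. c *\<^sub>C x)"
    by (rule bounded_linear_intro[of _ "cmod c"])
      (simp_all add: scaleC_add_right scaleR_scaleC norm_scaleC scaleC_scaleC mult.commute)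
  then show "(f \<longlongrightarrow> l) F \<Longrightarrow> ?thesis" by (rule bounded_linear.tendsto)
qed

lemma csubspace_closure:
  assumes "csubspace S" shows "csubspace (closure S)"
proof -
  have "x + y \<in> closure S" if xy: "x \<in> closure S" "y \<in> closure S" for x y
  proof -
    obtain f g where "\<And>n. f n \<in> S" "f \<longlonglongrightarrow> x" "\<And>n. g n \<in> S" "g \<longlonglongrightarrow> y"
      using xy unfolding closure_sequential by blast
    then show ?thesis unfolding closure_sequential
      by (intro exI[of _ "\<lambda>n. f n + g n"]) (auto intro: csubspace_add[OF assms] tendsto_add)
  qed
  moreover have "c *\<^sub>C x \<in> closure S" if x: "x \<in> closure S" for c x
  proof -
    obtain f where "\<And>n. f n \<in> S" "f \<longlonglongrightarrow> x" using x unfolding closure_sequential by blast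
    then show ?thesis unfolding closure_sequential
      by (intro exI[of _ "\<lambda>n. c *\<^sub>C f n"]) (auto intro: csubspace_scaleC[OF assms] tendsto_scaleC)
  qed
  ultimately show ?thesis
    using csubspace_zero[OF assms] closure_subset[of S] by (auto simp: csubspace_def)
qed

text \<open>The midpoint of two points of \<open>S\<close> is in \<open>S\<close>, hence at distance
  at least \<open>d\<close> from \<open>x\<close>; the parallelogram law then bounds the distance of
  two near-minimisers, so a minimising sequence is Cauchy.\<close>

lemma nearest_point_exists:
  fixes S :: "'a::complex_hilbert set"
  assumes S: "csubspace S" and cl: "closed S"
  shows "\<exists>p\<in>S. \<forall>s\<in>S. norm (x - p) \<le> norm (x - s)"
proof -
  have ne: "S \<noteq> {}" using csubspace_zero[OF S] by blast
  define d where "d = infdist x S"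
  have d_le: "d \<le> norm (x - s)" if "s \<in> S" for s
    unfolding d_def using infdist_le[OF that, of x] by (simp add: dist_norm)
  have d0: "0 \<le> d" unfolding d_def by (rule infdist_nonneg)
  have "\<exists>s\<in>S. norm (x - s) < d + inverse (real (Suc n))" for n
  proof (rule ccontr)
    assume "\<not> ?thesis"
    then have "d + inverse (real (Suc n)) \<le> dist x s" if "s \<in> S" for s
      using that by (force simp: dist_norm)
    then have "d + inverse (real (Suc n)) \<le> d"
      unfolding d_def infdist_notempty[OF ne] by (intro cINF_greatest ne)
    then show False by simp
  qed
  then obtain s where sS: "\<And>n. s n \<in> S" and s: "\<And>n. norm (x - s n) < d + inverse (real (Suc n))"
    by metis
  have lim: "(\<lambda>n. norm (x - s n)) \<longlonglongrightarrow> d"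
  proof (rule tendsto_sandwich[where f = "\<lambda>_. d" and h = "\<lambda>n. d + inverse (real (Suc n))"])
    show "(\<lambda>n. d + inverse (real (Suc n))) \<longlonglongrightarrow> d"
      using tendsto_add[OF tendsto_const LIMSEQ_inverse_real_of_nat, of d] by simp
    show "\<forall>\<^sub>F n in sequentially. d \<le> norm (x - s n)" using d_le[OF sS] by simp
    show "\<forall>\<^sub>F n in sequentially. norm (x - s n) \<le> d + inverse (real (Suc n))"
      using s less_imp_le by (intro always_eventually allI) blast
  qed simp
  have key: "(norm (s m - s n))\<^sup>2 \<le> 2 * (norm (x - s m))\<^sup>2 + 2 * (norm (x - s n))\<^sup>2 - 4 * d\<^sup>2" for m n
  proof -
    have mid: "(1/2 :: complex) *\<^sub>C (s m + s n) \<in> S"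
      by (intro csubspace_scaleC[OF S] csubspace_add[OF S] sS)
    have half: "(1/2 :: complex) *\<^sub>C y = (1/2) *\<^sub>R y" for y :: 'a
      using scaleR_scaleC[of "1/2" y] by simp
    have "(x - s m) + (x - s n) = 2 *\<^sub>R (x - (1/2 :: complex) *\<^sub>C (s m + s n))"
      unfolding half by (simp add: algebra_simps scaleR_2)
    then have "norm ((x - s m) + (x - s n)) = 2 * norm (x - (1/2 :: complex) *\<^sub>C (s m + s n))"
      by simp
    then have "2 * d \<le> norm ((x - s m) + (x - s n))" using d_le[OF mid] by simp
    then have "(2 * d)\<^sup>2 \<le> (norm ((x - s m) + (x - s n)))\<^sup>2" using d0 by (intro power_mono) auto
    moreover have "norm ((x - s m) - (x - s n)) = norm (s m - s n)"
      by (simp add: norm_minus_commute)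
    ultimately show ?thesis using parallelogram[of "x - s m" "x - s n"]
      by (simp add: power_mult_distrib)
  qed
  have "Cauchy s"
  proof (rule metric_CauchyI)
    fix e :: real assume e: "e > 0"
    have "(\<lambda>n. (norm (x - s n))\<^sup>2) \<longlonglongrightarrow> d\<^sup>2" by (intro tendsto_power lim)
    moreover have "d\<^sup>2 < d\<^sup>2 + e\<^sup>2 / 4" using e by simp
    ultimately have "\<forall>\<^sub>F n in sequentially. (norm (x - s n))\<^sup>2 < d\<^sup>2 + e\<^sup>2 / 4"
      by (rule order_tendstoD)
    then obtain N where N: "\<And>n. n \<ge> N \<Longrightarrow> (norm (x - s n))\<^sup>2 < d\<^sup>2 + e\<^sup>2 / 4"
      unfolding eventually_sequentially by blast
    have "dist (s m) (s n) < e" if "m \<ge> N" "n \<ge> N" for m n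
    proof -
      have "(norm (s m - s n))\<^sup>2 < e\<^sup>2" using key[of m n] N[OF that(1)] N[OF that(2)] by linarith
      then show ?thesis using e by (simp add: dist_norm power_less_imp_less_base)
    qed
    then show "\<exists>M. \<forall>m\<ge>M. \<forall>n\<ge>M. dist (s m) (s n) < e" by blast
  qed
  then obtain p where p: "s \<longlonglongrightarrow> p" using Cauchy_convergent convergent_def by blast
  have "p \<in> S" using cl sS p closed_sequentially by blast
  moreover have "norm (x - p) = d"
    by (rule LIMSEQ_unique[OF _ lim]) (intro tendsto_norm tendsto_diff tendsto_const p)
  ultimately show ?thesis using d_le by auto
qed

text \<open>If \<open>x - p\<close> had a component along some \<open>s\<close> in \<open>S\<close>,
  removing it would amount to moving \<open>p\<close> within \<open>S\<close> and would bring it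
  closer to \<open>x\<close>.\<close>

lemma orthogonal_projection_exists:
  fixes S :: "'a::complex_hilbert set"
  assumes S: "csubspace S" and cl: "closed S"
  shows "\<exists>p\<in>S. \<forall>s\<in>S. cinner s (x - p) = 0"
proof -
  obtain p where p: "p \<in> S" and min: "\<And>s. s \<in> S \<Longrightarrow> norm (x - p) \<le> norm (x - s)"
    using nearest_point_exists[OF assms] by blast
  have "cinner s (x - p) = 0" if s: "s \<in> S" for s
  proof (rule ccontr)
    define u where "u = x - p"
    assume "cinner s (x - p) \<noteq> 0"
    then have nz: "cinner s u \<noteq> 0" by (simp add: u_def)
    then have s0: "s \<noteq> 0" by auto
    define c where "c = cinner s u / complex_of_real ((norm s)\<^sup>2)"
    have "(cmod (cinner s u))\<^sup>2 / (norm s)\<^sup>2 > 0" using s0 nz by simp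
    then have lt: "(norm (u - c *\<^sub>C s))\<^sup>2 < (norm u)\<^sup>2"
      using norm_minus_component[OF s0, of u] unfolding c_def by linarith
    have "u - c *\<^sub>C s = x - (p + c *\<^sub>C s)" by (simp add: u_def)
    moreover have "p + c *\<^sub>C s \<in> S" by (intro csubspace_add[OF S] csubspace_scaleC[OF S] p s)
    ultimately have "norm u \<le> norm (u - c *\<^sub>C s)" using min unfolding u_def by metis
    then have "(norm u)\<^sup>2 \<le> (norm (u - c *\<^sub>C s))\<^sup>2" by (intro power_mono) auto
    with lt show False by linarith
  qed
  with p show ?thesis by blast
qed


section \<open>Bounded complex-linear operators\<close>

lemma bounded_clinearI:
  assumes "\<And>x y. T (x + y) = T x + T y" "\<And>c x. T (c *\<^sub>C x) = c *\<^sub>C T x"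
    and "\<And>x. norm (T x) \<le> K * norm x"
  shows "bounded_clinear (T :: 'a::complex_hilbert \<Rightarrow> 'b::complex_hilbert)"
  unfolding bounded_clinear_def using assms
  by (auto intro!: bounded_linear_intro[of T K] simp: scaleR_scaleC mult.commute)

lemma bounded_clinearD:
  assumes "bounded_clinear T"
  shows bounded_clinear_add: "T (x + y) = T x + T y"
    and bounded_clinear_diff: "T (x - y) = T x - T y"
    and bounded_clinear_scaleC: "T (c *\<^sub>C x) = c *\<^sub>C T x"
    and bounded_clinear_scaleR: "T (r *\<^sub>R x) = r *\<^sub>R T x"
    and bounded_clinear_zero: "T 0 = 0"
    and bounded_clinear_norm: "norm (T x) \<le> onorm T * norm x"
    and bounded_clinear_tendsto: "(f \<longlongrightarrow> l) F \<Longrightarrow> ((\<lambda>x. T (f x)) \<longlongrightarrow> T l) F"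
  using assms onorm[of T]
  by (auto simp: bounded_clinear_def linear_simps bounded_linear.tendsto)

lemma bounded_clinear_sum:
  "bounded_clinear T \<Longrightarrow> T (\<Sum>i\<in>I. f i) = (\<Sum>i\<in>I. T (f i))"
  by (induction I rule: infinite_finite_induct)
    (simp_all add: bounded_clinear_zero bounded_clinear_add)

lemma bounded_clinear_id: "bounded_clinear id"
  by (rule bounded_clinearI[of _ 1]) simp_all

lemma bounded_clinear_zero_map: "bounded_clinear (\<lambda>_. 0)"
  by (rule bounded_clinearI[of _ 0]) simp_all

lemma bounded_clinear_compose:
  "bounded_clinear S \<Longrightarrow> bounded_clinear T \<Longrightarrow> bounded_clinear (S \<circ> T)"
  by (auto simp: bounded_clinear_def o_def intro: bounded_linear_compose)

lemma bounded_clinear_plus: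
  "bounded_clinear S \<Longrightarrow> bounded_clinear T \<Longrightarrow> bounded_clinear (\<lambda>x. S x + T x)"
  by (auto simp: bounded_clinear_def bounded_linear_add scaleC_add_right)

lemma bounded_clinear_minus:
  "bounded_clinear S \<Longrightarrow> bounded_clinear T \<Longrightarrow> bounded_clinear (\<lambda>x. S x - T x)"
  by (auto simp: bounded_clinear_def bounded_linear_sub scaleC_diff_right)

lemma bounded_clinear_cscale: "bounded_clinear T \<Longrightarrow> bounded_clinear (\<lambda>x. c *\<^sub>C T x)"
proof (rule bounded_clinearI[of _ "cmod c * onorm T"])
  assume T: "bounded_clinear T"
  show "norm (c *\<^sub>C T x) \<le> cmod c * onorm T * norm x" for x
    using mult_left_mono[OF bounded_clinear_norm[OF T, of x], of "cmod c"]
    by (simp add: norm_scaleC mult.assoc)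
qed (simp_all add: bounded_clinearD scaleC_add_right scaleC_left_commute)

lemma bounded_clinear_rscale: "bounded_clinear T \<Longrightarrow> bounded_clinear (\<lambda>x. r *\<^sub>R T x)"
  by (simp add: scaleR_scaleC bounded_clinear_cscale)

lemma bounded_clinear_scalar: "bounded_clinear (\<lambda>x. c *\<^sub>C x)"
  using bounded_clinear_cscale[OF bounded_clinear_id, of c] by simp

lemma bounded_clinear_setsum:
  "(\<And>i. i \<in> I \<Longrightarrow> bounded_clinear (T i)) \<Longrightarrow> bounded_clinear (\<lambda>x. \<Sum>i\<in>I. T i x)"
  by (induction I rule: infinite_finite_induct)
    (simp_all add: bounded_clinear_zero_map bounded_clinear_plus)

lemma bounded_clinear_funpow: "bounded_clinear T \<Longrightarrow> bounded_clinear (T ^^ k :: 'a::complex_hilbert \<Rightarrow> 'a)"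
  by (induction k) (simp_all add: bounded_clinear_id bounded_clinear_compose)

lemma bounded_clinear_onorm_nonneg: "bounded_clinear T \<Longrightarrow> 0 \<le> onorm T"
  by (simp add: bounded_clinear_def onorm_pos_le)

lemma closed_kernel_bounded_clinear:
  assumes "bounded_clinear S" "bounded_clinear T"
  shows "closed {x. S x = T x}"
proof -
  have "continuous_on UNIV S" "continuous_on UNIV T"
    using assms by (auto simp: bounded_clinear_def linear_continuous_on)
  then show ?thesis by (rule closed_Collect_eq)
qed

lemma bounded_clinear_eq_on_dense:
  assumes "bounded_clinear S" "bounded_clinear T"
    and "\<And>x. x \<in> D \<Longrightarrow> S x = T x" and "closure D = UNIV"
  shows "S = T"
proof -
  have "closure D \<subseteq> {x. S x = T x}"
    using assms(3) by (intro closure_minimal closed_kernel_bounded_clinear assms) auto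
  then show ?thesis using assms(4) by auto
qed

subsection \<open>The Riesz representation and adjoints\<close>

text \<open>The kernel of a nonzero \<open>f\<close> is closed and of codimension one, so a nonzero
  vector \<open>u\<close> orthogonal to it represents \<open>f\<close> up to a scalar, which the
  value at \<open>u\<close> fixes.\<close>

lemma Riesz_representation:
  fixes f :: "'a::complex_hilbert \<Rightarrow> complex"
  assumes add: "\<And>x y. f (x + y) = f x + f y" and hom: "\<And>c x. f (c *\<^sub>C x) = c * f x"
    and bound: "\<And>x. cmod (f x) \<le> K * norm x"
  shows "\<exists>y. \<forall>x. f x = cinner y x"
proof (cases "\<forall>x. f x = 0")
  case True
  then show ?thesis by (intro exI[of _ 0]) simp
next
  case False
  then obtain x where x: "f x \<noteq> 0" by blast
  have bl: "bounded_linear f"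
    by (rule bounded_linear_intro[of f K])
      (simp_all add: add hom scaleR_scaleC bound mult.commute scaleR_conv_of_real)
  have f0: "f 0 = 0" using hom[of 0 0] by simp
  define S where "S = {x. f x = 0}"
  have "csubspace S" unfolding csubspace_def S_def by (simp add: add hom f0)
  moreover have "closed S" unfolding S_def
    by (rule closed_Collect_eq) (use bl linear_continuous_on in auto)
  ultimately obtain p where p: "p \<in> S" and orth: "\<And>s. s \<in> S \<Longrightarrow> cinner s (x - p) = 0"
    using orthogonal_projection_exists by blast
  define u where "u = x - p"
  have fu: "f u \<noteq> 0" using p x linear_simps(2)[OF bl, of x p] by (simp add: u_def S_def)
  then have u0: "cinner u u \<noteq> 0" using f0 by (auto simp: cinner_self)
  have "f z = cinner (cnj (f u / cinner u u) *\<^sub>C u) z" for z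
  proof -
    have "f (z - (f z / f u) *\<^sub>C u) = 0"
      using fu by (simp add: linear_simps(2)[OF bl] hom)
    then have "cinner (z - (f z / f u) *\<^sub>C u) u = 0" using orth unfolding S_def u_def by blast
    then have "cinner u (z - (f z / f u) *\<^sub>C u) = 0" by (metis cinner_commute complex_cnj_zero)
    then have "cinner u z = f z / f u * cinner u u"
      by (simp add: cinner_diff_right cinner_scaleC_right)
    then show ?thesis using fu u0 by (simp add: cinner_scaleC_left)
  qed
  then show ?thesis by blast
qed

text \<open>Inner products determine \<open>S\<close>, so linearity is inherited, and the squared
  norm of \<open>S y\<close> is \<open>cinner (T (S y)) y\<close>, which gives the bound. Thanks to
  this an adjoint is recognised from the defining identity alone.\<close>

lemma bounded_clinear_of_adjoint:
  fixes S :: "'b::complex_hilbert \<Rightarrow> 'a::complex_hilbert"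
  assumes T: "bounded_clinear T" and adj: "\<And>x y. cinner (T x) y = cinner x (S y)"
  shows "bounded_clinear S"
proof (rule bounded_clinearI)
  show "S (x + y) = S x + S y" for x y
    by (rule cinner_extI) (simp add: cinner_add_right flip: adj)
  show "S (c *\<^sub>C x) = c *\<^sub>C S x" for c x
    by (rule cinner_extI) (simp add: cinner_scaleC_right flip: adj)
  show "norm (S y) \<le> onorm T * norm y" for y
  proof (cases "S y = 0")
    case True
    then show ?thesis using bounded_clinear_onorm_nonneg[OF T] by simp
  next
    case False
    have "(norm (S y))\<^sup>2 = Re (cinner (T (S y)) y)" by (simp add: norm_power2 adj)
    also have "\<dots> \<le> cmod (cinner (T (S y)) y)" by (rule complex_Re_le_cmod)
    also have "\<dots> \<le> norm (T (S y)) * norm y" by (rule Cauchy_Schwarz_cinner)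
    also have "\<dots> \<le> (onorm T * norm (S y)) * norm y"
      by (intro mult_right_mono bounded_clinear_norm T) simp
    finally show ?thesis using False by (simp add: power2_eq_square mult_ac)
  qed
qed

lemma adjoint_exists:
  fixes T :: "'a::complex_hilbert \<Rightarrow> 'b::complex_hilbert"
  assumes T: "bounded_clinear T"
  shows "\<exists>S. bounded_clinear S \<and> (\<forall>x y. cinner (T x) y = cinner x (S y))"
proof -
  have "\<exists>s. \<forall>x. cinner y (T x) = cinner s x" for y
  proof (rule Riesz_representation[where K = "norm y * onorm T"])
    show "cmod (cinner y (T x)) \<le> norm y * onorm T * norm x" for x
      using Cauchy_Schwarz_cinner[of y "T x"]
        mult_left_mono[OF bounded_clinear_norm[OF T, of x], of "norm y"] by (simp add: mult.assoc)
  qed (simp_all add: bounded_clinearD[OF T] cinner_add_right cinner_scaleC_right)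
  then obtain S where S: "\<And>y x. cinner y (T x) = cinner (S y) x" by metis
  then have "cinner (T x) y = cinner x (S y)" for x y by (metis cinner_commute)
  with bounded_clinear_of_adjoint[OF T] show ?thesis by blast
qed

lemma hadj_eqI:
  assumes T: "bounded_clinear T" and adj: "\<And>x y. cinner (T x) y = cinner x (S y)"
  shows "hadj T = S"
  unfolding hadj_def
proof (rule the_equality)
  show "bounded_clinear S \<and> (\<forall>x y. cinner (T x) y = cinner x (S y))"
    using bounded_clinear_of_adjoint[OF assms] adj by blast
  show "S' = S" if "bounded_clinear S' \<and> (\<forall>x y. cinner (T x) y = cinner x (S' y))" for S'
    using that adj by (intro ext cinner_extI) metis
qed

lemma
  assumes T: "bounded_clinear T"
  shows bounded_clinear_hadj: "bounded_clinear (hadj T)"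
    and cinner_hadj_right: "cinner x (hadj T y) = cinner (T x) y"
    and cinner_hadj_left: "cinner (hadj T x) y = cinner x (T y)"
    and hadj_hadj: "hadj (hadj T) = T"
proof -
  obtain S where S: "bounded_clinear S" "\<And>x y. cinner (T x) y = cinner x (S y)"
    using adjoint_exists[OF T] by blast
  have "hadj T = S" by (rule hadj_eqI[OF T S(2)])
  with S show 1: "bounded_clinear (hadj T)" and 2: "cinner x (hadj T y) = cinner (T x) y" for x y
    by auto
  show 3: "cinner (hadj T x) y = cinner x (T y)" for x y by (metis 2 cinner_commute)
  show "hadj (hadj T) = T" by (rule hadj_eqI[OF 1 3])
qed

lemma hadj_compose:
  "bounded_clinear S \<Longrightarrow> bounded_clinear T \<Longrightarrow> hadj (S \<circ> T) = hadj T \<circ> hadj S"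
  by (rule hadj_eqI) (simp_all add: bounded_clinear_compose cinner_hadj_right)

lemma hadj_plus:
  "bounded_clinear S \<Longrightarrow> bounded_clinear T \<Longrightarrow> hadj (\<lambda>x. S x + T x) = (\<lambda>x. hadj S x + hadj T x)"
  by (rule hadj_eqI)
    (simp_all add: bounded_clinear_plus cinner_hadj_right cinner_add_left cinner_add_right)

lemma hadj_cscale: "bounded_clinear T \<Longrightarrow> hadj (\<lambda>x. c *\<^sub>C T x) = (\<lambda>x. cnj c *\<^sub>C hadj T x)"
  by (rule hadj_eqI)
    (simp_all add: bounded_clinear_cscale cinner_hadj_right cinner_scaleC_left cinner_scaleC_right)

lemma hadj_id: "hadj id = id"
  by (rule hadj_eqI) (simp_all add: bounded_clinear_id)

lemma onorm_hadj_le: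
  assumes T: "bounded_clinear T"
  shows "onorm (hadj T) \<le> onorm T"
proof (rule onorm_bound[OF bounded_clinear_onorm_nonneg[OF T]])
  fix y
  show "norm (hadj T y) \<le> onorm T * norm y"
  proof (cases "hadj T y = 0")
    case True
    then show ?thesis using bounded_clinear_onorm_nonneg[OF T] by simp
  next
    case False
    have "(norm (hadj T y))\<^sup>2 = Re (cinner (T (hadj T y)) y)"
      by (simp add: norm_power2 cinner_hadj_right[OF T])
    also have "\<dots> \<le> norm (T (hadj T y)) * norm y"
      by (rule order.trans[OF complex_Re_le_cmod Cauchy_Schwarz_cinner])
    also have "\<dots> \<le> (onorm T * norm (hadj T y)) * norm y"
      by (intro mult_right_mono bounded_clinear_norm T) simp
    finally show ?thesis using False by (simp add: power2_eq_square mult_ac)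
  qed
qed

lemma projection_operator:
  fixes S :: "'a::complex_hilbert set"
  assumes S: "csubspace S" and cl: "closed S"
  obtains p where "bounded_clinear p" "\<And>x. p x \<in> S" "\<And>x. x \<in> S \<Longrightarrow> p x = x"
    "\<And>x s. s \<in> S \<Longrightarrow> cinner s (x - p x) = 0"
proof -
  obtain p where p: "\<And>x. p x \<in> S" "\<And>x s. s \<in> S \<Longrightarrow> cinner s (x - p x) = 0"
    using orthogonal_projection_exists[OF assms] by metis
  have uniq: "p x = q" if q: "q \<in> S" "\<And>s. s \<in> S \<Longrightarrow> cinner s (x - q) = 0" for x q
  proof -
    have m: "p x - q \<in> S" by (intro csubspace_diff[OF S] p q)
    have "cinner (p x - q) ((x - q) - (x - p x)) = 0"
      using p(2)[OF m, of x] q(2)[OF m] cinner_diff_right[of "p x - q" "x - q" "x - p x"] by simp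
    then show ?thesis by (simp add: cinner_self)
  qed
  have "bounded_clinear p"
  proof (rule bounded_clinearI[of _ 1])
    show "p (x + y) = p x + p y" for x y
    proof (rule uniq)
      show "cinner s (x + y - (p x + p y)) = 0" if "s \<in> S" for s
        using p(2)[OF that, of x] p(2)[OF that, of y] by (simp add: cinner_diff_right cinner_add_right)
    qed (intro csubspace_add[OF S] p)
    show "p (c *\<^sub>C x) = c *\<^sub>C p x" for c x
    proof (rule uniq)
      show "cinner s (c *\<^sub>C x - c *\<^sub>C p x) = 0" if "s \<in> S" for s
        using p(2)[OF that, of x] by (simp add: cinner_scaleC_right flip: scaleC_diff_right)
    qed (intro csubspace_scaleC[OF S] p)
    show "norm (p x) \<le> 1 * norm x" for x
    proof -
      have "cinner (p x) (p x) = cinner (p x) x"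
        using p(2)[OF p(1), of x x] by (simp add: cinner_diff_right)
      then have "(norm (p x))\<^sup>2 \<le> norm (p x) * norm x"
        using Cauchy_Schwarz_cinner[of "p x" x] complex_Re_le_cmod[of "cinner (p x) x"]
        by (simp add: norm_power2)
      then show ?thesis by (cases "p x = 0") (simp_all add: power2_eq_square)
    qed
  qed
  moreover have "p x = x" if "x \<in> S" for x by (rule uniq[OF that]) simp
  ultimately show ?thesis using p that by blast
qed


subsection \<open>Commutants\<close>

lemma commutantD:
  assumes "T \<in> commutant S"
  shows commutant_bounded: "bounded_clinear T"
    and commutant_apply: "A \<in> S \<Longrightarrow> T (A x) = A (T x)"
  using assms by (auto simp: commutant_def fun_eq_iff)

lemma commutantI:
  "bounded_clinear T \<Longrightarrow> (\<And>A x. A \<in> S \<Longrightarrow> T (A x) = A (T x)) \<Longrightarrow> T \<in> commutant S"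
  by (auto simp: commutant_def fun_eq_iff)

lemma commutant_antimono: "S \<subseteq> S' \<Longrightarrow> commutant S' \<subseteq> commutant S"
  by (auto simp: commutant_def)

lemma subset_bicommutant: "(\<And>T. T \<in> S \<Longrightarrow> bounded_clinear T) \<Longrightarrow> S \<subseteq> bicommutant S"
  unfolding bicommutant_def by (auto intro!: commutantI simp: commutant_apply)

lemma bicommutant_mono: "S \<subseteq> S' \<Longrightarrow> bicommutant S \<subseteq> bicommutant S'"
  unfolding bicommutant_def by (intro commutant_antimono)

lemma commutant_bicommutant:
  assumes "\<And>T. T \<in> S \<Longrightarrow> bounded_clinear T"
  shows "commutant (bicommutant S) = commutant S"
proof
  show "commutant (bicommutant S) \<subseteq> commutant S"
    by (intro commutant_antimono subset_bicommutant assms)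
  have "commutant S \<subseteq> bicommutant (commutant S)"
    by (intro subset_bicommutant) (rule commutant_bounded)
  then show "commutant S \<subseteq> commutant (bicommutant S)" by (simp add: bicommutant_def)
qed

lemma commutant_compose: "T \<in> commutant S \<Longrightarrow> T' \<in> commutant S \<Longrightarrow> T \<circ> T' \<in> commutant S"
  by (rule commutantI) (auto simp: commutant_apply intro: bounded_clinear_compose commutant_bounded)

lemma commutant_plus:
  assumes "\<And>A. A \<in> S \<Longrightarrow> bounded_clinear A" "T \<in> commutant S" "T' \<in> commutant S"
  shows "(\<lambda>x. T x + T' x) \<in> commutant S"
  using assms
  by (intro commutantI) (auto simp: commutant_apply bounded_clinear_add intro: bounded_clinear_plus commutant_bounded)

lemma commutant_minus:
  assumes "\<And>A. A \<in> S \<Longrightarrow> bounded_clinear A" "T \<in> commutant S" "T' \<in> commutant S"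
  shows "(\<lambda>x. T x - T' x) \<in> commutant S"
  using assms
  by (intro commutantI) (auto simp: commutant_apply bounded_clinear_diff intro: bounded_clinear_minus commutant_bounded)

lemma commutant_cscale:
  assumes "\<And>A. A \<in> S \<Longrightarrow> bounded_clinear A" "T \<in> commutant S"
  shows "(\<lambda>x. c *\<^sub>C T x) \<in> commutant S"
  using assms
  by (intro commutantI) (auto simp: commutant_apply bounded_clinear_scaleC intro: bounded_clinear_cscale commutant_bounded)

lemma commutant_id: "id \<in> commutant S"
  by (rule commutantI) (simp_all add: bounded_clinear_id)

lemma commutant_scalar:
  "(\<And>A. A \<in> S \<Longrightarrow> bounded_clinear A) \<Longrightarrow> (\<lambda>x. c *\<^sub>C x) \<in> commutant S"
  using commutant_cscale[OF _ commutant_id, of S c] by simp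

lemma commutant_hadj:
  assumes bd: "\<And>A. A \<in> S \<Longrightarrow> bounded_clinear A" and adj: "\<And>A. A \<in> S \<Longrightarrow> hadj A \<in> S"
    and T: "T \<in> commutant S"
  shows "hadj T \<in> commutant S"
proof (rule commutantI)
  note bT = commutant_bounded[OF T]
  show "bounded_clinear (hadj T)" by (rule bounded_clinear_hadj[OF bT])
  fix A x assume A: "A \<in> S"
  have "cinner (hadj T (A x)) y = cinner (A (hadj T x)) y" for y
    using commutant_apply[OF T adj[OF A], of y]
    by (metis cinner_hadj_left[OF bT] cinner_hadj_right[OF bd[OF A]] cinner_commute)
  then show "hadj T (A x) = A (hadj T x)" by (rule cinner_extI')
qed

lemma
  assumes "T \<in> bicommutant S"
  shows bicommutant_bounded: "bounded_clinear T"
    and bicommutant_compose: "T' \<in> bicommutant S \<Longrightarrow> T \<circ> T' \<in> bicommutant S"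
    and bicommutant_minus: "T' \<in> bicommutant S \<Longrightarrow> (\<lambda>x. T x - T' x) \<in> bicommutant S"
  using assms commutant_bounded[of _ S] commutant_minus[of "commutant S" T T']
  by (auto simp: bicommutant_def intro: commutant_bounded commutant_compose)

lemma bicommutant_apply: "T \<in> bicommutant S \<Longrightarrow> y \<in> commutant S \<Longrightarrow> T (y x) = y (T x)"
  unfolding bicommutant_def by (rule commutant_apply)

lemma separatingD: "separating \<xi> N \<Longrightarrow> T \<in> N \<Longrightarrow> T \<xi> = 0 \<Longrightarrow> T = (\<lambda>_. 0)"
  by (simp add: separating_def)

lemma von_neumann_algebra_bicommutant:
  assumes bd: "\<And>A. A \<in> S \<Longrightarrow> bounded_clinear A" and adj: "\<And>A. A \<in> S \<Longrightarrow> hadj A \<in> S"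
  shows "von_neumann_algebra (bicommutant S)"
  unfolding von_neumann_algebra_def
proof (intro conjI ballI)
  fix T assume T: "T \<in> bicommutant S"
  then show "bounded_clinear T" unfolding bicommutant_def by (rule commutant_bounded)
  show "hadj T \<in> bicommutant S" unfolding bicommutant_def
    by (rule commutant_hadj)
      (use T in \<open>auto simp: bicommutant_def intro: commutant_bounded commutant_hadj[OF bd adj]\<close>)
next
  show "bicommutant (bicommutant S) = bicommutant S"
    using commutant_bicommutant[OF bd] by (simp add: bicommutant_def)
qed

text \<open>\<open>S\<close> and its bicommutant have the same commutant, so centrality needs to be
  tested only against the generators.\<close>

lemma factor_bicommutantI:
  assumes bd: "\<And>A. A \<in> S \<Longrightarrow> bounded_clinear A" and adj: "\<And>A. A \<in> S \<Longrightarrow> hadj A \<in> S"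
    and center: "\<And>z. z \<in> bicommutant S \<Longrightarrow> z \<in> commutant S \<Longrightarrow> \<exists>c. z = (\<lambda>x. c *\<^sub>C x)"
  shows "factor (bicommutant S)"
  unfolding factor_def
proof (intro conjI equalityI subsetI)
  show "von_neumann_algebra (bicommutant S)" by (rule von_neumann_algebra_bicommutant[OF bd adj])
  fix z assume "z \<in> bicommutant S \<inter> commutant (bicommutant S)"
  then have "z \<in> bicommutant S" "z \<in> commutant S" by (auto simp: commutant_bicommutant[OF bd])
  from center[OF this] show "z \<in> range (\<lambda>c x. c *\<^sub>C x)" by blast
next
  fix z :: "'a \<Rightarrow> 'a" assume "z \<in> range (\<lambda>c x. c *\<^sub>C x)"
  then obtain c where z: "z = (\<lambda>x. c *\<^sub>C x)" by blast
  show "z \<in> bicommutant S \<inter> commutant (bicommutant S)"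
    unfolding z bicommutant_def
    by (intro IntI commutant_scalar) (auto intro: commutant_bounded)
qed

text \<open>The closure of \<open>S'\<xi>\<close> is invariant under \<open>S'\<close>, so the projection onto it lies in \<open>S''\<close> and
  fixes \<open>\<xi>\<close>.\<close>

lemma separating_imp_commutant_dense:
  assumes bd: "\<And>A. A \<in> S \<Longrightarrow> bounded_clinear A" and adj: "\<And>A. A \<in> S \<Longrightarrow> hadj A \<in> S"
    and sep: "separating \<xi> (bicommutant S)"
  shows "closure ((\<lambda>y. y \<xi>) ` commutant S) = UNIV"
proof -
  define K0 where "K0 = (\<lambda>y. y \<xi>) ` commutant S"
  have K0: "csubspace K0" unfolding csubspace_def K0_def
  proof (intro conjI ballI allI)
    have "(\<lambda>x. 0) \<in> commutant S"
      using commutant_minus[OF bd commutant_id commutant_id] by simp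
    then show "0 \<in> (\<lambda>y. y \<xi>) ` commutant S" by (rule rev_image_eqI) simp
    show "x + y \<in> (\<lambda>y. y \<xi>) ` commutant S"
      if xy: "x \<in> (\<lambda>y. y \<xi>) ` commutant S" "y \<in> (\<lambda>y. y \<xi>) ` commutant S" for x y
    proof -
      obtain S1 S2 where "x = S1 \<xi>" "y = S2 \<xi>" "S1 \<in> commutant S" "S2 \<in> commutant S"
        using xy by blast
      then show ?thesis by (intro rev_image_eqI[OF commutant_plus[OF bd]]) auto
    qed
    show "c *\<^sub>C x \<in> (\<lambda>y. y \<xi>) ` commutant S" if x: "x \<in> (\<lambda>y. y \<xi>) ` commutant S" for c x
    proof -
      obtain S1 where "x = S1 \<xi>" "S1 \<in> commutant S" using x by blast
      then show ?thesis by (intro rev_image_eqI[OF commutant_cscale[OF bd]]) auto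
    qed
  qed
  obtain p where p: "bounded_clinear p" "\<And>x. p x \<in> closure K0" "\<And>x. x \<in> closure K0 \<Longrightarrow> p x = x"
    and orth: "\<And>x s. s \<in> closure K0 \<Longrightarrow> cinner s (x - p x) = 0"
    by (rule projection_operator[OF csubspace_closure[OF K0] closed_closure]) blast
  have inv: "y x \<in> closure K0" if y: "y \<in> commutant S" and x: "x \<in> closure K0" for y x
  proof -
    obtain f where f: "\<And>n. f n \<in> K0" "f \<longlonglongrightarrow> x" using x unfolding closure_sequential by blast
    have "y (f n) \<in> K0" for n
    proof -
      obtain y' where "y' \<in> commutant S" "f n = y' \<xi>" using f(1)[of n] unfolding K0_def by blast
      then show ?thesis
        unfolding K0_def by (intro rev_image_eqI[OF commutant_compose[OF y]]) simp_all
    qed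
    moreover have "(\<lambda>n. y (f n)) \<longlonglongrightarrow> y x"
      by (rule bounded_clinear_tendsto[OF commutant_bounded[OF y] f(2)])
    ultimately show ?thesis unfolding closure_sequential
      by (intro exI[of _ "\<lambda>n. y (f n)"] conjI allI)
  qed
  have "p (y x) = y (p x)" if y: "y \<in> commutant S" for y x
  proof -
    note bd_y = commutant_bounded[OF y]
    \<comment> \<open>\<open>q\<close> measures the failure of commutation. It lies in the closure,
      hence is orthogonal to \<open>y x - p (y x)\<close> and, since \<open>hadj y\<close> also
      preserves the closure, to \<open>y x - y (p x)\<close>; the difference of these two vectors is
      \<open>q\<close> itself.\<close>
    define q where "q = y (p x) - p (y x)"
    have q: "q \<in> closure K0" unfolding q_def
      by (rule csubspace_diff[OF csubspace_closure[OF K0] inv[OF y p(2)] p(2)])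
    have "cinner q (y x - p (y x)) = 0" by (rule orth[OF q])
    moreover have "cinner q (y x - y (p x)) = 0"
    proof -
      have "hadj y q \<in> closure K0" by (rule inv[OF commutant_hadj[OF bd adj y] q])
      from orth[OF this, of x] show ?thesis
        by (simp add: cinner_hadj_left[OF bd_y] bounded_clinear_diff[OF bd_y])
    qed
    ultimately have "cinner q (y x - p (y x) - (y x - y (p x))) = 0"
      using cinner_diff_right[of q "y x - p (y x)" "y x - y (p x)"] by simp
    then have "cinner q q = 0" by (simp add: q_def)
    then show ?thesis by (simp add: cinner_self q_def)
  qed
  then have "p \<in> bicommutant S" unfolding bicommutant_def by (intro commutantI p(1))
  moreover have "id \<in> bicommutant S" unfolding bicommutant_def by (rule commutant_id)
  ultimately have q: "(\<lambda>x. id x - p x) \<in> bicommutant S" by (intro bicommutant_minus)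
  have "\<xi> \<in> K0" using imageI[OF commutant_id, of "\<lambda>y. y \<xi>" S] by (simp only: K0_def id_apply)
  then have "\<xi> \<in> closure K0" by (rule subsetD[OF closure_subset])
  from p(3)[OF this] have "id \<xi> - p \<xi> = 0" by simp
  then have "(\<lambda>x. id x - p x) = (\<lambda>_. 0)"
    by (rule separatingD[OF sep q])
  then have "p x = x" for x by (simp add: fun_eq_iff)
  then have "x \<in> closure K0" for x using p(2)[of x] by simp
  then have "closure K0 = UNIV" by (intro equalityI subsetI UNIV_I)
  then show ?thesis by (simp only: K0_def)
qed


subsection \<open>Extension by density and strong limits\<close>

text \<open>The data are two families over one index set because \<open>v i\<close> is not visibly a
  function of \<open>u i\<close>; the norm bound, applied to differences, is what makes the
  assignment well defined. It produces the translation unitary, the intertwiner of two GNS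
  representations and the lift of a central element.\<close>

lemma dense_extension:
  fixes u :: "'i \<Rightarrow> 'a::complex_hilbert" and v :: "'i \<Rightarrow> 'b::complex_hilbert"
  assumes lin: "\<And>i j c. i \<in> I \<Longrightarrow> j \<in> I \<Longrightarrow> \<exists>l\<in>I. u l = u i + c *\<^sub>C u j \<and> v l = v i + c *\<^sub>C v j"
    and bound: "\<And>i. i \<in> I \<Longrightarrow> norm (v i) \<le> K * norm (u i)"
    and dense: "closure (u ` I) = UNIV"
  obtains T where "bounded_clinear T" "\<And>i. i \<in> I \<Longrightarrow> T (u i) = v i"
    "\<And>x. norm (T x) \<le> K * norm x"
proof -
  have lip: "norm (v i - v j) \<le> K * norm (u i - u j)" if ij: "i \<in> I" "j \<in> I" for i j
  proof -
    obtain l where "l \<in> I" "u l = u i + (-1) *\<^sub>C u j" "v l = v i + (-1) *\<^sub>C v j"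
      using lin[OF ij, of "-1"] by blast
    then show ?thesis using bound[of l] by simp
  qed
  have "\<exists>y. \<exists>f. (\<forall>n. f n \<in> I) \<and> (\<lambda>n. u (f n)) \<longlonglongrightarrow> x \<and> (\<lambda>n. v (f n)) \<longlonglongrightarrow> y" for x
  proof -
    have "x \<in> closure (u ` I)" using dense by simp
    then obtain g where g: "\<And>n. g n \<in> u ` I" "g \<longlonglongrightarrow> x" unfolding closure_sequential by blast
    then have "\<exists>i. i \<in> I \<and> g n = u i" for n by blast
    then obtain f where f: "\<And>n. f n \<in> I" "\<And>n. g n = u (f n)" by metis
    have uf: "(\<lambda>n. u (f n)) \<longlonglongrightarrow> x"
      using g(2) ext[of g "\<lambda>n. u (f n)", OF f(2)] by simp
    then have C: "Cauchy (\<lambda>n. u (f n))" by (rule LIMSEQ_imp_Cauchy)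
    have "Cauchy (\<lambda>n. v (f n))"
    proof (rule metric_CauchyI)
      fix e :: real assume e: "e > 0"
      have "e / (\<bar>K\<bar> + 1) > 0" using e by simp
      from metric_CauchyD[OF C this] obtain M
        where M: "\<And>m n. m \<ge> M \<Longrightarrow> n \<ge> M \<Longrightarrow> dist (u (f m)) (u (f n)) < e / (\<bar>K\<bar> + 1)" by blast
      have "dist (v (f m)) (v (f n)) < e" if "m \<ge> M" "n \<ge> M" for m n
      proof -
        have "dist (v (f m)) (v (f n)) \<le> K * dist (u (f m)) (u (f n))"
          using lip[OF f(1) f(1)] by (simp add: dist_norm)
        also have "\<dots> \<le> (\<bar>K\<bar> + 1) * dist (u (f m)) (u (f n))" by (intro mult_right_mono) auto
        also have "\<dots> < e" using M[OF that] by (simp add: field_simps)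
        finally show ?thesis .
      qed
      then show "\<exists>M. \<forall>m\<ge>M. \<forall>n\<ge>M. dist (v (f m)) (v (f n)) < e" by blast
    qed
    then obtain y where "(\<lambda>n. v (f n)) \<longlonglongrightarrow> y" using Cauchy_convergent convergent_def by blast
    with uf f(1) show ?thesis by (intro exI[of _ y] exI[of _ f] conjI allI)
  qed
  then obtain T where T: "\<And>x. \<exists>f. (\<forall>n. f n \<in> I) \<and> (\<lambda>n. u (f n)) \<longlonglongrightarrow> x \<and> (\<lambda>n. v (f n)) \<longlonglongrightarrow> T x"
    by metis
  define f where "f x = (SOME f. (\<forall>n. f n \<in> I) \<and> (\<lambda>n. u (f n)) \<longlonglongrightarrow> x \<and> (\<lambda>n. v (f n)) \<longlonglongrightarrow> T x)" for x
  have f: "f x n \<in> I" "(\<lambda>n. u (f x n)) \<longlonglongrightarrow> x" "(\<lambda>n. v (f x n)) \<longlonglongrightarrow> T x" for x n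
    using someI_ex[OF T[of x]] unfolding f_def by blast+
  have uniq: "T x = y" if h: "\<And>n. h n \<in> I" "(\<lambda>n. u (h n)) \<longlonglongrightarrow> x" "(\<lambda>n. v (h n)) \<longlonglongrightarrow> y" for x y h
  proof -
    have lim0: "(\<lambda>n. K * norm (u (f x n) - u (h n))) \<longlonglongrightarrow> 0"
      using tendsto_mult[OF tendsto_const tendsto_norm[OF tendsto_diff[OF f(2)[of x] h(2)]], of K] by simp
    have "(\<lambda>n. v (f x n) - v (h n)) \<longlonglongrightarrow> 0"
      by (rule Lim_null_comparison[OF _ lim0]) (use lip f(1) h(1) in auto)
    moreover have "(\<lambda>n. v (f x n) - v (h n)) \<longlonglongrightarrow> T x - y" by (intro tendsto_diff f h)
    ultimately show ?thesis using LIMSEQ_unique by fastforce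
  qed
  have lin': "T (x + c *\<^sub>C y) = T x + c *\<^sub>C T y" for x y c
  proof -
    have "\<exists>l. l \<in> I \<and> u l = u (f x n) + c *\<^sub>C u (f y n) \<and> v l = v (f x n) + c *\<^sub>C v (f y n)" for n
      using lin[OF f(1) f(1)] by blast
    then obtain h where h: "\<And>n. h n \<in> I" "\<And>n. u (h n) = u (f x n) + c *\<^sub>C u (f y n)"
      "\<And>n. v (h n) = v (f x n) + c *\<^sub>C v (f y n)" by metis
    show ?thesis
      by (rule uniq[of h]) (simp_all add: h tendsto_add tendsto_scaleC f)
  qed
  have nT: "norm (T x) \<le> K * norm x" for x
  proof (rule LIMSEQ_le)
    show "(\<lambda>n. norm (v (f x n))) \<longlonglongrightarrow> norm (T x)" by (intro tendsto_norm f)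
    show "(\<lambda>n. K * norm (u (f x n))) \<longlonglongrightarrow> K * norm x" by (intro tendsto_mult tendsto_const tendsto_norm f)
  qed (use bound f in auto)
  have T0: "T 0 = 0" using nT[of 0] by simp
  have "bounded_clinear T"
  proof (rule bounded_clinearI)
    show "T (x + y) = T x + T y" for x y using lin'[of x 1 y] by simp
    show "T (c *\<^sub>C x) = c *\<^sub>C T x" for c x using lin'[of 0 c x] T0 by simp
    show "norm (T x) \<le> K * norm x" for x by (rule nT)
  qed
  moreover have "T (u i) = v i" if "i \<in> I" for i
    by (rule uniq[of "\<lambda>_. i"]) (use that in auto)
  ultimately show ?thesis using nT that by blast
qed

text \<open>The uniform bound carries the Cauchy property from a dense set to every vector by an
  \<open>e / 3\<close> argument.\<close>

lemma strong_limit_exists: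
  fixes A :: "nat \<Rightarrow> 'a::complex_hilbert \<Rightarrow> 'b::complex_hilbert"
  assumes A: "\<And>n. bounded_clinear (A n)" "\<And>n x. norm (A n x) \<le> K * norm x"
    and dense: "closure D = UNIV" and conv: "\<And>x. x \<in> D \<Longrightarrow> convergent (\<lambda>n. A n x)"
  obtains B where "bounded_clinear B" "\<And>x. (\<lambda>n. A n x) \<longlonglongrightarrow> B x" "\<And>x. norm (B x) \<le> K * norm x"
proof -
  have conv': "convergent (\<lambda>n. A n x)" for x
  proof -
    have "Cauchy (\<lambda>n. A n x)"
    proof (rule metric_CauchyI)
      fix e :: real assume e: "e > 0"
      \<comment> \<open>The sign of \<open>K\<close> is unknown and \<open>K\<close> may vanish; the
        absolute value and the added 1 keep \<open>d\<close> positive and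
        \<open>\<bar>K\<bar> * d\<close> below \<open>e / 3\<close>.\<close>
      define d where "d = e / (3 * (\<bar>K\<bar> + 1))"
      have d: "d > 0" using e by (simp add: d_def)
      have Kd: "\<bar>K\<bar> * d < e / 3"
        using e mult_strict_right_mono[of "\<bar>K\<bar>" "\<bar>K\<bar> + 1" d] d by (simp add: d_def field_simps)
      have "x \<in> closure D" using dense by simp
      then obtain y where y: "y \<in> D" "dist y x < d" using d closure_approachable by metis
      have small: "norm (x - y) < d" using y by (simp add: dist_norm norm_minus_commute)
      have K: "norm (A n (x - y)) < e / 3" for n
      proof -
        have "norm (A n (x - y)) \<le> K * norm (x - y)" by (rule A)
        also have "\<dots> \<le> \<bar>K\<bar> * norm (x - y)" by (intro mult_right_mono) auto
        also have "\<dots> \<le> \<bar>K\<bar> * d" using small by (intro mult_left_mono) auto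
        finally show ?thesis using Kd by linarith
      qed
      have "Cauchy (\<lambda>n. A n y)" using conv[OF y(1)] by (rule convergent_Cauchy)
      from metric_CauchyD[OF this, of "e / 3"] e
      obtain N where N: "\<And>m n. m \<ge> N \<Longrightarrow> n \<ge> N \<Longrightarrow> dist (A m y) (A n y) < e / 3" by auto
      have "dist (A m x) (A n x) < e" if "m \<ge> N" "n \<ge> N" for m n
      proof -
        have "A m x - A n x = A m (x - y) + (A m y - A n y) - A n (x - y)"
          by (simp add: bounded_clinear_diff[OF A(1)])
        then have "norm (A m x - A n x) \<le> norm (A m (x - y)) + norm (A m y - A n y) + norm (A n (x - y))"
          using norm_triangle_ineq4[of "A m (x - y) + (A m y - A n y)" "A n (x - y)"]
            norm_triangle_ineq[of "A m (x - y)" "A m y - A n y"] by simp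
        also have "\<dots> < e" using K[of m] K[of n] N[OF that] by (simp add: dist_norm)
        finally show ?thesis by (simp add: dist_norm)
      qed
      then show "\<exists>N. \<forall>m\<ge>N. \<forall>n\<ge>N. dist (A m x) (A n x) < e" by blast
    qed
    then show ?thesis by (rule Cauchy_convergent)
  qed
  then obtain B where B: "\<And>x. (\<lambda>n. A n x) \<longlonglongrightarrow> B x" unfolding convergent_def by metis
  have nB: "norm (B x) \<le> K * norm x" for x
    by (rule LIMSEQ_le_const2[OF tendsto_norm[OF B]]) (use A in auto)
  have "bounded_clinear B"
  proof (rule bounded_clinearI)
    show "B (x + y) = B x + B y" for x y
      using LIMSEQ_unique[OF B[of "x + y"]] tendsto_add[OF B[of x] B[of y]]
      by (simp add: bounded_clinear_add[OF A(1)])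
    show "B (c *\<^sub>C x) = c *\<^sub>C B x" for c x
      using LIMSEQ_unique[OF B[of "c *\<^sub>C x"]] tendsto_scaleC[OF B[of x], of c]
      by (simp add: bounded_clinear_scaleC[OF A(1)])
    show "norm (B x) \<le> K * norm x" for x by (rule nB)
  qed
  with B nB that show ?thesis by blast
qed

lemma tendsto_of_dense:
  fixes A :: "nat \<Rightarrow> 'a::complex_hilbert \<Rightarrow> 'b::complex_hilbert"
  assumes A: "\<And>n. bounded_clinear (A n)" "\<And>n x. norm (A n x) \<le> K * norm x" and B: "bounded_clinear B"
    and dense: "closure D = UNIV" and lim: "\<And>x. x \<in> D \<Longrightarrow> (\<lambda>n. A n x) \<longlonglongrightarrow> B x"
  shows "(\<lambda>n. A n x) \<longlonglongrightarrow> B x"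
proof -
  have conv: "convergent (\<lambda>n. A n x)" if "x \<in> D" for x using lim[OF that] by (rule convergentI)
  obtain B' where B': "bounded_clinear B'" "\<And>x. (\<lambda>n. A n x) \<longlonglongrightarrow> B' x" "\<And>x. norm (B' x) \<le> K * norm x"
    by (rule strong_limit_exists[OF A dense conv]) (assumption | rule that)+
  have "B' = B" by (rule bounded_clinear_eq_on_dense[OF B'(1) B LIMSEQ_unique[OF B'(2) lim] dense])
  with B'(2) show ?thesis by simp
qed

lemma isometry_of_dense:
  assumes T: "bounded_clinear T" and D: "\<And>x. x \<in> D \<Longrightarrow> norm (T x) = norm x" and dense: "closure D = UNIV"
  shows "norm (T x) = norm x"
proof -
  have "x \<in> closure D" by (simp add: dense)
  then obtain f where f: "\<And>n. f n \<in> D" "f \<longlonglongrightarrow> x" unfolding closure_sequential by blast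
  have "(\<lambda>n. norm (f n)) \<longlonglongrightarrow> norm (T x)"
    using tendsto_norm[OF bounded_clinear_tendsto[OF T f(2)]] by (simp add: D[OF f(1)])
  from LIMSEQ_unique[OF this tendsto_norm[OF f(2)]] show ?thesis .
qed

lemma csubspace_range: "bounded_clinear T \<Longrightarrow> csubspace (range T)"
  unfolding csubspace_def
  by (auto simp: bounded_clinear_zero bounded_clinear_add[symmetric] bounded_clinear_scaleC[symmetric]
      intro: range_eqI[of _ _ 0])


subsection \<open>The mean ergodic theorem\<close>

text \<open>At \<open>n = 0\<close> the value is 0, since division by zero gives zero and the sum is
  empty.\<close>

definition cesaro :: "(nat \<Rightarrow> 'a::real_vector) \<Rightarrow> nat \<Rightarrow> 'a" where
  "cesaro f n = (1 / real n) *\<^sub>R (\<Sum>k<n. f k)"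

lemma cesaro_norm_le:
  fixes f :: "nat \<Rightarrow> 'a::real_normed_vector"
  assumes "\<And>k. norm (f k) \<le> C" "0 \<le> C"
  shows "norm (cesaro f n) \<le> C"
proof (cases "n = 0")
  case False
  have "norm (\<Sum>k<n. f k) \<le> real n * C"
    using sum_norm_le[of "{..<n}" f "\<lambda>_. C"] assms(1) by simp
  then show ?thesis using False by (simp add: cesaro_def divide_le_eq mult.commute)
qed (simp add: cesaro_def assms)

lemma cesaro_diff: "cesaro (\<lambda>k. f k - g k) n = cesaro f n - cesaro g n"
  by (simp add: cesaro_def sum_subtractf scaleR_diff_right)

lemma cesaro_const: "n > 0 \<Longrightarrow> cesaro (\<lambda>_. c) n = c"
  by (simp add: cesaro_def sum_constant_scaleR)

lemma cesaro_const_tendsto: "cesaro (\<lambda>_. c) \<longlonglongrightarrow> (c :: 'a::real_normed_vector)"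
  by (rule tendsto_eventually, rule eventually_sequentiallyI[of 1]) (simp add: cesaro_const)

lemma cesaro_bounded_clinear:
  "bounded_clinear T \<Longrightarrow> T (cesaro f n) = cesaro (\<lambda>k. T (f k)) n"
  by (simp add: cesaro_def bounded_clinear_scaleR bounded_clinear_sum)

lemma cesaro_eventually_zero:
  fixes f :: "nat \<Rightarrow> 'a::real_normed_vector"
  assumes "\<And>k. k \<ge> K \<Longrightarrow> f k = 0"
  shows "cesaro f \<longlonglongrightarrow> 0"
proof -
  have eq: "(\<Sum>k<n. f k) = (\<Sum>k<K. f k)" if "n \<ge> K" for n
    by (rule sum.mono_neutral_right) (use that assms in auto)
  have "(\<lambda>n. (1 / real n) *\<^sub>R (\<Sum>k<K. f k)) \<longlonglongrightarrow> 0 *\<^sub>R (\<Sum>k<K. f k)"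
    by (intro tendsto_scaleR tendsto_const lim_1_over_n)
  then have "(\<lambda>n. (1 / real n) *\<^sub>R (\<Sum>k<K. f k)) \<longlonglongrightarrow> 0" by simp
  moreover have "(1 / real n) *\<^sub>R (\<Sum>k<K. f k) = cesaro f n" if "n \<ge> K" for n
    unfolding cesaro_def eq[OF that] ..
  then have "\<forall>\<^sub>F n in sequentially. (1 / real n) *\<^sub>R (\<Sum>k<K. f k) = cesaro f n"
    by (rule eventually_sequentiallyI[of K])
  ultimately show ?thesis by (rule Lim_transform_eventually)
qed

lemma cesaro_eventually_cong:
  fixes f g :: "nat \<Rightarrow> 'a::real_normed_vector"
  assumes eq: "\<And>k. k \<ge> K \<Longrightarrow> f k = g k" and g: "cesaro g \<longlonglongrightarrow> l"
  shows "cesaro f \<longlonglongrightarrow> l"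
proof -
  have "cesaro (\<lambda>k. f k - g k) \<longlonglongrightarrow> 0"
    by (rule cesaro_eventually_zero[of K]) (simp add: eq)
  from tendsto_add[OF this g] show ?thesis by (simp add: cesaro_diff)
qed

text \<open>Averaging does not increase an error that is uniform in \<open>k\<close>, so the
  sequence and its limit may both be replaced by approximations. In the uses, uniformity comes from
  powers of an isometry.\<close>

lemma cesaro_approx:
  fixes f :: "nat \<Rightarrow> 'a::real_normed_vector"
  assumes "\<And>e. e > 0 \<Longrightarrow> \<exists>g l'. (\<forall>k. norm (f k - g k) \<le> e) \<and> norm (l' - l) \<le> e \<and> cesaro g \<longlonglongrightarrow> l'"
  shows "cesaro f \<longlonglongrightarrow> l"
proof (rule metric_LIMSEQ_I)
  fix e :: real assume e: "e > 0"
  then obtain g l' where g: "\<And>k. norm (f k - g k) \<le> e / 4" "norm (l' - l) \<le> e / 4"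
    and lim: "cesaro g \<longlonglongrightarrow> l'"
    using assms[of "e / 4"] by auto
  obtain N where N: "\<And>n. n \<ge> N \<Longrightarrow> dist (cesaro g n) l' < e / 4"
    using metric_LIMSEQ_D[OF lim, of "e / 4"] e by auto
  have "dist (cesaro f n) l < e" if "n \<ge> N" for n
  proof -
    have "cesaro f n - l = cesaro (\<lambda>k. f k - g k) n + (cesaro g n - l') + (l' - l)"
      by (simp add: cesaro_diff)
    moreover have "norm (cesaro (\<lambda>k. f k - g k) n) \<le> e / 4"
      by (rule cesaro_norm_le) (use g e in auto)
    ultimately have "norm (cesaro f n - l) \<le> e / 4 + norm (cesaro g n - l') + norm (l' - l)"
      using norm_triangle_ineq[of "cesaro (\<lambda>k. f k - g k) n + (cesaro g n - l')" "l' - l"]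
        norm_triangle_ineq[of "cesaro (\<lambda>k. f k - g k) n" "cesaro g n - l'"] by simp
    then show ?thesis using N[OF that] g(2) e by (simp add: dist_norm)
  qed
  then show "\<exists>N. \<forall>n\<ge>N. dist (cesaro f n) l < e" by blast
qed

lemma norm_funpow_isometry:
  fixes V :: "'a::real_normed_vector \<Rightarrow> 'a"
  shows "(\<And>x. norm (V x) = norm x) \<Longrightarrow> norm ((V ^^ k) x) = norm x"
  by (induction k) simp_all

text \<open>Polarisation: norms determine real parts of inner products, and replacing
  \<open>y\<close> by \<open>\<i> *\<^sub>C y\<close> supplies the imaginary parts.\<close>

lemma isometry_cinner:
  assumes V: "bounded_clinear V" and iso: "\<And>x. norm (V x) = norm x"
  shows "cinner (V x) (V y) = cinner x y"
proof -
  have re: "Re (cinner (V x) (V y)) = Re (cinner x y)" for x y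
  proof -
    have polar: "4 * Re (cinner a b) = (norm (a + b))\<^sup>2 - (norm (a - b))\<^sup>2" for a b :: "'c::complex_hilbert"
    proof -
      have "Re (cinner b a) = Re (cinner a b)" using cinner_commute[of b a] by simp
      then show ?thesis
        by (simp add: norm_power2 cinner_add_left cinner_add_right cinner_diff_left cinner_diff_right)
    qed
    show ?thesis using polar[of x y] polar[of "V x" "V y"]
      by (simp add: iso flip: bounded_clinear_add[OF V] bounded_clinear_diff[OF V])
  qed
  have "Re (cinner (V x) (V (\<i> *\<^sub>C y))) = Re (cinner x (\<i> *\<^sub>C y))" by (rule re)
  then have "Im (cinner (V x) (V y)) = Im (cinner x y)"
    by (simp add: bounded_clinear_scaleC[OF V] cinner_scaleC_right)
  with re show ?thesis by (simp add: complex_eq_iff)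
qed

text \<open>Decompose \<open>x = f + r\<close> with \<open>r\<close> in the closure of the range of
  \<open>V - 1\<close>, where the sums telescope, and \<open>f\<close> orthogonal to it.
  Orthogonality of \<open>f\<close> to \<open>V f - f\<close> gives
  \<open>cinner (V f) f = cinner f f\<close>, and for an isometry this forces
  \<open>V f = f\<close>.\<close>

theorem mean_ergodic:
  fixes V :: "'a::complex_hilbert \<Rightarrow> 'a"
  assumes V: "bounded_clinear V" and iso: "\<And>x. norm (V x) = norm x"
  obtains f where "V f = f" "cesaro (\<lambda>k. (V ^^ k) x) \<longlonglongrightarrow> f"
proof -
  define R where "R = range (\<lambda>y. V y - y)"
  have R: "csubspace R" unfolding R_def
    using csubspace_range[OF bounded_clinear_minus[OF V bounded_clinear_id]] by simp
  obtain r where r: "r \<in> closure R" and orth: "\<And>s. s \<in> closure R \<Longrightarrow> cinner s (x - r) = 0"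
    using orthogonal_projection_exists[OF csubspace_closure[OF R] closed_closure] by blast
  define f where "f = x - r"
  have "V f - f \<in> R" by (simp add: R_def)
  then have "V f - f \<in> closure R" by (rule subsetD[OF closure_subset])
  then have "cinner (V f - f) f = 0" using orth by (simp add: f_def)
  then have vf: "cinner (V f) f = cinner f f" by (simp add: cinner_diff_left)
  then have fv: "cinner f (V f) = cinner f f" by (metis cinner_commute)
  have "cinner (V f - f) (V f - f) = 0"
    by (simp add: cinner_diff_left cinner_diff_right vf fv isometry_cinner[OF V iso])
  then have fix_f: "V f = f" by (simp add: cinner_self)
  then have powf: "(V ^^ k) f = f" for k by (induction k) simp_all
  have zero: "cesaro (\<lambda>k. (V ^^ k) (V y - y)) \<longlonglongrightarrow> 0" for y
  proof -
    have tel: "(\<Sum>k<n. (V ^^ k) (V y - y)) = (V ^^ n) y - y" for n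
    proof -
      have "(V ^^ k) (V y - y) = (V ^^ Suc k) y - (V ^^ k) y" for k
        by (simp add: bounded_clinear_diff[OF bounded_clinear_funpow[OF V]] funpow_swap1)
      then have "(\<Sum>k<n. (V ^^ k) (V y - y)) = (\<Sum>k<n. (V ^^ Suc k) y - (V ^^ k) y)" by simp
      also have "\<dots> = (V ^^ n) y - y" by (induction n) (simp_all)
      finally show ?thesis .
    qed
    have lim: "(\<lambda>n. (1 / real n) * (2 * norm y)) \<longlonglongrightarrow> 0"
      using tendsto_mult[OF lim_1_over_n tendsto_const, of "2 * norm y"] by simp
    have "norm ((V ^^ n) y - y) \<le> 2 * norm y" for n
      using norm_triangle_ineq4[of "(V ^^ n) y" y] by (simp add: norm_funpow_isometry[of V, OF iso])
    then have "norm (cesaro (\<lambda>k. (V ^^ k) (V y - y)) n) \<le> (1 / real n) * (2 * norm y)" for n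
      unfolding cesaro_def tel by (simp add: divide_right_mono)
    then show ?thesis by (intro Lim_null_comparison[OF _ lim]) simp
  qed
  have "cesaro (\<lambda>k. (V ^^ k) r) \<longlonglongrightarrow> 0"
  proof (rule cesaro_approx)
    fix e :: real assume e: "e > 0"
    obtain y where y: "dist (V y - y) r < e"
      using r e unfolding closure_approachable R_def by blast
    have "norm ((V ^^ k) r - (V ^^ k) (V y - y)) \<le> e" for k
      using y norm_funpow_isometry[of V k "r - (V y - y)", OF iso]
      by (simp add: bounded_clinear_diff[OF bounded_clinear_funpow[OF V]] dist_norm norm_minus_commute)
    then show "\<exists>g l'. (\<forall>k. norm ((V ^^ k) r - g k) \<le> e) \<and> norm (l' - 0) \<le> e \<and> cesaro g \<longlonglongrightarrow> l'"
      using zero[of y] e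
      by (intro exI[of _ "\<lambda>k. (V ^^ k) (V y - y)"] exI[of _ 0]) simp
  qed
  moreover have "cesaro (\<lambda>k. (V ^^ k) x) n - cesaro (\<lambda>_. f) n = cesaro (\<lambda>k. (V ^^ k) r) n" for n
    unfolding cesaro_diff[symmetric] using powf
    by (simp add: f_def bounded_clinear_diff[OF bounded_clinear_funpow[OF V]] algebra_simps)
  ultimately have "(\<lambda>n. cesaro (\<lambda>k. (V ^^ k) x) n - cesaro (\<lambda>_. f) n) \<longlonglongrightarrow> 0" by simp
  from tendsto_add[OF this cesaro_const_tendsto[of f]]
  have "cesaro (\<lambda>k. (V ^^ k) x) \<longlonglongrightarrow> f" by simp
  with fix_f that show ?thesis by blast
qed


subsection \<open>Square roots in norm-closed operator algebras\<close>

text \<open>Norm-closedness is kept apart, as \<open>op_closure \<AA> \<subseteq> \<AA>\<close>, so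
  that the algebras of finite intervals, their union and its closure fall under one notion; the
  square roots ask for it separately.\<close>

definition star_algebra :: "('a::complex_hilbert \<Rightarrow> 'a) set \<Rightarrow> bool" where
  "star_algebra \<AA> \<longleftrightarrow> (\<forall>T\<in>\<AA>. bounded_clinear T) \<and> id \<in> \<AA> \<and>
     (\<forall>S\<in>\<AA>. \<forall>T\<in>\<AA>. (\<lambda>x. S x + T x) \<in> \<AA>) \<and> (\<forall>c. \<forall>T\<in>\<AA>. (\<lambda>x. c *\<^sub>C T x) \<in> \<AA>) \<and>
     (\<forall>S\<in>\<AA>. \<forall>T\<in>\<AA>. S \<circ> T \<in> \<AA>) \<and> (\<forall>T\<in>\<AA>. hadj T \<in> \<AA>)"

lemma star_algebraD:
  assumes "star_algebra \<AA>"
  shows star_algebra_bounded: "T \<in> \<AA> \<Longrightarrow> bounded_clinear T"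
    and star_algebra_id: "id \<in> \<AA>"
    and star_algebra_plus: "S \<in> \<AA> \<Longrightarrow> T \<in> \<AA> \<Longrightarrow> (\<lambda>x. S x + T x) \<in> \<AA>"
    and star_algebra_cscale: "T \<in> \<AA> \<Longrightarrow> (\<lambda>x. c *\<^sub>C T x) \<in> \<AA>"
    and star_algebra_compose: "S \<in> \<AA> \<Longrightarrow> T \<in> \<AA> \<Longrightarrow> S \<circ> T \<in> \<AA>"
    and star_algebra_hadj: "T \<in> \<AA> \<Longrightarrow> hadj T \<in> \<AA>"
  using assms by (auto simp: star_algebra_def)

lemma star_algebra_minus:
  assumes "star_algebra \<AA>" "S \<in> \<AA>" "T \<in> \<AA>"
  shows "(\<lambda>x. S x - T x) \<in> \<AA>"
  using star_algebra_plus[OF assms(1,2) star_algebra_cscale[OF assms(1,3), of "-1"]] by simp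

lemma star_algebra_zero: "star_algebra \<AA> \<Longrightarrow> (\<lambda>_. 0) \<in> \<AA>"
  using star_algebra_cscale[OF _ star_algebra_id, of \<AA> 0] by simp

lemma star_algebra_sum:
  assumes "star_algebra \<AA>"
  shows "(\<And>i. i \<in> I \<Longrightarrow> T i \<in> \<AA>) \<Longrightarrow> (\<lambda>x. \<Sum>i\<in>I. T i x) \<in> \<AA>"
  by (induction I rule: infinite_finite_induct)
    (simp_all add: star_algebra_zero[OF assms] star_algebra_plus[OF assms])

lemma star_algebra_commutant:
  assumes "\<And>A. A \<in> S \<Longrightarrow> bounded_clinear A" "\<And>A. A \<in> S \<Longrightarrow> hadj A \<in> S"
  shows "star_algebra (commutant S)"
  unfolding star_algebra_def
  using assms
  by (auto intro: commutant_bounded commutant_id commutant_plus commutant_cscale commutant_compose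
      commutant_hadj)

lemma op_closure_approx:
  assumes "T \<in> op_closure S" "e > 0"
  obtains A where "A \<in> S" "onorm (\<lambda>x. T x - A x) < e"
  using assms unfolding op_closure_def by blast

text \<open>Commutants are norm-closed, so square roots can be taken inside the commutant of a
  self-adjoint operator.\<close>

lemma op_closure_commutant:
  assumes bd: "\<And>A. A \<in> S \<Longrightarrow> bounded_clinear A"
  shows "op_closure (commutant S) \<subseteq> commutant S"
proof
  fix T assume T: "T \<in> op_closure (commutant S)"
  then have bT: "bounded_clinear T" by (simp add: op_closure_def)
  show "T \<in> commutant S"
  proof (rule commutantI[OF bT])
    fix A x assume A: "A \<in> S"
    note bA = bd[OF A]
    define C where "C = norm (A x) + onorm A * norm x + 1"
    have C: "C > 0" using bounded_clinear_onorm_nonneg[OF bA] by (simp add: C_def add_nonneg_pos)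
    have "norm (T (A x) - A (T x)) \<le> 0 + e" if e: "e > 0" for e
    proof -
      from e C have "e / C > 0" by simp
      then obtain B where B: "B \<in> commutant S" "onorm (\<lambda>x. T x - B x) < e / C"
        by (rule op_closure_approx[OF T])
      have bTB: "bounded_clinear (\<lambda>x. T x - B x)"
        by (intro bounded_clinear_minus bT commutant_bounded[OF B(1)])
      have le: "norm (T y - B y) \<le> e / C * norm y" for y
        using bounded_clinear_norm[OF bTB, of y] mult_right_mono[OF less_imp_le[OF B(2)], of "norm y"]
        by simp
      have "T (A x) - A (T x) = (T (A x) - B (A x)) - A (T x - B x)"
        using commutant_apply[OF B(1) A] by (simp add: bounded_clinear_diff[OF bA])
      then have "norm (T (A x) - A (T x)) \<le> norm (T (A x) - B (A x)) + norm (A (T x - B x))"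
        using norm_triangle_ineq4[of "T (A x) - B (A x)" "A (T x - B x)"] by (simp only:)
      also have "\<dots> \<le> e / C * norm (A x) + onorm A * (e / C * norm x)"
        using le[of "A x"] bounded_clinear_norm[OF bA, of "T x - B x"]
          mult_left_mono[OF le[of x] bounded_clinear_onorm_nonneg[OF bA]] by linarith
      also have "\<dots> = e / C * (norm (A x) + onorm A * norm x)" by (simp add: algebra_simps)
      also have "\<dots> \<le> e / C * C" using e C by (intro mult_left_mono) (auto simp: C_def)
      finally show ?thesis using C by simp
    qed
    then have "norm (T (A x) - A (T x)) \<le> 0" by (rule field_le_epsilon)
    then show "T (A x) = A (T x)" by simp
  qed
qed

lemma onorm_triangle_diff:
  assumes "bounded_clinear R" "bounded_clinear S" "bounded_clinear T"
  shows "onorm (\<lambda>x. R x - T x) \<le> onorm (\<lambda>x. R x - S x) + onorm (\<lambda>x. S x - T x)"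
proof (rule onorm_bound)
  have 1: "bounded_clinear (\<lambda>x. R x - S x)" and 2: "bounded_clinear (\<lambda>x. S x - T x)"
    by (intro bounded_clinear_minus assms)+
  show "0 \<le> onorm (\<lambda>x. R x - S x) + onorm (\<lambda>x. S x - T x)"
    by (intro add_nonneg_nonneg bounded_clinear_onorm_nonneg 1 2)
  show "norm (R x - T x) \<le> (onorm (\<lambda>x. R x - S x) + onorm (\<lambda>x. S x - T x)) * norm x" for x
    using norm_triangle_ineq[of "R x - S x" "S x - T x"]
      bounded_clinear_norm[OF 1, of x] bounded_clinear_norm[OF 2, of x] by (simp add: distrib_right)
qed

lemma subset_op_closure: "(\<And>T. T \<in> S \<Longrightarrow> bounded_clinear T) \<Longrightarrow> S \<subseteq> op_closure S"
  by (auto simp: op_closure_def onorm_zero intro!: bexI)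

lemma op_closure_mono: "S \<subseteq> S' \<Longrightarrow> op_closure S \<subseteq> op_closure S'"
  unfolding op_closure_def by blast

lemma op_closure_idem:
  assumes bd: "\<And>T. T \<in> S \<Longrightarrow> bounded_clinear T"
  shows "op_closure (op_closure S) \<subseteq> op_closure S"
proof
  fix T assume T: "T \<in> op_closure (op_closure S)"
  then have bT: "bounded_clinear T" by (simp add: op_closure_def)
  have "\<exists>A\<in>S. onorm (\<lambda>x. T x - A x) < e" if e: "e > 0" for e
  proof -
    from e have e2: "e / 2 > 0" by simp
    obtain B where B: "B \<in> op_closure S" "onorm (\<lambda>x. T x - B x) < e / 2"
      by (rule op_closure_approx[OF T e2])
    obtain A where A: "A \<in> S" "onorm (\<lambda>x. B x - A x) < e / 2"
      by (rule op_closure_approx[OF B(1) e2])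
    have "bounded_clinear B" using B(1) by (simp add: op_closure_def)
    from onorm_triangle_diff[OF bT this bd[OF A(1)]] A B show ?thesis by (intro bexI[of _ A]) auto
  qed
  with bT show "T \<in> op_closure S" by (simp add: op_closure_def)
qed

lemma onorm_bounded_clinear_compose:
  assumes "bounded_clinear S" "bounded_clinear T"
  shows "onorm (S \<circ> T) \<le> onorm S * onorm T"
  using onorm_compose[of S T] assms by (simp add: bounded_clinear_def)

lemma star_algebra_op_closure:
  assumes L: "star_algebra L"
  shows "star_algebra (op_closure L)"
  unfolding star_algebra_def
proof (intro conjI ballI allI)
  note bL = star_algebra_bounded[OF L]
  have bd: "bounded_clinear T" if "T \<in> op_closure L" for T using that by (simp add: op_closure_def)
  show "bounded_clinear T" if "T \<in> op_closure L" for T by (rule bd[OF that])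
  show "id \<in> op_closure L" using subset_op_closure[of L] bL star_algebra_id[OF L] by blast
  show "(\<lambda>x. S x + T x) \<in> op_closure L" if S: "S \<in> op_closure L" and T: "T \<in> op_closure L" for S T
  proof -
    have "\<exists>A\<in>L. onorm (\<lambda>x. S x + T x - A x) < e" if e: "e > 0" for e
    proof -
      from e have e2: "e / 2 > 0" by simp
      obtain A where A: "A \<in> L" "onorm (\<lambda>x. S x - A x) < e / 2" by (rule op_closure_approx[OF S e2])
      obtain B where B: "B \<in> L" "onorm (\<lambda>x. T x - B x) < e / 2" by (rule op_closure_approx[OF T e2])
      have "onorm (\<lambda>x. (S x - A x) + (T x - B x)) \<le> onorm (\<lambda>x. S x - A x) + onorm (\<lambda>x. T x - B x)"
        using bounded_clinear_minus[OF bd[OF S] bL[OF A(1)]] bounded_clinear_minus[OF bd[OF T] bL[OF B(1)]]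
        by (intro onorm_triangle) (auto simp: bounded_clinear_def)
      moreover have "(\<lambda>x. (S x - A x) + (T x - B x)) = (\<lambda>x. S x + T x - (A x + B x))" by auto
      ultimately show ?thesis using A B
        by (intro bexI[OF _ star_algebra_plus[OF L A(1) B(1)]]) auto
    qed
    then show ?thesis using bounded_clinear_plus[OF bd[OF S] bd[OF T]] by (simp add: op_closure_def)
  qed
  show "(\<lambda>x. c *\<^sub>C T x) \<in> op_closure L" if T: "T \<in> op_closure L" for T c
  proof -
    have "\<exists>A\<in>L. onorm (\<lambda>x. c *\<^sub>C T x - A x) < e" if e: "e > 0" for e
    proof -
      have d: "e / (cmod c + 1) > 0" using e by (simp add: add_nonneg_pos)
      obtain A where A: "A \<in> L" "onorm (\<lambda>x. T x - A x) < e / (cmod c + 1)"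
        by (rule op_closure_approx[OF T d])
      have b: "bounded_clinear (\<lambda>x. T x - A x)" by (intro bounded_clinear_minus bd[OF T] bL[OF A(1)])
      have "onorm (\<lambda>x. c *\<^sub>C T x - c *\<^sub>C A x) \<le> cmod c * onorm (\<lambda>x. T x - A x)"
        using mult_left_mono[OF bounded_clinear_norm[OF b], of "cmod c"] bounded_clinear_onorm_nonneg[OF b]
        by (intro onorm_bound) (simp_all add: norm_scaleC mult.assoc flip: scaleC_diff_right)
      also have "\<dots> \<le> (cmod c + 1) * onorm (\<lambda>x. T x - A x)"
        using bounded_clinear_onorm_nonneg[OF b] by (intro mult_right_mono) auto
      also have "\<dots> < e" using A(2) by (simp add: less_divide_eq mult.commute add_nonneg_pos)
      finally show ?thesis by (rule bexI[OF _ star_algebra_cscale[OF L A(1)]])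
    qed
    then show ?thesis using bounded_clinear_cscale[OF bd[OF T]] by (simp add: op_closure_def)
  qed
  show "S \<circ> T \<in> op_closure L" if S: "S \<in> op_closure L" and T: "T \<in> op_closure L" for S T
  proof -
    have "\<exists>A\<in>L. onorm (\<lambda>x. (S \<circ> T) x - A x) < e" if e: "e > 0" for e
    proof -
      \<comment> \<open>The difference of \<open>S T\<close> and \<open>A B\<close> is split as
        \<open>S (T - B) + (S - A) B\<close>. \<open>B\<close> is chosen first, because the
        tolerance for \<open>A\<close> depends on the norm of \<open>B\<close>.\<close>
      define C where "C = onorm S + 1"
      have C: "C > 0" using bounded_clinear_onorm_nonneg[OF bd[OF S]] by (simp add: C_def add_nonneg_pos)
      have d: "e / (2 * C) > 0" using e C by simp
      obtain B where B: "B \<in> L" "onorm (\<lambda>x. T x - B x) < e / (2 * C)" by (rule op_closure_approx[OF T d])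
      define D where "D = onorm B + 1"
      have D: "D > 0" using bounded_clinear_onorm_nonneg[OF bL[OF B(1)]] by (simp add: D_def add_nonneg_pos)
      have d: "e / (2 * D) > 0" using e D by simp
      obtain A where A: "A \<in> L" "onorm (\<lambda>x. S x - A x) < e / (2 * D)" by (rule op_closure_approx[OF S d])
      have b1: "bounded_clinear (\<lambda>x. T x - B x)" by (intro bounded_clinear_minus bd[OF T] bL[OF B(1)])
      have b2: "bounded_clinear (\<lambda>x. S x - A x)" by (intro bounded_clinear_minus bd[OF S] bL[OF A(1)])
      have "onorm (\<lambda>x. (S \<circ> T) x - (S \<circ> B) x) \<le> onorm S * onorm (\<lambda>x. T x - B x)"
        using onorm_bounded_clinear_compose[OF bd[OF S] b1]
        by (simp add: o_def bounded_clinear_diff[OF bd[OF S]])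
      also have "\<dots> \<le> C * onorm (\<lambda>x. T x - B x)"
        using bounded_clinear_onorm_nonneg[OF b1] by (intro mult_right_mono) (auto simp: C_def)
      also have "\<dots> < e / 2" using B(2) C by (simp add: field_simps)
      finally have 1: "onorm (\<lambda>x. (S \<circ> T) x - (S \<circ> B) x) < e / 2" .
      have "onorm (\<lambda>x. (S \<circ> B) x - (A \<circ> B) x) \<le> onorm (\<lambda>x. S x - A x) * onorm B"
        using onorm_bounded_clinear_compose[OF b2 bL[OF B(1)]] by (simp add: o_def)
      also have "\<dots> \<le> onorm (\<lambda>x. S x - A x) * D"
        using bounded_clinear_onorm_nonneg[OF b2] by (intro mult_left_mono) (auto simp: D_def)
      also have "\<dots> < e / 2" using A(2) D by (simp add: field_simps)
      finally have 2: "onorm (\<lambda>x. (S \<circ> B) x - (A \<circ> B) x) < e / 2" .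
      have "onorm (\<lambda>x. (S \<circ> T) x - (A \<circ> B) x) < e"
        using onorm_triangle_diff[of "S \<circ> T" "S \<circ> B" "A \<circ> B"] 1 2 bd[OF S] bd[OF T] bL[OF A(1)] bL[OF B(1)]
        by (force simp: bounded_clinear_compose)
      then show ?thesis using star_algebra_compose[OF L A(1) B(1)] by blast
    qed
    then show ?thesis using bounded_clinear_compose[OF bd[OF S] bd[OF T]] by (simp add: op_closure_def)
  qed
  show "hadj T \<in> op_closure L" if T: "T \<in> op_closure L" for T
  proof -
    have "\<exists>A\<in>L. onorm (\<lambda>x. hadj T x - A x) < e" if e: "e > 0" for e
    proof -
      obtain A where A: "A \<in> L" "onorm (\<lambda>x. T x - A x) < e" by (rule op_closure_approx[OF T e])
      have b: "bounded_clinear (\<lambda>x. T x - A x)" by (intro bounded_clinear_minus bd[OF T] bL[OF A(1)])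
      have "hadj (\<lambda>x. T x - A x) = (\<lambda>x. hadj T x - hadj A x)"
        by (rule hadj_eqI[OF b])
          (simp add: cinner_diff_left cinner_diff_right cinner_hadj_right bd[OF T] bL[OF A(1)])
      then have "onorm (\<lambda>x. hadj T x - hadj A x) < e" using onorm_hadj_le[OF b] A(2) by simp
      then show ?thesis using star_algebra_hadj[OF L A(1)] by blast
    qed
    then show ?thesis using bounded_clinear_hadj[OF bd[OF T]] by (simp add: op_closure_def)
  qed
qed

text \<open>With \<open>r = \<parallel>X\<parallel> < 1\<close>, the map \<open>Y \<mapsto> (X + Y\<^sup>2) / 2\<close> is a contraction of the self-adjoint elements
  of norm at most \<open>r\<close>; at its fixed point, \<open>(1 - Y)\<^sup>2 = 1 - X\<close>.\<close>

lemma sqrt_one_minus: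
  assumes alg: "star_algebra \<AA>" and closed: "op_closure \<AA> \<subseteq> \<AA>"
    and X: "X \<in> \<AA>" "hadj X = X" "onorm X < 1"
  obtains S where "S \<in> \<AA>" "hadj S = S" "\<And>x. S (S x) = x - X x"
proof -
  note bd = star_algebra_bounded[OF alg]
  define r where "r = onorm X"
  have r: "0 \<le> r" "r < 1" using X(3) bounded_clinear_onorm_nonneg[OF bd[OF X(1)]] by (auto simp: r_def)
  \<comment> \<open>The type of bounded linear maps, with the operator norm as distance, supplies
    the complete metric space in which the fixed point is sought.\<close>
  define bX where "bX = Blinfun X"
  have blX: "bounded_linear X" using bd[OF X(1)] by (simp add: bounded_clinear_def)
  have bX: "blinfun_apply bX = X" by (simp add: bX_def bounded_linear_Blinfun_apply[OF blX])
  have nX: "norm bX = r" by (simp add: norm_blinfun.rep_eq bX r_def)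
  define W where "W = {Y :: 'a \<Rightarrow>\<^sub>L 'a. blinfun_apply Y \<in> \<AA> \<and>
    (\<forall>x y. cinner (Y x) y = cinner x (Y y)) \<and> norm Y \<le> r}"
  define F where "F Y = (1/2 :: real) *\<^sub>R (bX + (Y o\<^sub>L Y))" for Y :: "'a \<Rightarrow>\<^sub>L 'a"
  have half: "(1/2 :: complex) *\<^sub>C y = (1/2) *\<^sub>R y" for y :: 'a
    using scaleR_scaleC[of "1/2" y] by simp
  have Fapp: "blinfun_apply (F Y) = (\<lambda>x. (1/2 :: complex) *\<^sub>C (X x + (blinfun_apply Y \<circ> blinfun_apply Y) x))" for Y
    unfolding half by (rule ext) (simp add: F_def bX scaleR_blinfun.rep_eq plus_blinfun.rep_eq)
  have adjX: "cinner (X x) y = cinner x (X y)" for x y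
    using cinner_hadj_right[OF bd[OF X(1)], of x y] X(2) by simp
  have "closed W"
    unfolding closed_sequential_limits
  proof (intro allI impI, elim conjE)
    fix f l assume f: "\<forall>n. f n \<in> W" and lim: "f \<longlonglongrightarrow> l"
    have lim': "(\<lambda>n. f n x) \<longlonglongrightarrow> l x" for x
      by (intro blinfun.tendsto lim tendsto_const)
    have "norm l \<le> r"
      by (rule LIMSEQ_le_const2[OF tendsto_norm[OF lim]]) (use f in \<open>auto simp: W_def\<close>)
    moreover have "cinner (l x) y = cinner x (l y)" for x y
    proof (rule LIMSEQ_unique)
      show "(\<lambda>n. cinner (f n x) y) \<longlonglongrightarrow> cinner (l x) y" by (intro tendsto_cinner lim' tendsto_const)
      have "(\<lambda>n. cinner x (f n y)) \<longlonglongrightarrow> cinner x (l y)" by (intro tendsto_cinner lim' tendsto_const)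
      then show "(\<lambda>n. cinner (f n x) y) \<longlonglongrightarrow> cinner x (l y)" using f by (simp add: W_def)
    qed
    moreover have "blinfun_apply l \<in> op_closure \<AA>"
      unfolding op_closure_def
    proof (intro CollectI conjI allI impI)
      have "l (c *\<^sub>C x) = c *\<^sub>C l x" for c x
      proof (rule LIMSEQ_unique[OF lim'])
        have "f n (c *\<^sub>C x) = c *\<^sub>C f n x" for n
          using f bd[of "blinfun_apply (f n)"] by (simp add: W_def bounded_clinear_scaleC)
        then show "(\<lambda>n. f n (c *\<^sub>C x)) \<longlonglongrightarrow> c *\<^sub>C l x"
          using tendsto_scaleC[OF lim'[of x], of c] by simp
      qed
      then show "bounded_clinear (blinfun_apply l)"
        by (simp add: bounded_clinear_def blinfun.bounded_linear_right)
      fix e :: real assume "e > 0"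
      from metric_LIMSEQ_D[OF lim this] obtain n where "dist (f n) l < e" by blast
      then have "norm (l - f n) < e" by (simp add: dist_norm norm_minus_commute)
      then have "onorm (\<lambda>x. l x - f n x) < e"
        by (simp add: norm_blinfun.rep_eq minus_blinfun.rep_eq)
      then show "\<exists>A\<in>\<AA>. onorm (\<lambda>x. l x - A x) < e" using f by (auto simp: W_def)
    qed
    ultimately show "l \<in> W" using closed by (auto simp: W_def)
  qed
  then have "complete W" by (simp add: complete_eq_closed)
  moreover have "0 \<in> W"
    using star_algebra_zero[OF alg] r by (simp add: W_def zero_blinfun.rep_eq)
  then have "W \<noteq> {}" by blast
  moreover have "F ` W \<subseteq> W"
  proof (intro image_subsetI)
    fix Y assume Y: "Y \<in> W"
    have 1: "blinfun_apply (F Y) \<in> \<AA>" unfolding Fapp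
      by (intro star_algebra_cscale[OF alg] star_algebra_plus[OF alg] X(1) star_algebra_compose[OF alg])
        (use Y in \<open>auto simp: W_def\<close>)
    have 2: "cinner (F Y x) y = cinner x (F Y y)" for x y
      using Y unfolding Fapp
      by (simp add: cinner_scaleC_left cinner_scaleC_right cinner_add_left cinner_add_right adjX W_def)
    have nY: "norm Y \<le> r" using Y by (simp add: W_def)
    have "norm (F Y) \<le> (1/2) * (r + norm Y * norm Y)"
      unfolding F_def using norm_triangle_ineq[of bX "Y o\<^sub>L Y"] norm_blinfun_compose[of Y Y] nX by simp
    also have "\<dots> \<le> (1/2) * (r + 1 * r)"
      using nY r by (intro mult_left_mono add_left_mono mult_mono) auto
    finally have 3: "norm (F Y) \<le> r" by simp
    show "F Y \<in> W" using 1 2 3 by (simp add: W_def)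
  qed
  moreover have "\<forall>Y\<in>W. \<forall>Z\<in>W. dist (F Y) (F Z) \<le> r * dist Y Z"
  proof (intro ballI)
    fix Y Z assume YZ: "Y \<in> W" "Z \<in> W"
    \<comment> \<open>Difference of squares without commutativity: each of the two terms has norm at
      most \<open>r\<close> times the distance, and the factor one half makes up for their
      number.\<close>
    have "F Y - F Z = (1/2 :: real) *\<^sub>R ((Y o\<^sub>L (Y - Z)) + ((Y - Z) o\<^sub>L Z))"
      by (rule blinfun_eqI) (simp add: F_def blinfun.diff_left blinfun.diff_right blinfun.add_left
          blinfun.scaleR_left algebra_simps)
    then have "norm (F Y - F Z) \<le> (1/2) * (norm Y * norm (Y - Z) + norm (Y - Z) * norm Z)"
      using norm_triangle_ineq[of "Y o\<^sub>L (Y - Z)" "(Y - Z) o\<^sub>L Z"]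
        norm_blinfun_compose[of Y "Y - Z"] norm_blinfun_compose[of "Y - Z" Z] by simp
    also have "\<dots> \<le> (1/2) * (r * norm (Y - Z) + norm (Y - Z) * r)"
      using YZ by (intro mult_left_mono add_mono mult_right_mono) (auto simp: W_def)
    finally show "dist (F Y) (F Z) \<le> r * dist Y Z" by (simp add: dist_norm)
  qed
  ultimately have "\<exists>!Y\<in>W. F Y = Y" using r by (intro Banach_fix[of W r F]) auto
  then obtain Y where Y: "Y \<in> W" "F Y = Y" by blast
  define S where "S x = x - Y x" for x
  have SA: "S \<in> \<AA>" unfolding S_def
    using star_algebra_minus[OF alg star_algebra_id[OF alg], of "blinfun_apply Y"] Y(1) by (simp add: W_def)
  moreover have "hadj S = S"
    by (rule hadj_eqI[OF bd[OF SA]])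
      (use Y(1) in \<open>simp add: S_def W_def cinner_diff_left cinner_diff_right\<close>)
  moreover have "S (S x) = x - X x" for x
  proof -
    have "Y x = (1/2) *\<^sub>R (X x + Y (Y x))"
      by (rule fun_cong[OF Fapp[of Y, unfolded Y(2) half o_apply]])
    then have "Y x + Y x = X x + Y (Y x)" by (metis field_sum_of_halves scaleR_add_right scaleR_left_distrib scaleR_one)
    then show ?thesis by (simp add: S_def blinfun.diff_right algebra_simps)
  qed
  ultimately show ?thesis using that by blast
qed

text \<open>Positivity of \<open>r^2 - hadj T T\<close> in algebraic form, as the square of a
  self-adjoint element of the same algebra. The strict inequality makes the norm of the rescaled
  \<open>hadj w \<circ> w\<close> smaller than 1, as the fixed-point construction requires.\<close>

lemma sqrt_norm_defect:
  assumes alg: "star_algebra \<AA>" and closed: "op_closure \<AA> \<subseteq> \<AA>"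
    and T: "T \<in> \<AA>" and r: "onorm T < r"
  obtains S where "S \<in> \<AA>" "hadj S = S"
    "\<And>x. S (S x) = complex_of_real (r\<^sup>2) *\<^sub>C x - hadj T (T x)"
proof -
  note bd = star_algebra_bounded[OF alg]
  have r0: "r > 0" using r bounded_clinear_onorm_nonneg[OF bd[OF T]] by linarith
  define w where "w = (\<lambda>x. complex_of_real (1 / r) *\<^sub>C T x)"
  have w: "w \<in> \<AA>" unfolding w_def by (rule star_algebra_cscale[OF alg T])
  note bw = bd[OF w]
  have "onorm w \<le> onorm T / r"
  proof (rule onorm_bound)
    show "norm (w x) \<le> onorm T / r * norm x" for x
      using bounded_clinear_norm[OF bd[OF T], of x] r0
      by (simp add: w_def norm_scaleC norm_divide divide_right_mono)
  qed (use bounded_clinear_onorm_nonneg[OF bd[OF T]] r0 in simp)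
  also have "\<dots> < 1" using r r0 by simp
  finally have n1: "onorm w < 1" .
  define X where "X = hadj w \<circ> w"
  have XA: "X \<in> \<AA>" unfolding X_def by (intro star_algebra_compose[OF alg] star_algebra_hadj[OF alg] w)
  have adjX: "hadj X = X" by (simp add: X_def hadj_compose bounded_clinear_hadj bw hadj_hadj)
  have "onorm X \<le> onorm (hadj w) * onorm w"
    unfolding X_def by (rule onorm_bounded_clinear_compose[OF bounded_clinear_hadj[OF bw] bw])
  also have "\<dots> \<le> onorm w * onorm w"
    by (intro mult_right_mono onorm_hadj_le bw bounded_clinear_onorm_nonneg)
  also have "\<dots> < 1"
    using n1 mult_left_mono[OF less_imp_le[OF n1] bounded_clinear_onorm_nonneg[OF bw]] by linarith
  finally have "onorm X < 1" .
  then obtain S where S: "S \<in> \<AA>" "hadj S = S" "\<And>x. S (S x) = x - X x"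
    by (rule sqrt_one_minus[OF alg closed XA adjX]) blast
  note bS = bd[OF S(1)]
  have X: "X x = complex_of_real (1 / r\<^sup>2) *\<^sub>C hadj T (T x)" for x
    by (simp add: X_def w_def hadj_cscale[OF bd[OF T]] scaleC_scaleC power2_eq_square
        bounded_clinear_scaleC[OF bounded_clinear_hadj[OF bd[OF T]]])
  show ?thesis
  proof (rule that[of "\<lambda>x. complex_of_real r *\<^sub>C S x"])
    show "(\<lambda>x. complex_of_real r *\<^sub>C S x) \<in> \<AA>" by (rule star_algebra_cscale[OF alg S(1)])
    show "hadj (\<lambda>x. complex_of_real r *\<^sub>C S x) = (\<lambda>x. complex_of_real r *\<^sub>C S x)"
      by (simp add: hadj_cscale[OF bS] S(2))
    show "complex_of_real r *\<^sub>C S (complex_of_real r *\<^sub>C S x)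
        = complex_of_real (r\<^sup>2) *\<^sub>C x - hadj T (T x)" for x
      using r0 by (simp add: bounded_clinear_scaleC[OF bS] S(3) X scaleC_scaleC scaleC_diff_right
          power2_eq_square)
  qed
qed

text \<open>Passes to the limit in estimates that the square roots give only for \<open>r\<close>
  strictly above the operator norm.\<close>

lemma le_mult_if_greater:
  fixes a u v :: real
  assumes v: "v \<ge> 0" and le: "\<And>r. r > a \<Longrightarrow> u \<le> r * v"
  shows "u \<le> a * v"
proof (rule field_le_epsilon)
  fix e :: real assume e: "e > 0"
  have "u \<le> (a + e / (v + 1)) * v" by (rule le) (use e v in \<open>simp add: add_nonneg_pos\<close>)
  also have "\<dots> = a * v + e * (v / (v + 1))" by (simp add: distrib_right)
  also have "e * (v / (v + 1)) \<le> e * 1"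
    using e v by (intro mult_left_mono) (simp_all add: divide_le_eq add_nonneg_pos)
  finally show "u \<le> a * v + e" by simp
qed


section \<open>Asymptotically abelian shifts of a factor\<close>

text \<open>The GNS situation in abstract form: \<open>L\<close> stands for the image of the local
  algebra, \<open>V\<close> for translation by one site and \<open>U\<close> for its inverse.
  \<open>L\<close> is not assumed norm-closed, which is what allows commutation with distant
  translates to be exact from some \<open>K\<close> on. \<open>center\<close> carries the factor
  property.\<close>

locale shift_system =
  fixes L :: "('h::complex_hilbert \<Rightarrow> 'h) set" and V U :: "'h \<Rightarrow> 'h" and \<xi> :: 'h
  assumes L_bounded: "T \<in> L \<Longrightarrow> bounded_clinear T"
    and L_hadj: "T \<in> L \<Longrightarrow> hadj T \<in> L"
    and V_bounded: "bounded_clinear V" and U_bounded: "bounded_clinear U"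
    and V_isometry: "norm (V x) = norm x"
    and VU: "V (U x) = x" and UV: "U (V x) = x"
    and V_\<xi>: "V \<xi> = \<xi>" and norm_\<xi>: "cinner \<xi> \<xi> = 1"
    and VTU: "T \<in> L \<Longrightarrow> V \<circ> T \<circ> U \<in> L" and UTV: "T \<in> L \<Longrightarrow> U \<circ> T \<circ> V \<in> L"
    and asymptotically_abelian:
      "\<lbrakk>S \<in> L; T \<in> L\<rbrakk> \<Longrightarrow> \<exists>K. \<forall>k\<ge>K. \<forall>x. S ((V ^^ k) (T ((U ^^ k) x))) = (V ^^ k) (T ((U ^^ k) (S x)))"
    and cyclic: "closure ((\<lambda>T. T \<xi>) ` L) = UNIV"
    and separating: "separating \<xi> (bicommutant L)"
    and center: "\<lbrakk>z \<in> bicommutant L; z \<in> commutant L\<rbrakk> \<Longrightarrow> \<exists>c. z = (\<lambda>x. c *\<^sub>C x)"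
begin

section \<open>Translates of operators and of their commutant\<close>

definition shift :: "nat \<Rightarrow> ('h \<Rightarrow> 'h) \<Rightarrow> 'h \<Rightarrow> 'h" where
  "shift k T x = (V ^^ k) (T ((U ^^ k) x))"

lemma V_pow_bounded: "bounded_clinear (V ^^ k)" and U_pow_bounded: "bounded_clinear (U ^^ k)"
  by (rule bounded_clinear_funpow V_bounded U_bounded)+

lemma U_isometry: "norm (U x) = norm x"
  using V_isometry[of "U x"] by (simp add: VU)

lemma U_pow_V_pow: "(U ^^ k) ((V ^^ k) x) = x"
  by (induction k arbitrary: x) (simp_all add: UV funpow_swap1)

lemma V_pow_U_pow: "(V ^^ k) ((U ^^ k) x) = x"
  by (induction k arbitrary: x) (simp_all add: VU funpow_swap1)

lemma V_pow_\<xi>: "(V ^^ k) \<xi> = \<xi>"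
  by (induction k) (simp_all add: V_\<xi>)

lemma U_pow_\<xi>: "(U ^^ k) \<xi> = \<xi>"
  by (metis U_pow_V_pow V_pow_\<xi>)

lemma norm_V_pow: "norm ((V ^^ k) x) = norm x" and norm_U_pow: "norm ((U ^^ k) x) = norm x"
  by (rule norm_funpow_isometry V_isometry U_isometry)+

lemma shift_bounded: "bounded_clinear T \<Longrightarrow> bounded_clinear (shift k T)"
proof -
  assume "bounded_clinear T"
  then have "bounded_clinear ((V ^^ k) \<circ> (T \<circ> (U ^^ k)))"
    by (intro bounded_clinear_compose V_pow_bounded U_pow_bounded)
  then show ?thesis by (simp add: shift_def[abs_def] o_def)
qed

lemma norm_shift_le: "bounded_clinear T \<Longrightarrow> norm (shift k T x) \<le> onorm T * norm x"
  using bounded_clinear_norm[of T "(U ^^ k) x"] by (simp add: shift_def norm_V_pow norm_U_pow)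

lemma shift_\<xi>: "shift k T \<xi> = (V ^^ k) (T \<xi>)"
  by (simp add: shift_def U_pow_\<xi>)

lemma shift_apply_V_pow: "shift k T ((V ^^ k) x) = (V ^^ k) (T x)"
  by (simp add: shift_def U_pow_V_pow)

lemma U_conj_pow_in_L: "T \<in> L \<Longrightarrow> (\<lambda>x. (U ^^ k) (T ((V ^^ k) x))) \<in> L"
proof (induction k)
  case (Suc k)
  then have "(\<lambda>x. U ((U ^^ k) (T ((V ^^ k) (V x))))) \<in> L"
    using UTV[of "\<lambda>x. (U ^^ k) (T ((V ^^ k) x))"] by (simp add: o_def)
  then show ?case by (simp add: funpow_swap1)
qed simp

lemma V_conj_pow_in_L: "T \<in> L \<Longrightarrow> (\<lambda>x. (V ^^ k) (T ((U ^^ k) x))) \<in> L"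
proof (induction k)
  case (Suc k)
  then have "(\<lambda>x. V ((V ^^ k) (T ((U ^^ k) (U x))))) \<in> L"
    using VTU[of "\<lambda>x. (V ^^ k) (T ((U ^^ k) x))"] by (simp add: o_def)
  then show ?case by (simp add: funpow_swap1)
qed simp

text \<open>\<open>L\<close> is invariant under conjugation by \<open>U\<close>, hence its commutant
  is invariant under conjugation by \<open>V\<close>.\<close>

lemma shift_commutant:
  assumes y: "y \<in> commutant L"
  shows "shift k y \<in> commutant L"
proof (rule commutantI)
  show "bounded_clinear (shift k y)" by (rule shift_bounded[OF commutant_bounded[OF y]])
  fix B x assume B: "B \<in> L"
  have "shift k y (B x) = (V ^^ k) (y ((U ^^ k) (B ((V ^^ k) ((U ^^ k) x)))))"
    by (simp add: shift_def V_pow_U_pow)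
  also have "\<dots> = (V ^^ k) ((U ^^ k) (B ((V ^^ k) (y ((U ^^ k) x)))))"
    using commutant_apply[OF y U_conj_pow_in_L[OF B, of k], of "(U ^^ k) x"] by simp
  also have "\<dots> = B (shift k y x)" by (simp add: shift_def V_pow_U_pow)
  finally show "shift k y (B x) = B (shift k y x)" .
qed

lemma commutant_dense: "closure ((\<lambda>y. y \<xi>) ` commutant L) = UNIV"
  by (rule separating_imp_commutant_dense[OF L_bounded L_hadj separating])

lemma L_bicommutant: "T \<in> L \<Longrightarrow> T \<in> bicommutant L"
  using subset_bicommutant[of L] L_bounded by blast

lemma cesaro_op_bounded:
  assumes "\<And>k. bounded_clinear (T k)"
  shows "bounded_clinear (\<lambda>x. cesaro (\<lambda>k. T k x) n)"
  unfolding cesaro_def by (intro bounded_clinear_rscale bounded_clinear_setsum assms)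

text \<open>The Cesaro means of \<open>shift k T\<close> converge strongly on \<open>L'\<xi>\<close> by the mean ergodic theorem; the
  limit is central, hence a scalar.\<close>

lemma cesaro_shift_\<xi>:
  assumes T: "T \<in> L"
  shows "cesaro (\<lambda>k. (V ^^ k) (T \<xi>)) \<longlonglongrightarrow> cinner \<xi> (T \<xi>) *\<^sub>C \<xi>"
proof -
  note bT = L_bounded[OF T]
  define A where "A n x = cesaro (\<lambda>k. shift k T x) n" for n x
  obtain f where f: "V f = f" "cesaro (\<lambda>k. (V ^^ k) (T \<xi>)) \<longlonglongrightarrow> f"
    by (rule mean_ergodic[OF V_bounded V_isometry])
  have A_bounded: "bounded_clinear (A n)" for n
    unfolding A_def[abs_def] by (intro cesaro_op_bounded shift_bounded bT)
  have A_norm: "norm (A n x) \<le> onorm T * norm x" for n x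
    unfolding A_def using bounded_clinear_onorm_nonneg[OF bT]
    by (intro cesaro_norm_le norm_shift_le bT) simp
  have shift_y: "shift k T (y x) = y (shift k T x)" if "y \<in> commutant L" for k x y
    unfolding shift_def
    using commutant_apply[OF that V_conj_pow_in_L[OF T, of k]] by simp
  have A_y: "A n (y x) = y (A n x)" if "y \<in> commutant L" for n y x
    unfolding A_def by (simp add: shift_y[OF that] cesaro_bounded_clinear[OF commutant_bounded[OF that]])
  have A_\<xi>: "(\<lambda>n. A n \<xi>) \<longlonglongrightarrow> f" using f(2) by (simp add: A_def shift_\<xi>)
  have conv: "convergent (\<lambda>n. A n x)" if "x \<in> (\<lambda>y. y \<xi>) ` commutant L" for x
  proof -
    obtain y where y: "y \<in> commutant L" "x = y \<xi>" using \<open>x \<in> _\<close> by blast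
    have "(\<lambda>n. y (A n \<xi>)) \<longlonglongrightarrow> y f"
      by (rule bounded_clinear_tendsto[OF commutant_bounded[OF y(1)] A_\<xi>])
    then show ?thesis unfolding y(2) A_y[OF y(1)] convergent_def by blast
  qed
  obtain B where B: "bounded_clinear B" "\<And>x. (\<lambda>n. A n x) \<longlonglongrightarrow> B x" "\<And>x. norm (B x) \<le> onorm T * norm x"
    by (rule strong_limit_exists[OF A_bounded A_norm commutant_dense conv]) (assumption | rule that)+
  have "B (y x) = y (B x)" if y: "y \<in> commutant L" for y x
  proof (rule LIMSEQ_unique[OF B(2)])
    show "(\<lambda>n. A n (y x)) \<longlonglongrightarrow> y (B x)" unfolding A_y[OF y]
      by (rule bounded_clinear_tendsto[OF commutant_bounded[OF y] B(2)])
  qed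
  then have B1: "B \<in> bicommutant L" unfolding bicommutant_def by (intro commutantI B(1))
  have "B (S x) = S (B x)" if S: "S \<in> L" for S x
  proof (rule LIMSEQ_unique[OF B(2)])
    obtain K where K: "\<And>k x. k \<ge> K \<Longrightarrow> S (shift k T x) = shift k T (S x)"
      using asymptotically_abelian[OF S T] unfolding shift_def by blast
    have "cesaro (\<lambda>k. S (shift k T x)) \<longlonglongrightarrow> S (B x)"
      using bounded_clinear_tendsto[OF L_bounded[OF S] B(2)[of x]]
      unfolding A_def by (simp add: cesaro_bounded_clinear[OF L_bounded[OF S]])
    then show "(\<lambda>n. A n (S x)) \<longlonglongrightarrow> S (B x)"
      unfolding A_def by (rule cesaro_eventually_cong[of K, rotated]) (simp add: K)
  qed
  then have "B \<in> commutant L" by (intro commutantI B(1))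
  from center[OF B1 this] obtain c where c: "B = (\<lambda>x. c *\<^sub>C x)" by blast
  have fc: "f = c *\<^sub>C \<xi>" using LIMSEQ_unique[OF A_\<xi> B(2)] by (simp add: c)
  \<comment> \<open>The scalar is read off from the expectation in \<open>\<xi>\<close>, which is
    the same for all translates because \<open>V\<close> is an isometry fixing
    \<open>\<xi>\<close>.\<close>
  have "(\<lambda>n. cinner \<xi> (A n \<xi>)) \<longlonglongrightarrow> cinner \<xi> f" by (intro tendsto_cinner tendsto_const A_\<xi>)
  moreover have "cinner \<xi> (A n \<xi>) = cesaro (\<lambda>_. cinner \<xi> (T \<xi>)) n" for n
  proof -
    have "cinner \<xi> ((V ^^ k) (T \<xi>)) = cinner \<xi> (T \<xi>)" for k
      using isometry_cinner[OF V_pow_bounded norm_V_pow, of k \<xi> "T \<xi>"] by (simp add: V_pow_\<xi>)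
    then have "(\<Sum>k<n. cinner \<xi> (shift k T \<xi>)) = (\<Sum>k<n. cinner \<xi> (T \<xi>))" by (simp add: shift_\<xi>)
    then show ?thesis
      unfolding A_def cesaro_def
      by (simp add: scaleR_scaleC cinner_scaleC_right cinner_sum_right scaleR_conv_of_real)
  qed
  ultimately have "cesaro (\<lambda>_. cinner \<xi> (T \<xi>)) \<longlonglongrightarrow> cinner \<xi> f" by simp
  from LIMSEQ_unique[OF this cesaro_const_tendsto] have "cinner \<xi> f = cinner \<xi> (T \<xi>)" .
  then have "c = cinner \<xi> (T \<xi>)" by (simp add: fc cinner_scaleC_right norm_\<xi>)
  then show ?thesis using f(2) fc by simp
qed

text \<open>Ergodicity: the projection onto the fixed vectors of \<open>V\<close> has rank one.
  Since the means are contractions, the limit extends from \<open>L\<close> applied to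
  \<open>\<xi>\<close> to all vectors.\<close>

lemma cesaro_V_pow: "cesaro (\<lambda>k. (V ^^ k) \<eta>) \<longlonglongrightarrow> cinner \<xi> \<eta> *\<^sub>C \<xi>"
proof (rule tendsto_of_dense[where K = 1, OF cesaro_op_bounded[OF V_pow_bounded] _ _ cyclic])
  have "norm \<xi> = 1" by (simp add: norm_eq_sqrt_cinner norm_\<xi>)
  then show "bounded_clinear (\<lambda>x. cinner \<xi> x *\<^sub>C \<xi>)"
    using Cauchy_Schwarz_cinner[of \<xi>]
    by (intro bounded_clinearI[of _ 1])
      (simp_all add: cinner_add_right cinner_scaleC_right scaleC_add_left scaleC_scaleC norm_scaleC)
  show "norm (cesaro (\<lambda>k. (V ^^ k) x) n) \<le> 1 * norm x" for n x
    by (intro cesaro_norm_le) (simp_all add: norm_V_pow)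
  show "cesaro (\<lambda>k. (V ^^ k) x) \<longlonglongrightarrow> cinner \<xi> x *\<^sub>C \<xi>" if "x \<in> (\<lambda>T. T \<xi>) ` L" for x
    using that cesaro_shift_\<xi> by auto
qed

text \<open>\<open>x\<close> and \<open>y\<close> are translated together, so their product is a
  single translated operator. On a vector \<open>b \<xi>\<close> with \<open>b\<close> in
  \<open>L\<close> both factors pass through \<open>b\<close>, \<open>shift k y\<close> always and
  \<open>shift k x\<close> for large \<open>k\<close>; there remains \<open>b\<close> applied to a
  translate of the vector \<open>x (y \<xi>)\<close>, which ergodicity averages.\<close>

lemma cesaro_shift_product:
  assumes x: "x \<in> L" and y: "y \<in> commutant L"
  shows "cesaro (\<lambda>k. shift k x (shift k y \<eta>)) \<longlonglongrightarrow> cinner \<xi> (x (y \<xi>)) *\<^sub>C \<eta>"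
proof -
  let ?c = "cinner \<xi> (x (y \<xi>))"
  define T where "T k \<eta> = shift k x (shift k y \<eta>)" for k \<eta>
  have T: "T k \<eta> = shift k (x \<circ> y) \<eta>" for k \<eta>
    by (simp add: T_def shift_def U_pow_V_pow)
  have bxy: "bounded_clinear (x \<circ> y)"
    by (intro bounded_clinear_compose L_bounded x commutant_bounded[OF y])
  have bT: "bounded_clinear (T k)" for k unfolding T by (intro shift_bounded bxy)
  have lim: "cesaro (\<lambda>k. T k \<zeta>) \<longlonglongrightarrow> ?c *\<^sub>C \<zeta>" if "\<zeta> \<in> (\<lambda>T. T \<xi>) ` L" for \<zeta>
  proof -
    obtain b where b: "b \<in> L" "\<zeta> = b \<xi>" using \<open>\<zeta> \<in> _\<close> by blast
    obtain K where K: "\<And>k x'. k \<ge> K \<Longrightarrow> b (shift k x x') = shift k x (b x')"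
      using asymptotically_abelian[OF b(1) x] unfolding shift_def by blast
    have "T k \<zeta> = b ((V ^^ k) (x (y \<xi>)))" if "k \<ge> K" for k
    proof -
      have "T k \<zeta> = shift k x (b (shift k y \<xi>))"
        by (simp add: T_def b(2) commutant_apply[OF shift_commutant[OF y] b(1)])
      also have "\<dots> = b (shift k x (shift k y \<xi>))" by (simp add: K[OF that])
      finally show ?thesis by (simp add: shift_\<xi> shift_apply_V_pow)
    qed
    moreover have "cesaro (\<lambda>k. b ((V ^^ k) (x (y \<xi>)))) \<longlonglongrightarrow> ?c *\<^sub>C \<zeta>"
      using bounded_clinear_tendsto[OF L_bounded[OF b(1)] cesaro_V_pow[of "x (y \<xi>)"]]
      by (simp add: cesaro_bounded_clinear[OF L_bounded[OF b(1)]] b(2)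
          bounded_clinear_scaleC[OF L_bounded[OF b(1)]])
    ultimately show ?thesis by (rule cesaro_eventually_cong)
  qed
  have "norm (cesaro (\<lambda>k. T k \<eta>) n) \<le> onorm (x \<circ> y) * norm \<eta>" for n \<eta>
    unfolding T using bounded_clinear_onorm_nonneg[OF bxy]
    by (intro cesaro_norm_le norm_shift_le bxy) simp
  from tendsto_of_dense[OF cesaro_op_bounded[OF bT] this bounded_clinear_scalar cyclic lim]
  have "cesaro (\<lambda>k. T k \<eta>) \<longlonglongrightarrow> ?c *\<^sub>C \<eta>" .
  then show ?thesis by (simp add: T_def)
qed

text \<open>Approximating \<open>y\<xi>\<close> by \<open>y'\<xi>\<close> with \<open>y' \<in> L'\<close>, which commutes with \<open>m\<close>, controls
  \<open>m (shift k y \<xi>)\<close> uniformly in \<open>k\<close>.\<close>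

lemma cesaro_shift_sandwich:
  assumes x: "x \<in> L" and y: "y \<in> L" and m: "m \<in> bicommutant L"
  shows "cesaro (\<lambda>k. shift k x (m (shift k y \<xi>))) \<longlonglongrightarrow> cinner \<xi> (x (y \<xi>)) *\<^sub>C m \<xi>"
proof (rule cesaro_approx)
  fix e :: real assume e: "e > 0"
  note bx = L_bounded[OF x]
  have bm: "bounded_clinear m" by (rule bicommutant_bounded[OF m])
  \<comment> \<open>\<open>C\<close> bounds the errors made in the sequence and in its limit when
    \<open>y \<xi>\<close> is replaced by \<open>y' \<xi>\<close>; the 1 keeps it positive.\<close>
  define C where "C = onorm x * onorm m + onorm x * norm (m \<xi>) * norm \<xi> + 1"
  have nn: "0 \<le> onorm x" "0 \<le> onorm m" by (intro bounded_clinear_onorm_nonneg bx bm)+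
  then have C: "C > 0" by (auto simp: C_def intro!: add_nonneg_pos add_nonneg_nonneg)
  define d where "d = e / C"
  have d: "d > 0" using e C by (simp add: d_def)
  have "y \<xi> \<in> closure ((\<lambda>y. y \<xi>) ` commutant L)" by (simp add: commutant_dense)
  then obtain y' where y': "y' \<in> commutant L" "dist (y' \<xi>) (y \<xi>) < d"
    using d unfolding closure_approachable by blast
  have small: "norm (y \<xi> - y' \<xi>) \<le> d" using y'(2) by (simp add: dist_norm norm_minus_commute)
  \<comment> \<open>The purpose of \<open>y'\<close>: its translates still commute with
    \<open>L\<close>, so \<open>m\<close> moves past them and acts on \<open>\<xi>\<close>
    directly.\<close>
  have eq: "shift k x (m (shift k y' \<xi>)) = shift k x (shift k y' (m \<xi>))" for k
    by (simp add: bicommutant_apply[OF m shift_commutant[OF y'(1)]])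
  have "norm (shift k x (m (shift k y \<xi>)) - shift k x (shift k y' (m \<xi>))) \<le> e" for k
  proof -
    have "shift k x (m (shift k y \<xi>)) - shift k x (shift k y' (m \<xi>))
        = shift k x (m ((V ^^ k) (y \<xi> - y' \<xi>)))"
      by (simp add: eq[symmetric] shift_\<xi> bounded_clinear_diff[OF V_pow_bounded]
          bounded_clinear_diff[OF bm] bounded_clinear_diff[OF shift_bounded[OF bx]])
    then have "norm (shift k x (m (shift k y \<xi>)) - shift k x (shift k y' (m \<xi>)))
        \<le> onorm x * norm (m ((V ^^ k) (y \<xi> - y' \<xi>)))"
      using norm_shift_le[OF bx] by simp
    also have "\<dots> \<le> onorm x * (onorm m * norm (y \<xi> - y' \<xi>))"
      using bounded_clinear_norm[OF bm, of "(V ^^ k) (y \<xi> - y' \<xi>)"] nn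
      by (intro mult_left_mono) (simp_all add: norm_V_pow)
    also have "\<dots> \<le> onorm x * (onorm m * d)" using small nn by (intro mult_left_mono) auto
    also have "\<dots> = (onorm x * onorm m) * d" by simp
    also have "\<dots> \<le> C * d" using d nn by (intro mult_right_mono) (auto simp: C_def)
    finally show ?thesis using C by (simp add: d_def)
  qed
  moreover have "norm (cinner \<xi> (x (y' \<xi>)) *\<^sub>C m \<xi> - cinner \<xi> (x (y \<xi>)) *\<^sub>C m \<xi>) \<le> e"
  proof -
    have "cinner \<xi> (x (y' \<xi>)) *\<^sub>C m \<xi> - cinner \<xi> (x (y \<xi>)) *\<^sub>C m \<xi>
        = cinner \<xi> (x (y' \<xi> - y \<xi>)) *\<^sub>C m \<xi>"
      using scaleC_add_left[of "cinner \<xi> (x (y' \<xi> - y \<xi>))" "cinner \<xi> (x (y \<xi>))" "m \<xi>"]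
      by (simp add: bounded_clinear_diff[OF bx] cinner_diff_right)
    then have "norm (cinner \<xi> (x (y' \<xi>)) *\<^sub>C m \<xi> - cinner \<xi> (x (y \<xi>)) *\<^sub>C m \<xi>)
        = cmod (cinner \<xi> (x (y' \<xi> - y \<xi>))) * norm (m \<xi>)" by (simp add: norm_scaleC)
    also have "\<dots> \<le> (norm \<xi> * (onorm x * d)) * norm (m \<xi>)"
    proof (intro mult_right_mono)
      have "norm (x (y' \<xi> - y \<xi>)) \<le> onorm x * norm (y' \<xi> - y \<xi>)" by (rule bounded_clinear_norm[OF bx])
      also have "\<dots> \<le> onorm x * d" using small nn by (intro mult_left_mono) (simp_all add: norm_minus_commute)
      finally have "norm \<xi> * norm (x (y' \<xi> - y \<xi>)) \<le> norm \<xi> * (onorm x * d)"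
        by (intro mult_left_mono) auto
      then show "cmod (cinner \<xi> (x (y' \<xi> - y \<xi>))) \<le> norm \<xi> * (onorm x * d)"
        using Cauchy_Schwarz_cinner[of \<xi> "x (y' \<xi> - y \<xi>)"] by linarith
    qed simp
    also have "\<dots> = (onorm x * norm (m \<xi>) * norm \<xi>) * d" by (simp add: mult_ac)
    also have "\<dots> \<le> C * d" using d nn by (intro mult_right_mono) (auto simp: C_def)
    finally show ?thesis using C by (simp add: d_def)
  qed
  moreover have "cesaro (\<lambda>k. shift k x (shift k y' (m \<xi>))) \<longlonglongrightarrow> cinner \<xi> (x (y' \<xi>)) *\<^sub>C m \<xi>"
    by (rule cesaro_shift_product[OF x y'(1)])
  ultimately show "\<exists>g l'. (\<forall>k. norm (shift k x (m (shift k y \<xi>)) - g k) \<le> e) \<and>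
      norm (l' - cinner \<xi> (x (y \<xi>)) *\<^sub>C m \<xi>) \<le> e \<and> cesaro g \<longlonglongrightarrow> l'"
    by (intro exI[of _ "\<lambda>k. shift k x (shift k y' (m \<xi>))"] exI[of _ "cinner \<xi> (x (y' \<xi>)) *\<^sub>C m \<xi>"]
        conjI allI)
qed

text \<open>In the application the sum of \<open>u i\<close> times a distant copy of
  \<open>v i\<close> is a swap. Multiplying the commutation relation by an equally distant copy of
  \<open>x\<close> and averaging turns each \<open>v i\<close> into a number, and commutation with a
  slice remains. The averages are computed only at \<open>\<xi>\<close>, which suffices because
  \<open>\<xi>\<close> separates the bicommutant.\<close>

theorem commutes_with_slice:
  assumes z: "z \<in> bicommutant L" and x: "x \<in> L" and I: "finite I"
    and u: "\<And>i. i \<in> I \<Longrightarrow> u i \<in> L" and v: "\<And>i. i \<in> I \<Longrightarrow> v i \<in> L"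
    and xv: "\<And>i. i \<in> I \<Longrightarrow> x \<circ> v i \<in> L" and id: "id \<in> L"
    and comm: "\<And>k \<eta>. k \<ge> K \<Longrightarrow>
      z (\<Sum>i\<in>I. u i (shift k (v i) \<eta>)) = (\<Sum>i\<in>I. u i (shift k (v i) (z \<eta>)))"
  shows "z (\<Sum>i\<in>I. cinner \<xi> (x (v i \<xi>)) *\<^sub>C u i \<eta>) = (\<Sum>i\<in>I. cinner \<xi> (x (v i \<xi>)) *\<^sub>C u i (z \<eta>))"
proof -
  have bz: "bounded_clinear z" by (rule bicommutant_bounded[OF z])
  let ?c = "\<lambda>i. cinner \<xi> (x (v i \<xi>))"
  have cesaro_sum: "cesaro (\<lambda>k. \<Sum>i\<in>I. f i k) \<longlonglongrightarrow> (\<Sum>i\<in>I. l i)"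
    if "\<And>i. i \<in> I \<Longrightarrow> cesaro (f i) \<longlonglongrightarrow> l i" for f :: "_ \<Rightarrow> nat \<Rightarrow> 'h" and l
  proof -
    have "cesaro (\<lambda>k. \<Sum>i\<in>I. f i k) n = (\<Sum>i\<in>I. cesaro (f i) n)" for n
      unfolding cesaro_def by (simp add: scaleR_sum_right[symmetric] sum.swap[of _ I])
    then have "cesaro (\<lambda>k. \<Sum>i\<in>I. f i k) = (\<lambda>n. \<Sum>i\<in>I. cesaro (f i) n)" by (rule ext)
    then show ?thesis using that by (simp add: tendsto_sum)
  qed
  \<comment> \<open>On this side \<open>z \<circ> u i\<close> stands between the copies of
    \<open>x\<close> and \<open>v i\<close>; it is the middle factor of the sandwich.\<close>
  have L1: "cesaro (\<lambda>k. \<Sum>i\<in>I. shift k x (z (u i (shift k (v i) \<xi>)))) \<longlonglongrightarrow> (\<Sum>i\<in>I. ?c i *\<^sub>C z (u i \<xi>))"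
  proof (rule cesaro_sum)
    fix i assume i: "i \<in> I"
    show "cesaro (\<lambda>k. shift k x (z (u i (shift k (v i) \<xi>)))) \<longlonglongrightarrow> ?c i *\<^sub>C z (u i \<xi>)"
      using cesaro_shift_sandwich[OF x v[OF i] bicommutant_compose[OF z L_bicommutant[OF u[OF i]]]] by simp
  qed
  obtain K1 where K1: "\<And>i k \<eta>. i \<in> I \<Longrightarrow> k \<ge> K1 \<Longrightarrow> u i (shift k x \<eta>) = shift k x (u i \<eta>)"
  proof -
    have "\<forall>i\<in>I. \<exists>K. \<forall>k\<ge>K. \<forall>\<eta>. u i (shift k x \<eta>) = shift k x (u i \<eta>)"
      using asymptotically_abelian[OF u x] unfolding shift_def by blast
    then obtain f where f: "\<And>i k \<eta>. i \<in> I \<Longrightarrow> k \<ge> f i \<Longrightarrow> u i (shift k x \<eta>) = shift k x (u i \<eta>)"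
      by metis
    show ?thesis
    proof (rule that[of "Max (insert 0 (f ` I))"])
      fix i k \<eta> assume i: "i \<in> I" and k: "Max (insert 0 (f ` I)) \<le> k"
      have "f i \<le> Max (insert 0 (f ` I))" using I i by (intro Max_ge) auto
      with k show "u i (shift k x \<eta>) = shift k x (u i \<eta>)" by (intro f[OF i]) simp
    qed
  qed
  \<comment> \<open>On this side the copy of \<open>x\<close> has passed \<open>u i\<close> and
    meets that of \<open>v i\<close>, so they form one translated operator. The product lemma then
    applies with the identity as the element of the commutant.\<close>
  have L2: "cesaro (\<lambda>k. \<Sum>i\<in>I. u i (shift k (x \<circ> v i) (z \<xi>))) \<longlonglongrightarrow> (\<Sum>i\<in>I. ?c i *\<^sub>C u i (z \<xi>))"
  proof (rule cesaro_sum)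
    fix i assume i: "i \<in> I"
    have "cesaro (\<lambda>k. shift k (x \<circ> v i) (shift k id (z \<xi>))) \<longlonglongrightarrow> ?c i *\<^sub>C z \<xi>"
      using cesaro_shift_product[OF xv[OF i] commutant_id, of "z \<xi>"] by simp
    then have "cesaro (\<lambda>k. shift k (x \<circ> v i) (z \<xi>)) \<longlonglongrightarrow> ?c i *\<^sub>C z \<xi>"
      by (simp add: shift_def V_pow_U_pow)
    from bounded_clinear_tendsto[OF L_bounded[OF u[OF i]] this]
    show "cesaro (\<lambda>k. u i (shift k (x \<circ> v i) (z \<xi>))) \<longlonglongrightarrow> ?c i *\<^sub>C u i (z \<xi>)"
      by (simp add: cesaro_bounded_clinear[OF L_bounded[OF u[OF i]]] bounded_clinear_scaleC[OF L_bounded[OF u[OF i]]])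
  qed
  have "(\<Sum>i\<in>I. shift k x (z (u i (shift k (v i) \<xi>)))) = (\<Sum>i\<in>I. u i (shift k (x \<circ> v i) (z \<xi>)))"
    if k: "k \<ge> max K K1" for k
  proof -
    note bs = shift_bounded[OF L_bounded[OF x], of k]
    have "(\<Sum>i\<in>I. shift k x (z (u i (shift k (v i) \<xi>)))) = shift k x (z (\<Sum>i\<in>I. u i (shift k (v i) \<xi>)))"
      by (simp add: bounded_clinear_sum[OF bs] bounded_clinear_sum[OF bz])
    also have "\<dots> = (\<Sum>i\<in>I. shift k x (u i (shift k (v i) (z \<xi>))))"
      using k by (simp add: comm bounded_clinear_sum[OF bs])
    also have "\<dots> = (\<Sum>i\<in>I. u i (shift k (x \<circ> v i) (z \<xi>)))"
    proof (rule sum.cong[OF refl])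
      fix i assume i: "i \<in> I"
      have "shift k x (u i (shift k (v i) (z \<xi>))) = u i (shift k x (shift k (v i) (z \<xi>)))"
        using K1[OF i, of k] k by simp
      then show "shift k x (u i (shift k (v i) (z \<xi>))) = u i (shift k (x \<circ> v i) (z \<xi>))"
        by (simp add: shift_def U_pow_V_pow)
    qed
    finally show ?thesis .
  qed
  from LIMSEQ_unique[OF L1 cesaro_eventually_cong[OF this L2]]
  have at_\<xi>: "(\<Sum>i\<in>I. ?c i *\<^sub>C z (u i \<xi>)) = (\<Sum>i\<in>I. ?c i *\<^sub>C u i (z \<xi>))" .
  define w where "w \<eta> = (\<Sum>i\<in>I. ?c i *\<^sub>C u i \<eta>)" for \<eta>
  have bw: "bounded_clinear w" unfolding w_def[abs_def]
    by (intro bounded_clinear_setsum bounded_clinear_cscale L_bounded u)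
  have "w \<in> bicommutant L" unfolding bicommutant_def
  proof (rule commutantI[OF bw])
    fix y \<eta> assume y: "y \<in> commutant L"
    have "w (y \<eta>) = (\<Sum>i\<in>I. ?c i *\<^sub>C y (u i \<eta>))"
      unfolding w_def by (intro sum.cong refl) (simp add: commutant_apply[OF y u])
    then show "w (y \<eta>) = y (w \<eta>)"
      by (simp add: w_def bounded_clinear_sum[OF commutant_bounded[OF y]]
          bounded_clinear_scaleC[OF commutant_bounded[OF y]])
  qed
  then have "(\<lambda>\<eta>. (z \<circ> w) \<eta> - (w \<circ> z) \<eta>) \<in> bicommutant L"
    using z by (intro bicommutant_minus bicommutant_compose)
  moreover have "(z \<circ> w) \<xi> - (w \<circ> z) \<xi> = 0"
    using at_\<xi> by (simp add: w_def bounded_clinear_sum[OF bz] bounded_clinear_scaleC[OF bz])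
  ultimately have "(\<lambda>\<eta>. (z \<circ> w) \<eta> - (w \<circ> z) \<eta>) = (\<lambda>_. 0)"
    by (rule separatingD[OF separating])
  then have "z (w \<eta>) = w (z \<eta>)" for \<eta> by (simp add: fun_eq_iff)
  then show ?thesis by (simp add: w_def)
qed

end


section \<open>Local operators on the chain\<close>

definition matrix_unit :: "'d \<Rightarrow> 'd \<Rightarrow> 'd::finite cmat" where
  "matrix_unit s t = (\<chi> i j. if i = s \<and> j = t then 1 else 0)"

lemma matrix_unit_mult_right: "(A ** matrix_unit b a) $ s $ t = (if t = a then A $ s $ b else 0)"
proof -
  have "(A ** matrix_unit b a) $ s $ t = (\<Sum>k\<in>UNIV. if k = b then (if t = a then A $ s $ k else 0) else 0)"
    unfolding matrix_matrix_mult_def vec_lambda_beta by (rule sum.cong) (auto simp: matrix_unit_def)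
  then show ?thesis by simp
qed

lemma matrix_unit_mult_left: "(matrix_unit b a ** A) $ s $ t = (if s = b then A $ a $ t else 0)"
proof -
  have "(matrix_unit b a ** A) $ s $ t = (\<Sum>k\<in>UNIV. if k = a then (if s = b then A $ k $ t else 0) else 0)"
    unfolding matrix_matrix_mult_def vec_lambda_beta by (rule sum.cong) (auto simp: matrix_unit_def)
  then show ?thesis by simp
qed

lemma ell2_fun_sum: "ell2_fun (\<Sum>i\<in>I. f i) a = (\<Sum>i\<in>I. ell2_fun (f i) a)"
  by (induction I rule: infinite_finite_induct) simp_all

lemma site_op_matrix_unit:
  "ell2_fun (site_op i (matrix_unit s t) \<psi>) \<sigma> = (if \<sigma> i = s then ell2_fun \<psi> (\<sigma>(i := t)) else 0)"
proof -
  have "ell2_fun (site_op i (matrix_unit s t) \<psi>) \<sigma>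
      = (\<Sum>r\<in>UNIV. if r = t then (if \<sigma> i = s then ell2_fun \<psi> (\<sigma>(i := r)) else 0) else 0)"
    unfolding ell2_fun_site_op by (rule sum.cong) (auto simp: matrix_unit_def)
  then show ?thesis by simp
qed

lemma site_op_sum_matrix_units:
  "site_op i A \<psi> = (\<Sum>s\<in>UNIV. \<Sum>t\<in>UNIV. A $ s $ t *\<^sub>C site_op i (matrix_unit s t) \<psi>)"
proof (rule ell2_eqI)
  fix \<sigma>
  have "ell2_fun (\<Sum>s\<in>UNIV. \<Sum>t\<in>UNIV. A $ s $ t *\<^sub>C site_op i (matrix_unit s t) \<psi>) \<sigma>
      = (\<Sum>s\<in>UNIV. if \<sigma> i = s then (\<Sum>t\<in>UNIV. A $ s $ t * ell2_fun \<psi> (\<sigma>(i := t))) else 0)"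
    unfolding ell2_fun_sum ell2_fun_scaleC site_op_matrix_unit by (rule sum.cong) auto
  then show "ell2_fun (site_op i A \<psi>) \<sigma>
      = ell2_fun (\<Sum>s\<in>UNIV. \<Sum>t\<in>UNIV. A $ s $ t *\<^sub>C site_op i (matrix_unit s t) \<psi>) \<sigma>"
    by (simp add: ell2_fun_site_op)
qed

text \<open>The operator is a partial isometry: it reads \<open>\<psi>\<close> at configurations
  with \<open>t\<close> at site \<open>i\<close>, each at most once, because
  \<open>\<sigma>(i := t)\<close> determines \<open>\<sigma>\<close> among the configurations with
  \<open>s\<close> there.\<close>

lemma norm_site_op_matrix_unit: "norm (site_op i (matrix_unit s t) \<psi>) \<le> norm \<psi>"
proof (rule norm_ell2_le)
  fix F :: "(int \<Rightarrow> 'a) set" assume F: "finite F"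
  define H where "H = {\<sigma>\<in>F. \<sigma> i = s}"
  have inj: "inj_on (\<lambda>\<sigma>. \<sigma>(i := t)) H"
    by (rule inj_onI) (metis (mono_tags, lifting) H_def fun_upd_triv fun_upd_upd mem_Collect_eq)
  have "(\<Sum>\<sigma>\<in>F. (cmod (ell2_fun (site_op i (matrix_unit s t) \<psi>) \<sigma>))\<^sup>2)
      = (\<Sum>\<sigma>\<in>H. (cmod (ell2_fun \<psi> (\<sigma>(i := t))))\<^sup>2)"
    unfolding H_def by (rule sum.mono_neutral_cong_right) (use F in \<open>auto simp: site_op_matrix_unit\<close>)
  also have "\<dots> = (\<Sum>\<sigma>\<in>(\<lambda>\<sigma>. \<sigma>(i := t)) ` H. (cmod (ell2_fun \<psi> \<sigma>))\<^sup>2)"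
    by (simp add: sum.reindex[OF inj])
  finally have "L2_set (\<lambda>\<sigma>. cmod (ell2_fun (site_op i (matrix_unit s t) \<psi>) \<sigma>)) F
      = L2_set (\<lambda>\<sigma>. cmod (ell2_fun \<psi> \<sigma>)) ((\<lambda>\<sigma>. \<sigma>(i := t)) ` H)" by (simp add: L2_set_def)
  also have "\<dots> \<le> norm \<psi>" by (rule L2_set_le_norm_ell2) (use F in \<open>simp add: H_def\<close>)
  finally show "L2_set (\<lambda>\<sigma>. cmod (ell2_fun (site_op i (matrix_unit s t) \<psi>) \<sigma>)) F \<le> norm \<psi>" .
qed

lemma bounded_clinear_site_op: "bounded_clinear (site_op i A)"
proof -
  have "bounded_clinear (site_op i (matrix_unit s t))" for s t :: 'a
  proof (rule bounded_clinearI[of _ 1])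
    show "site_op i (matrix_unit s t) (x + y) = site_op i (matrix_unit s t) x + site_op i (matrix_unit s t) y" for x y
      by (rule ell2_eqI) (simp add: site_op_matrix_unit)
    show "site_op i (matrix_unit s t) (c *\<^sub>C x) = c *\<^sub>C site_op i (matrix_unit s t) x" for c x
      by (rule ell2_eqI) (simp add: site_op_matrix_unit)
  qed (simp add: norm_site_op_matrix_unit)
  then have "bounded_clinear (\<lambda>\<psi>. \<Sum>s\<in>UNIV. \<Sum>t\<in>UNIV. A $ s $ t *\<^sub>C site_op i (matrix_unit s t) \<psi>)"
    by (intro bounded_clinear_setsum bounded_clinear_cscale)
  then show ?thesis by (simp flip: site_op_sum_matrix_units)
qed

text \<open>Changing the value at site \<open>i\<close> is a bijection between configurations with
  \<open>t\<close> there and those with \<open>s\<close> there; reindexing the inner product along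
  it exchanges the two matrix units.\<close>

lemma cinner_site_op_matrix_unit:
  "cinner (site_op i (matrix_unit s t) \<psi>) \<zeta> = cinner \<psi> (site_op i (matrix_unit t s) \<zeta>)"
proof -
  define f where "f \<sigma> = cnj (ell2_fun \<psi> (\<sigma>(i := t))) * ell2_fun \<zeta> \<sigma>" for \<sigma>
  have bij: "bij_betw (\<lambda>\<sigma>. \<sigma>(i := s)) {\<sigma>. \<sigma> i = t} {\<sigma>. \<sigma> i = s}"
    by (rule bij_betw_byWitness[where f' = "\<lambda>\<sigma>. \<sigma>(i := t)"]) auto
  have "cinner (site_op i (matrix_unit s t) \<psi>) \<zeta> = infsum f {\<sigma>. \<sigma> i = s}"
    unfolding cinner_ell2_def
    by (rule infsum_cong_neutral) (auto simp: site_op_matrix_unit f_def)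
  also have "\<dots> = infsum (\<lambda>\<sigma>. f (\<sigma>(i := s))) {\<sigma>. \<sigma> i = t}"
    by (rule infsum_reindex_bij_betw[OF bij, symmetric])
  also have "\<dots> = cinner \<psi> (site_op i (matrix_unit t s) \<zeta>)"
    unfolding cinner_ell2_def
    by (rule infsum_cong_neutral) (auto simp: site_op_matrix_unit f_def)
  finally show ?thesis .
qed

lemma hadj_site_op: "hadj (site_op i A) = site_op i (cadj A)"
proof (rule hadj_eqI[OF bounded_clinear_site_op])
  fix \<psi> \<zeta> :: "'a chain"
  have left: "cinner (\<Sum>x\<in>I. f x) \<zeta> = (\<Sum>x\<in>I. cinner (f x) \<zeta>)" for f :: "'b \<Rightarrow> 'a chain" and I
    by (induction I rule: infinite_finite_induct) (simp_all add: cinner_add_left)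
  have "cinner (site_op i A \<psi>) \<zeta>
      = (\<Sum>s\<in>UNIV. \<Sum>t\<in>UNIV. cnj (A $ s $ t) * cinner (site_op i (matrix_unit s t) \<psi>) \<zeta>)"
    unfolding site_op_sum_matrix_units[of i A \<psi>] left
    by (intro sum.cong refl) (simp add: cinner_scaleC_left left)
  also have "\<dots> = (\<Sum>t\<in>UNIV. \<Sum>s\<in>UNIV. cnj (A $ s $ t) * cinner \<psi> (site_op i (matrix_unit t s) \<zeta>))"
    unfolding cinner_site_op_matrix_unit by (rule sum.swap)
  also have "\<dots> = cinner \<psi> (site_op i (cadj A) \<zeta>)"
    unfolding site_op_sum_matrix_units[of i "cadj A"]
    by (simp add: cinner_sum_right cinner_scaleC_right cadj_def)
  finally show "cinner (site_op i A \<psi>) \<zeta> = cinner \<psi> (site_op i (cadj A) \<zeta>)" .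
qed

lemma cadj_cadj [simp]: "cadj (cadj A) = A"
  by (simp add: cadj_def vec_eq_iff)


subsection \<open>Translations\<close>

text \<open>The sign makes conjugation carry site \<open>i\<close> to \<open>i + k\<close>. This
  operator acts on the defining space of the chain algebra; its counterpart on the GNS space has to
  be obtained from invariance of the state.\<close>

definition translate :: "int \<Rightarrow> 'd::finite chain \<Rightarrow> 'd chain" where
  "translate k \<psi> = Abs_ell2 (\<lambda>\<sigma>. ell2_fun \<psi> (\<lambda>i. \<sigma> (i + k)))"

lemma bij_translate_config: "bij (\<lambda>(\<sigma> :: int \<Rightarrow> 'd) i. \<sigma> (i + k))"
  by (rule bij_betw_byWitness[where f' = "\<lambda>\<sigma> i. \<sigma> (i - k)"]) auto

lemma ell2_fun_translate [simp]: "ell2_fun (translate k \<psi>) \<sigma> = ell2_fun \<psi> (\<lambda>i. \<sigma> (i + k))"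
proof -
  have "square_summable (\<lambda>\<sigma>. ell2_fun \<psi> (\<lambda>i. \<sigma> (i + k)))"
    using summable_on_reindex_bij_betw[OF bij_translate_config[of k], of "\<lambda>\<sigma>. (cmod (ell2_fun \<psi> \<sigma>))\<^sup>2"]
      ell2_fun_square_summable[of \<psi>] by (simp add: square_summable_def)
  then show ?thesis by (simp add: translate_def Abs_ell2_inverse)
qed

lemma translate_translate: "translate j (translate k \<psi>) = translate (j + k) \<psi>"
  by (rule ell2_eqI) (simp add: add_ac)

lemma translate_0: "translate 0 \<psi> = \<psi>"
  by (rule ell2_eqI) simp

lemma cinner_translate: "cinner (translate k \<psi>) \<zeta> = cinner \<psi> (translate (- k) \<zeta>)"
  using infsum_reindex_bij_betw[OF bij_translate_config[of k],
      of "\<lambda>\<sigma>. cnj (ell2_fun \<psi> \<sigma>) * ell2_fun \<zeta> (\<lambda>i. \<sigma> (i - k))"]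
  by (simp add: cinner_ell2_def)

lemma norm_translate: "norm (translate k \<psi>) = norm \<psi>"
  by (rule cinner_eq_norm) (simp add: cinner_translate translate_translate translate_0)

lemma bounded_clinear_translate: "bounded_clinear (translate k)"
proof (rule bounded_clinearI[of _ 1])
  show "translate k (x + y) = translate k x + translate k y" for x y :: "'a chain"
    by (rule ell2_eqI) simp
  show "translate k (c *\<^sub>C x) = c *\<^sub>C translate k x" for c and x :: "'a chain"
    by (rule ell2_eqI) simp
qed (simp add: norm_translate)

lemma hadj_translate: "hadj (translate k) = translate (- k)"
  by (rule hadj_eqI[OF bounded_clinear_translate cinner_translate])

definition translate_op :: "int \<Rightarrow> ('d::finite chain \<Rightarrow> 'd chain) \<Rightarrow> 'd chain \<Rightarrow> 'd chain" where
  "translate_op k T = translate k \<circ> T \<circ> translate (- k)"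

lemma translate_op_compose: "translate_op k (S \<circ> T) = translate_op k S \<circ> translate_op k T"
  by (simp add: translate_op_def fun_eq_iff translate_translate translate_0)

lemma translate_op_plus:
  "translate_op k (\<lambda>\<psi>. S \<psi> + T \<psi>) = (\<lambda>\<psi>. translate_op k S \<psi> + translate_op k T \<psi>)"
  by (simp add: translate_op_def fun_eq_iff bounded_clinear_add[OF bounded_clinear_translate])

lemma translate_op_cscale:
  "translate_op k (\<lambda>\<psi>. c *\<^sub>C T \<psi>) = (\<lambda>\<psi>. c *\<^sub>C translate_op k T \<psi>)"
  by (simp add: translate_op_def fun_eq_iff bounded_clinear_scaleC[OF bounded_clinear_translate])

lemma translate_op_translate_op: "translate_op j (translate_op k T) = translate_op (j + k) T"
  by (simp add: translate_op_def fun_eq_iff translate_translate add.commute)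

lemma translate_op_0: "translate_op 0 T = T"
  by (simp add: translate_op_def fun_eq_iff translate_0)

lemma translate_op_id: "translate_op k id = id"
  by (simp add: translate_op_def fun_eq_iff translate_translate translate_0)

lemma hadj_translate_op:
  "bounded_clinear T \<Longrightarrow> hadj (translate_op k T) = translate_op k (hadj T)"
  by (simp add: translate_op_def hadj_compose bounded_clinear_compose bounded_clinear_translate
      hadj_translate o_assoc)

lemma translate_op_site_op: "translate_op k (site_op i A) = site_op (i + k) A"
proof (rule ext, rule ell2_eqI)
  fix \<psi> :: "'a chain" and \<sigma> :: "int \<Rightarrow> 'a"
  have "(\<lambda>j. ((\<lambda>j. \<sigma> (j + k))(i := s)) (j - k)) = \<sigma>(i + k := s)" for s
    by (auto simp: fun_eq_iff)
  then show "ell2_fun (translate_op k (site_op i A) \<psi>) \<sigma> = ell2_fun (site_op (i + k) A \<psi>) \<sigma>"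
    by (simp add: translate_op_def ell2_fun_site_op)
qed

lemma translate_op_tensor_at: "translate_op k (tensor_at a As) = tensor_at (a + k) As"
  by (induction As arbitrary: a)
    (simp_all add: translate_op_id[unfolded id_def] translate_op_compose translate_op_site_op id_def add_ac)


subsection \<open>The local algebras\<close>

lemma bounded_clinear_tensor_at: "bounded_clinear (tensor_at a As)"
  by (induction As arbitrary: a)
    (simp_all only: tensor_at.simps bounded_clinear_id bounded_clinear_compose bounded_clinear_site_op)

lemma site_op_commute_tensor_at:
  "i < a \<Longrightarrow> site_op i A \<circ> tensor_at a As = tensor_at a As \<circ> site_op i A"
proof (induction As arbitrary: a)
  case (Cons B As)
  have "site_op i A \<circ> tensor_at a (B # As) = site_op a B \<circ> (site_op i A \<circ> tensor_at (a + 1) As)"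
    using site_op_commute[of i a A B] Cons.prems by (simp add: o_assoc)
  also have "\<dots> = site_op a B \<circ> (tensor_at (a + 1) As \<circ> site_op i A)"
    by (subst Cons.IH) (use Cons.prems in simp_all)
  finally show ?case by (simp only: tensor_at.simps o_assoc)
qed simp

lemma tensor_at_commute:
  "a + int (length As) \<le> b \<Longrightarrow> tensor_at a As \<circ> tensor_at b Bs = tensor_at b Bs \<circ> tensor_at a As"
proof (induction As arbitrary: a)
  case (Cons A As)
  have "tensor_at a (A # As) \<circ> tensor_at b Bs = site_op a A \<circ> (tensor_at (a + 1) As \<circ> tensor_at b Bs)"
    by (simp only: tensor_at.simps o_assoc)
  also have "\<dots> = (site_op a A \<circ> tensor_at b Bs) \<circ> tensor_at (a + 1) As"
    by (subst Cons.IH) (use Cons.prems in simp, simp only: tensor_at.simps o_assoc)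
  also have "\<dots> = tensor_at b Bs \<circ> tensor_at a (A # As)"
    by (subst site_op_commute_tensor_at) (use Cons.prems in simp, simp only: tensor_at.simps o_assoc)
  finally show ?case .
qed simp

lemma tensor_at_mult:
  "length As = length Bs \<Longrightarrow> tensor_at a As \<circ> tensor_at a Bs = tensor_at a (map2 (**) As Bs)"
proof (induction As Bs arbitrary: a rule: list_induct2)
  case (Cons A As B Bs)
  have "tensor_at a (A # As) \<circ> tensor_at a (B # Bs)
      = site_op a A \<circ> (tensor_at (a + 1) As \<circ> site_op a B) \<circ> tensor_at (a + 1) Bs"
    by (simp only: tensor_at.simps o_assoc)
  also have "\<dots> = site_op a A \<circ> (site_op a B \<circ> tensor_at (a + 1) As) \<circ> tensor_at (a + 1) Bs"
    by (subst site_op_commute_tensor_at) simp_all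
  also have "\<dots> = (site_op a A \<circ> site_op a B) \<circ> (tensor_at (a + 1) As \<circ> tensor_at (a + 1) Bs)"
    by (simp only: tensor_at.simps o_assoc)
  finally show ?case
    by (simp only: site_op_mult Cons.IH zip_Cons_Cons list.map prod.case tensor_at.simps)
qed simp

lemma hadj_tensor_at: "hadj (tensor_at a As) = tensor_at a (map cadj As)"
proof (induction As arbitrary: a)
  case Nil
  then show ?case by (simp only: tensor_at.simps list.map hadj_id)
next
  case (Cons A As)
  have "hadj (tensor_at a (A # As)) = tensor_at (a + 1) (map cadj As) \<circ> site_op a (cadj A)"
    unfolding tensor_at.simps
    by (simp only: hadj_compose[OF bounded_clinear_site_op bounded_clinear_tensor_at] hadj_site_op Cons.IH)
  also have "\<dots> = site_op a (cadj A) \<circ> tensor_at (a + 1) (map cadj As)"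
    by (rule site_op_commute_tensor_at[symmetric]) simp
  finally show ?case by (simp only: tensor_at.simps list.map)
qed

lemma tensor_at_append: "tensor_at a (As @ Bs) = tensor_at a As \<circ> tensor_at (a + int (length As)) Bs"
  by (induction As arbitrary: a) (simp_all add: fun_eq_iff add_ac)

lemma tensor_at_replicate_1: "tensor_at a (replicate n (mat 1)) = id"
  by (induction n arbitrary: a) (simp_all add: site_op_1)

lemma local_alg_zero: "(\<lambda>_. 0) \<in> local_alg a b"
  unfolding local_alg_def by (intro CollectI exI[of _ 0]) simp

lemma local_alg_add_tensor:
  assumes T: "T \<in> local_alg a b" and As: "length As = nat (b - a + 1)"
  shows "(\<lambda>\<psi>. T \<psi> + c *\<^sub>C tensor_at a As \<psi>) \<in> local_alg a b"
proof -
  obtain N :: nat and d Bs where *: "\<And>k. k < N \<Longrightarrow> length (Bs k) = nat (b - a + 1)"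
    "T = (\<lambda>\<psi>. \<Sum>k<N. d k *\<^sub>C tensor_at a (Bs k) \<psi>)"
    using T unfolding local_alg_def by blast
  show ?thesis unfolding local_alg_def
    by (intro CollectI exI[of _ "Suc N"] exI[of _ "d(N := c)"] exI[of _ "Bs(N := As)"])
      (auto simp: * As less_Suc_eq)
qed

text \<open>Induction on the number of elementary tensors, so that linear statements have to be
  checked only on \<open>tensor_at\<close>.\<close>

lemma local_alg_induct [consumes 1, case_names zero add]:
  assumes T: "T \<in> local_alg a b" and zero: "P (\<lambda>_. 0)"
    and add: "\<And>T c As. \<lbrakk>T \<in> local_alg a b; P T; length As = nat (b - a + 1)\<rbrakk> \<Longrightarrow>
      P (\<lambda>\<psi>. T \<psi> + c *\<^sub>C tensor_at a As \<psi>)"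
  shows "P T"
proof -
  obtain N :: nat and c As where len: "\<And>k. k < N \<Longrightarrow> length (As k) = nat (b - a + 1)"
    and T_eq: "T = (\<lambda>\<psi>. \<Sum>k<N. c k *\<^sub>C tensor_at a (As k) \<psi>)"
    using T unfolding local_alg_def by blast
  have "n \<le> N \<Longrightarrow> (\<lambda>\<psi>. \<Sum>k<n. c k *\<^sub>C tensor_at a (As k) \<psi>) \<in> local_alg a b \<and>
      P (\<lambda>\<psi>. \<Sum>k<n. c k *\<^sub>C tensor_at a (As k) \<psi>)" for n
  proof (induction n)
    case 0
    then show ?case by (simp add: local_alg_zero zero)
  next
    case (Suc n)
    then show ?case
      using add[of "\<lambda>\<psi>. \<Sum>k<n. c k *\<^sub>C tensor_at a (As k) \<psi>" "As n" "c n"]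
        local_alg_add_tensor[of "\<lambda>\<psi>. \<Sum>k<n. c k *\<^sub>C tensor_at a (As k) \<psi>" a b "As n" "c n"] len[of n]
      by simp
  qed
  then show ?thesis by (simp add: T_eq)
qed

lemma tensor_at_in_local_alg: "length As = nat (b - a + 1) \<Longrightarrow> tensor_at a As \<in> local_alg a b"
  using local_alg_add_tensor[OF local_alg_zero, of As b a 1] by simp

lemma local_alg_plus:
  assumes "S \<in> local_alg a b" "T \<in> local_alg a b"
  shows "(\<lambda>\<psi>. S \<psi> + T \<psi>) \<in> local_alg a b"
  using assms(2)
proof (induction rule: local_alg_induct)
  case (add T c As)
  from local_alg_add_tensor[OF add(3,2), of c] show ?case by (simp add: add.assoc)
qed (simp add: assms)

lemma local_alg_cscale:
  assumes "T \<in> local_alg a b" shows "(\<lambda>\<psi>. c *\<^sub>C T \<psi>) \<in> local_alg a b"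
  using assms
proof (induction rule: local_alg_induct)
  case (add T d As)
  from local_alg_add_tensor[OF add(3,2), of "c * d"] show ?case
    by (simp add: scaleC_add_right scaleC_scaleC)
qed (simp add: local_alg_zero)

lemma local_alg_bounded: "T \<in> local_alg a b \<Longrightarrow> bounded_clinear T"
  by (induction rule: local_alg_induct)
    (simp_all add: bounded_clinear_zero_map bounded_clinear_plus bounded_clinear_cscale
      bounded_clinear_tensor_at)

lemma local_alg_compose:
  assumes S: "S \<in> local_alg a b" and T: "T \<in> local_alg a b"
  shows "S \<circ> T \<in> local_alg a b"
proof -
  have tensor: "tensor_at a Bs \<circ> T \<in> local_alg a b" if Bs: "length Bs = nat (b - a + 1)" for Bs
    using T
  proof (induction rule: local_alg_induct)
    case zero
    then show ?case by (simp add: o_def bounded_clinear_zero[OF bounded_clinear_tensor_at] local_alg_zero)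
  next
    case (add T c As)
    have "tensor_at a Bs \<circ> (\<lambda>\<psi>. T \<psi> + c *\<^sub>C tensor_at a As \<psi>)
        = (\<lambda>\<psi>. (tensor_at a Bs \<circ> T) \<psi> + c *\<^sub>C tensor_at a (map2 (**) Bs As) \<psi>)"
      using tensor_at_mult[of Bs As a] Bs add(2)
      by (simp add: fun_eq_iff bounded_clinear_add[OF bounded_clinear_tensor_at]
          bounded_clinear_scaleC[OF bounded_clinear_tensor_at])
    then show ?case using local_alg_add_tensor[OF add(3), of "map2 (**) Bs As" c] Bs add(2) by simp
  qed
  show ?thesis using S
  proof (induction rule: local_alg_induct)
    case (add S c As)
    from local_alg_plus[OF add(3) local_alg_cscale[OF tensor[OF add(2)], of c]]
    show ?case by (simp add: o_def)
  qed (simp add: o_def local_alg_zero)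
qed

lemma local_alg_hadj:
  assumes "T \<in> local_alg a b" shows "hadj T \<in> local_alg a b"
  using assms
proof (induction rule: local_alg_induct)
  case zero
  have "hadj (\<lambda>_ :: 'a chain. 0) = (\<lambda>_. 0)" by (rule hadj_eqI[OF bounded_clinear_zero_map]) simp
  then show ?case by (simp add: local_alg_zero)
next
  case (add T c As)
  have "hadj (\<lambda>\<psi>. T \<psi> + c *\<^sub>C tensor_at a As \<psi>)
      = (\<lambda>\<psi>. hadj T \<psi> + cnj c *\<^sub>C tensor_at a (map cadj As) \<psi>)"
    by (simp add: hadj_plus[OF local_alg_bounded[OF add(1)] bounded_clinear_cscale[OF bounded_clinear_tensor_at]]
        hadj_cscale[OF bounded_clinear_tensor_at] hadj_tensor_at)
  then show ?case using local_alg_add_tensor[OF add(3), of "map cadj As"] add(2) by simp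
qed

lemma star_algebra_local_alg: "star_algebra (local_alg a b)"
  unfolding star_algebra_def
proof (intro conjI ballI allI)
  show "id \<in> local_alg a b"
    using tensor_at_in_local_alg[of "replicate (nat (b - a + 1)) (mat 1)" b a]
    by (simp add: tensor_at_replicate_1 id_def)
qed (auto intro: local_alg_bounded local_alg_plus local_alg_cscale local_alg_compose local_alg_hadj)

lemma site_op_in_local_alg:
  assumes "a \<le> i" "i \<le> b" shows "site_op i A \<in> local_alg a b"
proof -
  let ?l = "replicate (nat (i - a)) (mat 1) @ [A] @ replicate (nat (b - i)) (mat 1)"
  have "tensor_at a ?l \<in> local_alg a b" by (rule tensor_at_in_local_alg) (use assms in simp)
  moreover have "tensor_at a ?l = site_op i A"
    using assms by (simp only: tensor_at_append tensor_at_replicate_1 tensor_at.simps) simp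
  ultimately show ?thesis by simp
qed

lemma tensor_at_in_local_alg':
  "a' \<le> a \<Longrightarrow> a + int (length As) \<le> b' + 1 \<Longrightarrow> tensor_at a As \<in> local_alg a' b'"
proof (induction As arbitrary: a)
  case Nil
  then show ?case by (simp only: tensor_at.simps star_algebra_id[OF star_algebra_local_alg])
next
  case (Cons A As)
  then show ?case
    unfolding tensor_at.simps by (intro local_alg_compose site_op_in_local_alg Cons.IH) auto
qed

text \<open>The condition \<open>a \<le> b + 1\<close> admits the empty interval and makes
  \<open>nat (b - a + 1)\<close> the true number of sites.\<close>

lemma local_alg_mono:
  assumes "a' \<le> a" "b \<le> b'" "a \<le> b + 1" and T: "T \<in> local_alg a b"
  shows "T \<in> local_alg a' b'"
  using T
proof (induction rule: local_alg_induct)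
  case (add T c As)
  then show ?case
    using assms by (intro local_alg_plus local_alg_cscale tensor_at_in_local_alg') auto
qed (rule local_alg_zero)

lemma local_alg_incseq: "m \<le> n \<Longrightarrow> local_alg (- int m) (int m) \<subseteq> local_alg (- int n) (int n)"
  using local_alg_mono[of "- int n" "- int m" "int m" "int n"] by auto

section \<open>From finite intervals to the local algebra of the chain\<close>

lemma star_algebra_Union:
  fixes \<AA> :: "nat \<Rightarrow> ('a::complex_hilbert \<Rightarrow> 'a) set"
  assumes alg: "\<And>n. star_algebra (\<AA> n)" and mono: "\<And>m n. m \<le> n \<Longrightarrow> \<AA> m \<subseteq> \<AA> n"
  shows "star_algebra (\<Union>n. \<AA> n)"
  unfolding star_algebra_def
proof (intro conjI ballI allI)
  have pair: "\<exists>n. S \<in> \<AA> n \<and> T \<in> \<AA> n" if ST: "S \<in> (\<Union>n. \<AA> n)" "T \<in> (\<Union>n. \<AA> n)" for S T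
  proof -
    obtain m n where "S \<in> \<AA> m" "T \<in> \<AA> n" using ST by blast
    then show ?thesis using mono[of m "max m n"] mono[of n "max m n"]
      by (intro exI[of _ "max m n"]) auto
  qed
  show "bounded_clinear T" if "T \<in> (\<Union>n. \<AA> n)" for T using that star_algebra_bounded[OF alg] by blast
  show "id \<in> (\<Union>n. \<AA> n)" using star_algebra_id[OF alg] by blast
  show "(\<lambda>x. S x + T x) \<in> (\<Union>n. \<AA> n)" if "S \<in> (\<Union>n. \<AA> n)" "T \<in> (\<Union>n. \<AA> n)" for S T
    using pair[OF that] star_algebra_plus[OF alg] by blast
  show "(\<lambda>x. c *\<^sub>C T x) \<in> (\<Union>n. \<AA> n)" if "T \<in> (\<Union>n. \<AA> n)" for c T
    using that star_algebra_cscale[OF alg] by blast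
  show "S \<circ> T \<in> (\<Union>n. \<AA> n)" if "S \<in> (\<Union>n. \<AA> n)" "T \<in> (\<Union>n. \<AA> n)" for S T
    using pair[OF that] star_algebra_compose[OF alg] by blast
  show "hadj T \<in> (\<Union>n. \<AA> n)" if "T \<in> (\<Union>n. \<AA> n)" for T using that star_algebra_hadj[OF alg] by blast
qed

lemma star_algebra_Int: "star_algebra \<AA> \<Longrightarrow> star_algebra \<BB> \<Longrightarrow> star_algebra (\<AA> \<inter> \<BB>)"
  unfolding star_algebra_def by blast

definition chain_loc :: "('d::finite chain \<Rightarrow> 'd chain) set" where
  "chain_loc = (\<Union>n::nat. local_alg (- int n) (int n))"

lemma chain_alg_eq: "chain_alg = op_closure chain_loc"
  by (simp add: chain_alg_def chain_loc_def)

lemma star_algebra_chain_loc: "star_algebra chain_loc"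
  unfolding chain_loc_def
  by (rule star_algebra_Union[OF star_algebra_local_alg local_alg_incseq])

lemma star_algebra_chain_alg: "star_algebra chain_alg"
  unfolding chain_alg_eq by (rule star_algebra_op_closure[OF star_algebra_chain_loc])

lemma chain_loc_subset: "chain_loc \<subseteq> chain_alg"
  unfolding chain_alg_eq by (rule subset_op_closure) (rule star_algebra_bounded[OF star_algebra_chain_loc])

lemma op_closure_chain_alg: "op_closure chain_alg \<subseteq> chain_alg"
  unfolding chain_alg_eq by (rule op_closure_idem) (rule star_algebra_bounded[OF star_algebra_chain_loc])

lemma tensor_at_in_chain_loc: "tensor_at a As \<in> chain_loc"
proof -
  define n where "n = nat (\<bar>a\<bar> + int (length As))"
  have "tensor_at a As \<in> local_alg (- int n) (int n)"
    by (rule tensor_at_in_local_alg') (auto simp: n_def)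
  then show ?thesis unfolding chain_loc_def by blast
qed

lemma site_op_in_chain_loc: "site_op i A \<in> chain_loc"
  using tensor_at_in_chain_loc[of i "[A]"] by simp

lemma chain_loc_induct [consumes 1, case_names zero add]:
  assumes T: "T \<in> chain_loc" and zero: "P (\<lambda>_. 0)"
    and add: "\<And>T c a As. \<lbrakk>T \<in> chain_loc; P T\<rbrakk> \<Longrightarrow> P (\<lambda>\<psi>. T \<psi> + c *\<^sub>C tensor_at a As \<psi>)"
  shows "P T"
proof -
  obtain n :: nat where "T \<in> local_alg (- int n) (int n)" using T unfolding chain_loc_def by blast
  then show ?thesis
  proof (induction rule: local_alg_induct)
    case (add T c As)
    then show ?case by (intro assms(3)) (auto simp: chain_loc_def)
  qed (rule zero)
qed

lemma translate_op_in_chain_loc: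
  assumes "T \<in> chain_loc" shows "translate_op k T \<in> chain_loc"
  using assms
proof (induction rule: chain_loc_induct)
  case zero
  have "translate_op k (\<lambda>_. 0) = (\<lambda>_. 0 :: 'a chain)"
    using translate_op_cscale[of k 0 id] by simp
  then show ?case using star_algebra_zero[OF star_algebra_chain_loc] by simp
next
  case (add T c a As)
  then show ?case unfolding translate_op_plus translate_op_cscale translate_op_tensor_at
    by (intro star_algebra_plus[OF star_algebra_chain_loc] star_algebra_cscale[OF star_algebra_chain_loc]
        tensor_at_in_chain_loc)
qed

lemma local_alg_commute_tensor_at:
  assumes "S \<in> local_alg (- int n) (int n)" "int n < b"
  shows "S (tensor_at b Bs \<psi>) = tensor_at b Bs (S \<psi>)"
  using assms(1)
proof (induction rule: local_alg_induct)
  case zero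
  then show ?case by (simp add: bounded_clinear_zero[OF bounded_clinear_tensor_at])
next
  case (add T c As)
  have "tensor_at (- int n) As \<circ> tensor_at b Bs = tensor_at b Bs \<circ> tensor_at (- int n) As"
    using add(2) assms(2) by (intro tensor_at_commute) simp
  with add(3) show ?case
    by (simp add: fun_eq_iff bounded_clinear_add[OF bounded_clinear_tensor_at]
        bounded_clinear_scaleC[OF bounded_clinear_tensor_at])
qed

lemma chain_loc_asymptotically_abelian:
  assumes "S \<in> chain_loc" "T \<in> chain_loc"
  shows "\<exists>K. \<forall>k\<ge>K. S \<circ> translate_op (int k) T = translate_op (int k) T \<circ> S"
proof -
  obtain n m where S: "S \<in> local_alg (- int n) (int n)" and T: "T \<in> local_alg (- int m) (int m)"
    using assms unfolding chain_loc_def by blast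
  note bS = local_alg_bounded[OF S]
  \<comment> \<open>The translate of \<open>T\<close> begins at site \<open>k - m\<close>, which
    lies beyond \<open>n\<close>, so the two supports are disjoint.\<close>
  have "S \<circ> translate_op (int k) T = translate_op (int k) T \<circ> S" if k: "k \<ge> n + m + 1" for k
    using T
  proof (induction rule: local_alg_induct)
    case zero
    have "translate_op (int k) (\<lambda>_. 0) = (\<lambda>_. 0 :: 'a chain)"
      using translate_op_cscale[of "int k" 0 id] by simp
    then show ?case by (simp add: fun_eq_iff bounded_clinear_zero[OF bS])
  next
    case (add T c As)
    have "S (tensor_at (- int m + int k) As \<psi>) = tensor_at (- int m + int k) As (S \<psi>)" for \<psi>
      using k by (intro local_alg_commute_tensor_at[OF S]) simp
    with add(3) show ?case
      by (simp add: translate_op_plus translate_op_cscale translate_op_tensor_at fun_eq_iff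
          bounded_clinear_add[OF bS] bounded_clinear_scaleC[OF bS])
  qed
  then show ?thesis by blast
qed


section \<open>The gauge-invariant local operators\<close>

definition gauge_unitary :: "nat \<Rightarrow> 'd::finite cmat \<Rightarrow> 'd chain \<Rightarrow> 'd chain" where
  "gauge_unitary n g = tensor_at (- int n) (replicate (2 * n + 1) g)"

lemma unitary_mat_cadj: "unitary_mat g \<Longrightarrow> unitary_mat (cadj g)"
  by (simp add: unitary_mat_def)

lemma gauge_unitary_cancel:
  assumes "unitary_mat g"
  shows "gauge_unitary n g (gauge_unitary n (cadj g) \<psi>) = \<psi>"
    and "gauge_unitary n (cadj g) (gauge_unitary n g \<psi>) = \<psi>"
proof -
  have *: "gauge_unitary n h (gauge_unitary n (cadj h) \<psi>) = \<psi>" if h: "unitary_mat h" for h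
  proof -
    \<comment> \<open>Inserting the identity as an operator at site 0 reduces the cancellation to
      the conjugation formula, where unitarity gives \<open>mat 1\<close> back.\<close>
    have "gauge_unitary n h \<circ> site_op 0 (mat 1) \<circ> gauge_unitary n (cadj h) = id"
      using h unfolding gauge_unitary_def tensor_at_conj[OF h]
      by (simp add: unitary_mat_def site_op_1)
    then show ?thesis by (simp add: site_op_1 fun_eq_iff)
  qed
  show "gauge_unitary n g (gauge_unitary n (cadj g) \<psi>) = \<psi>" by (rule *[OF assms])
  show "gauge_unitary n (cadj g) (gauge_unitary n g \<psi>) = \<psi>"
    using *[OF unitary_mat_cadj[OF assms]] by simp
qed

definition gauge_conj :: "nat \<Rightarrow> 'd::finite cmat \<Rightarrow> ('d chain \<Rightarrow> 'd chain) \<Rightarrow> 'd chain \<Rightarrow> 'd chain" where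
  "gauge_conj n g T = gauge_unitary n g \<circ> T \<circ> gauge_unitary n (cadj g)"

lemma bounded_clinear_gauge_unitary: "bounded_clinear (gauge_unitary n g)"
  unfolding gauge_unitary_def by (rule bounded_clinear_tensor_at)

lemma gauge_conj_compose:
  "unitary_mat g \<Longrightarrow> gauge_conj n g (S \<circ> T) = gauge_conj n g S \<circ> gauge_conj n g T"
  by (simp add: gauge_conj_def fun_eq_iff gauge_unitary_cancel)

lemma gauge_conj_plus:
  "gauge_conj n g (\<lambda>\<psi>. S \<psi> + T \<psi>) = (\<lambda>\<psi>. gauge_conj n g S \<psi> + gauge_conj n g T \<psi>)"
  by (simp add: gauge_conj_def fun_eq_iff bounded_clinear_add[OF bounded_clinear_gauge_unitary])

lemma gauge_conj_cscale: "gauge_conj n g (\<lambda>\<psi>. c *\<^sub>C T \<psi>) = (\<lambda>\<psi>. c *\<^sub>C gauge_conj n g T \<psi>)"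
  by (simp add: gauge_conj_def fun_eq_iff bounded_clinear_scaleC[OF bounded_clinear_gauge_unitary])

lemma gauge_conj_sum: "gauge_conj n g (\<lambda>\<psi>. \<Sum>i\<in>I. T i \<psi>) = (\<lambda>\<psi>. \<Sum>i\<in>I. gauge_conj n g (T i) \<psi>)"
  by (simp add: gauge_conj_def fun_eq_iff bounded_clinear_sum[OF bounded_clinear_gauge_unitary])

lemma gauge_conj_site_op:
  "unitary_mat g \<Longrightarrow> \<bar>i\<bar> \<le> int n \<Longrightarrow> gauge_conj n g (site_op i A) = site_op i (g ** A ** cadj g)"
  unfolding gauge_conj_def gauge_unitary_def by (subst tensor_at_conj) auto

lemma gauge_conj_tensor_at:
  "unitary_mat g \<Longrightarrow> - int n \<le> a \<Longrightarrow> a + int (length As) \<le> int n + 1 \<Longrightarrow>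
    gauge_conj n g (tensor_at a As) = tensor_at a (map (\<lambda>A. g ** A ** cadj g) As)"
proof (induction As arbitrary: a)
  case Nil
  then show ?case by (simp add: gauge_conj_def fun_eq_iff gauge_unitary_cancel)
next
  case (Cons A As)
  have "gauge_conj n g (site_op a A) = site_op a (g ** A ** cadj g)"
    using Cons.prems by (intro gauge_conj_site_op) auto
  moreover have "gauge_conj n g (tensor_at (a + 1) As) = tensor_at (a + 1) (map (\<lambda>A. g ** A ** cadj g) As)"
    using Cons.prems by (intro Cons.IH) auto
  ultimately show ?case
    by (simp only: tensor_at.simps list.map gauge_conj_compose[OF Cons.prems(1)])
qed

lemma gauge_conj_local:
  assumes g: "unitary_mat g" and T: "T \<in> local_alg (- int m) (int m)" and n: "n \<ge> m"
  shows "gauge_conj n g T = gauge_conj m g T"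
  using T
proof (induction rule: local_alg_induct)
  case zero
  have "gauge_conj k g (\<lambda>_. 0) = (\<lambda>_. 0)" for k using gauge_conj_cscale[of k g 0 id] by simp
  then show ?case by simp
next
  case (add T c As)
  have "gauge_conj k g (tensor_at (- int m) As) = tensor_at (- int m) (map (\<lambda>A. g ** A ** cadj g) As)"
    if "k \<ge> m" for k
    using that add(2) by (intro gauge_conj_tensor_at g) auto
  with add(3) n show ?case by (simp add: gauge_conj_plus gauge_conj_cscale)
qed

text \<open>The sequence defining \<open>gauge_aut\<close> is constant once the conjugating product
  covers the support, so the limit is attained at \<open>m\<close>.\<close>

lemma gauge_aut_local:
  assumes g: "unitary_mat g" and T: "T \<in> local_alg (- int m) (int m)"
  shows "gauge_aut g T = gauge_conj m g T"
proof
  fix \<psi>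
  have "\<forall>\<^sub>F n in sequentially. (tensor_at (- int n) (replicate (2 * n + 1) g) \<circ> T \<circ>
      tensor_at (- int n) (replicate (2 * n + 1) (cadj g))) \<psi> = gauge_conj m g T \<psi>"
  proof (rule eventually_sequentiallyI)
    fix n assume "m \<le> n"
    from gauge_conj_local[OF g T this]
    show "(tensor_at (- int n) (replicate (2 * n + 1) g) \<circ> T \<circ>
      tensor_at (- int n) (replicate (2 * n + 1) (cadj g))) \<psi> = gauge_conj m g T \<psi>"
      by (metis gauge_conj_def gauge_unitary_def)
  qed
  then show "gauge_aut g T \<psi> = gauge_conj m g T \<psi>"
    unfolding gauge_aut_def by (intro limI tendsto_eventually)
qed

text \<open>Invariance under conjugation by a unitary is commutation with it. In this form the
  algebra structure of the invariant operators is inherited from an intersection with a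
  commutant.\<close>

lemma gauge_local_eq:
  assumes G: "\<And>g. g \<in> G \<Longrightarrow> unitary_mat g"
  shows "gauge_local G (- int n) (int n)
    = local_alg (- int n) (int n) \<inter> commutant (gauge_unitary n ` G)"
proof -
  have "gauge_aut g T = T \<longleftrightarrow> (\<forall>\<psi>. T (gauge_unitary n g \<psi>) = gauge_unitary n g (T \<psi>))"
    if T: "T \<in> local_alg (- int n) (int n)" and g: "g \<in> G" for T g
  proof -
    have "gauge_conj n g T = T \<longleftrightarrow> (\<forall>\<psi>. T (gauge_unitary n g \<psi>) = gauge_unitary n g (T \<psi>))"
    proof
      assume "gauge_conj n g T = T"
      then show "\<forall>\<psi>. T (gauge_unitary n g \<psi>) = gauge_unitary n g (T \<psi>)"
        by (metis G[OF g] gauge_conj_def gauge_unitary_cancel(2) o_apply)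
    next
      assume "\<forall>\<psi>. T (gauge_unitary n g \<psi>) = gauge_unitary n g (T \<psi>)"
      then have "gauge_conj n g T \<psi> = T (gauge_unitary n g (gauge_unitary n (cadj g) \<psi>))" for \<psi>
        by (simp add: gauge_conj_def)
      then show "gauge_conj n g T = T" by (simp add: fun_eq_iff gauge_unitary_cancel[OF G[OF g]])
    qed
    then show ?thesis by (simp add: gauge_aut_local[OF G[OF g] T])
  qed
  then have "T \<in> gauge_local G (- int n) (int n) \<longleftrightarrow> T \<in> local_alg (- int n) (int n) \<and>
      (\<forall>g\<in>G. \<forall>\<psi>. T (gauge_unitary n g \<psi>) = gauge_unitary n g (T \<psi>))" for T
    unfolding gauge_local_def by blast
  then show ?thesis
    unfolding commutant_def using local_alg_bounded by (intro set_eqI) (auto simp: fun_eq_iff)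
qed

lemma hadj_gauge_unitary: "hadj (gauge_unitary n g) = gauge_unitary n (cadj g)"
  by (simp add: gauge_unitary_def hadj_tensor_at del: replicate_Suc)

text \<open>\<open>Suc n\<close> turns the union over \<open>n \<ge> 1\<close> into a union over all
  naturals, the shape that \<open>star_algebra_Union\<close> handles.\<close>

definition gauge_loc :: "'d::finite cmat set \<Rightarrow> ('d chain \<Rightarrow> 'd chain) set" where
  "gauge_loc G = (\<Union>n. gauge_local G (- int (Suc n)) (int (Suc n)))"

lemma gauge_alg_eq: "gauge_alg G = op_closure (gauge_loc G)"
proof -
  have "{1::nat..} = range Suc" by (auto simp: image_iff) (metis Suc_le_D)
  then show ?thesis unfolding gauge_alg_def gauge_loc_def by simp
qed

lemma star_algebra_gauge_loc:
  assumes G: "discrete_unitary_subgroup G"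
  shows "star_algebra (gauge_loc G)"
  unfolding gauge_loc_def
proof (rule star_algebra_Union)
  have u: "\<And>g. g \<in> G \<Longrightarrow> unitary_mat g" and adj: "\<And>g. g \<in> G \<Longrightarrow> cadj g \<in> G"
    using G by (auto simp: discrete_unitary_subgroup_def)
  show "star_algebra (gauge_local G (- int (Suc n)) (int (Suc n)))" for n
    by (subst gauge_local_eq, erule u, intro star_algebra_Int star_algebra_local_alg star_algebra_commutant)
      (auto simp: bounded_clinear_gauge_unitary hadj_gauge_unitary adj)
  show "gauge_local G (- int (Suc m)) (int (Suc m)) \<subseteq> gauge_local G (- int (Suc n)) (int (Suc n))"
    if "m \<le> n" for m n
    unfolding gauge_local_def using local_alg_incseq[of "Suc m" "Suc n"] that by auto
qed

lemma gauge_loc_subset: "gauge_loc G \<subseteq> chain_loc"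
  unfolding gauge_loc_def chain_loc_def gauge_local_def by blast

lemma gauge_alg_subset: "gauge_alg G \<subseteq> chain_alg"
  unfolding gauge_alg_eq chain_alg_eq by (rule op_closure_mono[OF gauge_loc_subset])

lemma star_algebra_gauge_alg: "discrete_unitary_subgroup G \<Longrightarrow> star_algebra (gauge_alg G)"
  unfolding gauge_alg_eq by (intro star_algebra_op_closure star_algebra_gauge_loc)

text \<open>For \<open>p = (a, b)\<close> the summand is the matrix unit \<open>e_ab\<close> at
  \<open>i\<close> times \<open>e_ba\<close> at \<open>j\<close>. Written so, and not as a
  permutation of configurations, the transposition is visibly local and displays the factors that
  are sliced later.\<close>

definition swap_op :: "int \<Rightarrow> int \<Rightarrow> 'd::finite chain \<Rightarrow> 'd chain" where
  "swap_op i j = (\<lambda>\<psi>. \<Sum>p\<in>UNIV. (site_op i (matrix_unit (fst p) (snd p)) \<circ>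
     site_op j (matrix_unit (snd p) (fst p))) \<psi>)"

lemma conj_matrix_unit:
  "(g ** matrix_unit a b ** cadj g) $ s $ t = g $ s $ a * cnj (g $ t $ b)"
proof -
  have "(g ** matrix_unit a b ** cadj g) $ s $ t
      = (\<Sum>r\<in>UNIV. if r = b then g $ s $ a * cnj (g $ t $ r) else 0)"
    unfolding matrix_matrix_mult_def[of "g ** matrix_unit a b"] vec_lambda_beta matrix_unit_mult_right
    by (intro sum.cong) (auto simp: cadj_def)
  then show ?thesis by simp
qed

text \<open>Conjugation replaces the matrix units by those of another orthonormal basis, and the sum
  does not depend on the basis: for every unitary \<open>h\<close> it exchanges the values at
  \<open>i\<close> and \<open>j\<close>. The case \<open>h = mat 1\<close> is the swap
  itself.\<close>

lemma gauge_conj_swap_op: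
  fixes g :: "'d::finite cmat"
  assumes g: "unitary_mat g" and ij: "i \<noteq> j" "\<bar>i\<bar> \<le> int n" "\<bar>j\<bar> \<le> int n"
  shows "gauge_conj n g (swap_op i j) = swap_op i j"
proof -
  have formula: "ell2_fun (\<Sum>p\<in>UNIV. (site_op i (h ** matrix_unit (fst p) (snd p) ** cadj h) \<circ>
      site_op j (h ** matrix_unit (snd p) (fst p) ** cadj h)) \<psi>) \<sigma> = ell2_fun \<psi> (\<sigma>(i := \<sigma> j, j := \<sigma> i))"
    if h: "unitary_mat h" for h :: "'d cmat" and \<psi> \<sigma>
  proof -
    have orth: "(\<Sum>a\<in>UNIV. h $ s $ a * cnj (h $ t $ a)) = (if s = t then 1 else 0)" for s t
    proof -
      have "(h ** cadj h) $ s $ t = (mat 1 :: 'd cmat) $ s $ t" using h by (simp add: unitary_mat_def)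
      then show ?thesis by (simp add: matrix_matrix_mult_def cadj_def mat_def)
    qed
    have "ell2_fun (\<Sum>p\<in>UNIV. (site_op i (h ** matrix_unit (fst p) (snd p) ** cadj h) \<circ>
        site_op j (h ** matrix_unit (snd p) (fst p) ** cadj h)) \<psi>) \<sigma>
      = (\<Sum>p\<in>UNIV. \<Sum>s\<in>UNIV. \<Sum>t\<in>UNIV. (h $ \<sigma> i $ fst p * cnj (h $ s $ snd p)) *
          ((h $ \<sigma> j $ snd p * cnj (h $ t $ fst p)) * ell2_fun \<psi> (\<sigma>(i := s, j := t))))"
      using ij(1) by (simp add: ell2_fun_sum ell2_fun_site_op conj_matrix_unit sum_distrib_left)
    also have "\<dots> = (\<Sum>s\<in>UNIV. \<Sum>t\<in>UNIV. \<Sum>p\<in>UNIV. (h $ \<sigma> i $ fst p * cnj (h $ s $ snd p)) *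
          ((h $ \<sigma> j $ snd p * cnj (h $ t $ fst p)) * ell2_fun \<psi> (\<sigma>(i := s, j := t))))"
      by (subst sum.swap, intro sum.cong refl, rule sum.swap)
    also have "\<dots> = (\<Sum>s\<in>UNIV. \<Sum>t\<in>UNIV. (\<Sum>a\<in>UNIV. h $ \<sigma> i $ a * cnj (h $ t $ a)) *
        (\<Sum>b\<in>UNIV. h $ \<sigma> j $ b * cnj (h $ s $ b)) * ell2_fun \<psi> (\<sigma>(i := s, j := t)))"
    proof (intro sum.cong refl)
      fix s t
      have prod: "(\<Sum>a\<in>UNIV. f a) * (\<Sum>b\<in>UNIV. f' b) = (\<Sum>p\<in>UNIV. f (fst p) * f' (snd p))"
        for f f' :: "'d \<Rightarrow> complex"
        by (simp add: sum_product sum.cartesian_product case_prod_unfold)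
      show "(\<Sum>p\<in>UNIV. (h $ \<sigma> i $ fst p * cnj (h $ s $ snd p)) *
          ((h $ \<sigma> j $ snd p * cnj (h $ t $ fst p)) * ell2_fun \<psi> (\<sigma>(i := s, j := t))))
        = (\<Sum>a\<in>UNIV. h $ \<sigma> i $ a * cnj (h $ t $ a)) *
          (\<Sum>b\<in>UNIV. h $ \<sigma> j $ b * cnj (h $ s $ b)) * ell2_fun \<psi> (\<sigma>(i := s, j := t))"
        unfolding prod unfolding sum_distrib_right by (intro sum.cong refl) (simp add: mult_ac)
    qed
    also have "\<dots> = (\<Sum>s\<in>UNIV. \<Sum>t\<in>UNIV. if s = \<sigma> j then (if t = \<sigma> i then ell2_fun \<psi> (\<sigma>(i := s, j := t)) else 0) else 0)"
      unfolding orth by (intro sum.cong refl) simp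
    also have "\<dots> = (\<Sum>s\<in>UNIV. if s = \<sigma> j then (\<Sum>t\<in>UNIV. if t = \<sigma> i then ell2_fun \<psi> (\<sigma>(i := s, j := t)) else 0) else 0)"
      by (intro sum.cong refl) simp
    also have "\<dots> = ell2_fun \<psi> (\<sigma>(i := \<sigma> j, j := \<sigma> i))" by simp
    finally show ?thesis .
  qed
  have one: "cadj (mat 1) = (mat 1 :: 'd cmat)"
    by (simp add: cadj_def mat_def vec_eq_iff)
  then have unitary_one: "unitary_mat (mat 1 :: 'd cmat)" by (simp add: unitary_mat_def)
  have "gauge_conj n g (swap_op i j) \<psi> = swap_op i j \<psi>" for \<psi>
  proof (rule ell2_eqI)
    fix \<sigma>
    have "gauge_conj n g (swap_op i j) \<psi>
        = (\<Sum>p\<in>UNIV. (site_op i (g ** matrix_unit (fst p) (snd p) ** cadj g) \<circ>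
            site_op j (g ** matrix_unit (snd p) (fst p) ** cadj g)) \<psi>)"
      unfolding swap_op_def gauge_conj_sum
      by (simp only: gauge_conj_compose[OF g] gauge_conj_site_op[OF g ij(2)] gauge_conj_site_op[OF g ij(3)])
    then show "ell2_fun (gauge_conj n g (swap_op i j) \<psi>) \<sigma> = ell2_fun (swap_op i j \<psi>) \<sigma>"
      using formula[OF g, of \<psi> \<sigma>] formula[OF unitary_one, of \<psi> \<sigma>] by (simp add: swap_op_def one)
  qed
  then show ?thesis by blast
qed

lemma swap_op_in_gauge_alg:
  assumes G: "discrete_unitary_subgroup G" and "i \<noteq> j"
  shows "swap_op i j \<in> gauge_alg G"
proof -
  define n where "n = nat \<bar>i\<bar> + nat \<bar>j\<bar>"
  have i: "\<bar>i\<bar> \<le> int (Suc n)" and j: "\<bar>j\<bar> \<le> int (Suc n)" by (auto simp: n_def)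
  have loc: "swap_op i j \<in> local_alg (- int (Suc n)) (int (Suc n))"
    unfolding swap_op_def
    by (intro star_algebra_sum[OF star_algebra_local_alg] local_alg_compose site_op_in_local_alg)
      (use i j in auto)
  have "gauge_aut g (swap_op i j) = swap_op i j" if "g \<in> G" for g
  proof -
    have g: "unitary_mat g" using G that by (auto simp: discrete_unitary_subgroup_def)
    show ?thesis by (simp only: gauge_aut_local[OF g loc] gauge_conj_swap_op[OF g assms(2) i j])
  qed
  then have "swap_op i j \<in> gauge_loc G" using loc unfolding gauge_loc_def gauge_local_def by blast
  then show ?thesis unfolding gauge_alg_eq
    using subset_op_closure[of "gauge_loc G"] star_algebra_bounded[OF star_algebra_gauge_loc[OF G]] by blast
qed


section \<open>Representations\<close>

lemma representation_onD:
  assumes "representation_on \<AA> \<pi>"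
  shows rep_bounded: "T \<in> \<AA> \<Longrightarrow> bounded_clinear (\<pi> T)"
    and rep_plus: "S \<in> \<AA> \<Longrightarrow> T \<in> \<AA> \<Longrightarrow> \<pi> (\<lambda>x. S x + T x) = (\<lambda>y. \<pi> S y + \<pi> T y)"
    and rep_cscale: "T \<in> \<AA> \<Longrightarrow> \<pi> (\<lambda>x. c *\<^sub>C T x) = (\<lambda>y. c *\<^sub>C \<pi> T y)"
    and rep_compose: "S \<in> \<AA> \<Longrightarrow> T \<in> \<AA> \<Longrightarrow> \<pi> (S \<circ> T) = \<pi> S \<circ> \<pi> T"
    and rep_hadj: "T \<in> \<AA> \<Longrightarrow> \<pi> (hadj T) = hadj (\<pi> T)"
    and rep_id: "\<pi> id = id"
  using assms by (auto simp: representation_on_def)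

lemma rep_compose_apply:
  "representation_on \<AA> \<pi> \<Longrightarrow> S \<in> \<AA> \<Longrightarrow> T \<in> \<AA> \<Longrightarrow> \<pi> (S \<circ> T) y = \<pi> S (\<pi> T y)"
  using fun_cong[OF rep_compose[of \<AA> \<pi> S T], of y] unfolding o_apply .

lemma rep_plus_cscale:
  assumes "star_algebra \<AA>" "representation_on \<AA> \<pi>" "S \<in> \<AA>" "T \<in> \<AA>"
  shows "\<pi> (\<lambda>x. S x + c *\<^sub>C T x) = (\<lambda>y. \<pi> S y + c *\<^sub>C \<pi> T y)"
  using rep_plus[OF assms(2,3) star_algebra_cscale[OF assms(1,4)]] rep_cscale[OF assms(2,4)] by simp

lemma rep_minus:
  assumes alg: "star_algebra \<AA>" and rep: "representation_on \<AA> \<pi>" and S: "S \<in> \<AA>" and T: "T \<in> \<AA>"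
  shows "\<pi> (\<lambda>x. S x - T x) = (\<lambda>y. \<pi> S y - \<pi> T y)"
  using rep_plus_cscale[OF alg rep S T, of "-1"] by simp

lemma rep_zero:
  assumes alg: "star_algebra \<AA>" and rep: "representation_on \<AA> \<pi>"
  shows "\<pi> (\<lambda>_. 0) = (\<lambda>_. 0)"
  using rep_cscale[OF rep star_algebra_id[OF alg], of 0] by simp

lemma rep_sum:
  assumes alg: "star_algebra \<AA>" and rep: "representation_on \<AA> \<pi>"
  shows "(\<And>i. i \<in> I \<Longrightarrow> T i \<in> \<AA>) \<Longrightarrow> \<pi> (\<lambda>x. \<Sum>i\<in>I. T i x) = (\<lambda>y. \<Sum>i\<in>I. \<pi> (T i) y)"
proof (induction I rule: infinite_finite_induct)
  case (insert i I)
  then show ?case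
    using rep_plus[OF rep, of "T i" "\<lambda>x. \<Sum>i\<in>I. T i x"] star_algebra_sum[OF alg, of I T] by simp
qed (simp_all add: rep_zero[OF alg rep])

text \<open>With \<open>r^2 - hadj T T\<close> equal to \<open>S S\<close> in the algebra, the
  squared norm of \<open>\<pi> S \<eta>\<close> is the difference of the squares of
  \<open>r * norm \<eta>\<close> and \<open>norm (\<pi> T \<eta>)\<close>, which is therefore
  nonnegative. The definition of a representation asks only that each operator be bounded, so
  contractivity has to be derived.\<close>

lemma rep_norm_le:
  assumes alg: "star_algebra \<AA>" and closed: "op_closure \<AA> \<subseteq> \<AA>"
    and rep: "representation_on \<AA> \<pi>" and T: "T \<in> \<AA>"
  shows "norm (\<pi> T \<eta>) \<le> onorm T * norm \<eta>"
proof (rule le_mult_if_greater)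
  fix r assume r: "r > onorm T"
  then obtain S where S: "S \<in> \<AA>" "hadj S = S"
    "\<And>x. S (S x) = complex_of_real (r\<^sup>2) *\<^sub>C x - hadj T (T x)"
    by (rule sqrt_norm_defect[OF alg closed T]) blast
  have r0: "r \<ge> 0" using r bounded_clinear_onorm_nonneg[OF star_algebra_bounded[OF alg T]] by linarith
  note hT = star_algebra_hadj[OF alg T]
  have "S \<circ> S = (\<lambda>x. complex_of_real (r\<^sup>2) *\<^sub>C id x - (hadj T \<circ> T) x)" by (simp add: fun_eq_iff S(3))
  then have "\<pi> (S \<circ> S) = (\<lambda>y. complex_of_real (r\<^sup>2) *\<^sub>C \<pi> id y - \<pi> (hadj T \<circ> T) y)"
    using rep_minus[OF alg rep star_algebra_cscale[OF alg star_algebra_id[OF alg]] star_algebra_compose[OF alg hT T]]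
    by (simp only: rep_cscale[OF rep star_algebra_id[OF alg]])
  then have SS: "\<pi> S (\<pi> S \<eta>) = complex_of_real (r\<^sup>2) *\<^sub>C \<eta> - hadj (\<pi> T) (\<pi> T \<eta>)"
    by (simp only: rep_compose_apply[OF rep S(1) S(1), symmetric] rep_id[OF rep] id_apply
        rep_compose_apply[OF rep hT T] rep_hadj[OF rep T])
  have "hadj (\<pi> S) = \<pi> S" using rep_hadj[OF rep S(1)] S(2) by simp
  then have "cinner (\<pi> S \<eta>) (\<pi> S \<eta>) = cinner \<eta> (\<pi> S (\<pi> S \<eta>))"
    using cinner_hadj_left[OF rep_bounded[OF rep S(1)], of \<eta> "\<pi> S \<eta>"] by simp
  also have "\<dots> = complex_of_real (r\<^sup>2) * cinner \<eta> \<eta> - cinner (\<pi> T \<eta>) (\<pi> T \<eta>)"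
    by (simp only: SS cinner_diff_right cinner_scaleC_right cinner_hadj_right[OF rep_bounded[OF rep T]])
  finally have "(norm (\<pi> S \<eta>))\<^sup>2 = (r * norm \<eta>)\<^sup>2 - (norm (\<pi> T \<eta>))\<^sup>2"
    by (simp add: norm_power2 power_mult_distrib)
  then have "(norm (\<pi> T \<eta>))\<^sup>2 \<le> (r * norm \<eta>)\<^sup>2" using zero_le_power2[of "norm (\<pi> S \<eta>)"] by linarith
  then show "norm (\<pi> T \<eta>) \<le> r * norm \<eta>" by (rule power2_le_imp_le) (simp add: r0)
qed simp

lemma rep_op_closure:
  assumes alg: "star_algebra \<AA>" and closed: "op_closure \<AA> \<subseteq> \<AA>" and rep: "representation_on \<AA> \<pi>"
    and L: "L \<subseteq> \<AA>" and T: "T \<in> \<AA>" "T \<in> op_closure L"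
  shows "\<pi> T \<in> op_closure (\<pi> ` L)"
  unfolding op_closure_def
proof (intro CollectI conjI allI impI)
  show "bounded_clinear (\<pi> T)" by (rule rep_bounded[OF rep T(1)])
  fix e :: real assume "e > 0"
  then obtain A where A: "A \<in> L" "onorm (\<lambda>x. T x - A x) < e" by (rule op_closure_approx[OF T(2)])
  have AA: "A \<in> \<AA>" using A(1) L by blast
  have D: "(\<lambda>x. T x - A x) \<in> \<AA>" by (rule star_algebra_minus[OF alg T(1) AA])
  have "onorm (\<lambda>y. \<pi> T y - \<pi> A y) \<le> onorm (\<lambda>x. T x - A x)"
    using rep_norm_le[OF alg closed rep D] rep_minus[OF alg rep T(1) AA]
    by (intro onorm_bound bounded_clinear_onorm_nonneg[OF star_algebra_bounded[OF alg D]]) simp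
  with A show "\<exists>B\<in>\<pi> ` L. onorm (\<lambda>y. \<pi> T y - B y) < e"
    by (intro bexI[of _ "\<pi> A"] imageI) simp_all
qed

lemma commutant_op_closure: 
  assumes bd: "\<And>A. A \<in> S \<Longrightarrow> bounded_clinear A"
  shows "commutant (op_closure S) = commutant S"
proof
  show "commutant (op_closure S) \<subseteq> commutant S" by (intro commutant_antimono subset_op_closure bd)
  show "commutant S \<subseteq> commutant (op_closure S)"
  proof
    fix y assume y: "y \<in> commutant S"
    note bd_y = commutant_bounded[OF y]
    have "S \<subseteq> commutant {y}" using bd y by (auto intro!: commutantI simp: commutant_apply)
    from op_closure_mono[OF this] have sub: "op_closure S \<subseteq> commutant {y}"
      using op_closure_commutant[of "{y}"] bd_y by simp
    show "y \<in> commutant (op_closure S)"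
    proof (rule commutantI[OF bd_y])
      fix A x assume "A \<in> op_closure S"
      with sub have "A \<in> commutant {y}" by (rule subsetD)
      from commutant_apply[OF this] show "y (A x) = A (y x)" by simp
    qed
  qed
qed

section \<open>GNS triples\<close>

lemma gns_tripleD:
  assumes "gns_triple \<AA> \<phi> \<pi> \<xi>"
  shows gns_rep: "representation_on \<AA> \<pi>"
    and gns_state: "T \<in> \<AA> \<Longrightarrow> \<phi> T = cinner \<xi> (\<pi> T \<xi>)"
    and gns_cyclic: "closure ((\<lambda>T. \<pi> T \<xi>) ` \<AA>) = UNIV"
  using assms by (auto simp: gns_triple_def)

text \<open>Norms of GNS vectors are values of the state, hence comparable between translates and
  between different triples.\<close>

lemma gns_norm:
  assumes alg: "star_algebra \<AA>" and gns: "gns_triple \<AA> \<phi> \<pi> \<xi>" and T: "T \<in> \<AA>"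
  shows "\<phi> (hadj T \<circ> T) = complex_of_real ((norm (\<pi> T \<xi>))\<^sup>2)"
proof -
  note rep = gns_rep[OF gns]
  note hT = star_algebra_hadj[OF alg T]
  have "\<phi> (hadj T \<circ> T) = cinner \<xi> (hadj (\<pi> T) (\<pi> T \<xi>))"
    using gns_state[OF gns star_algebra_compose[OF alg hT T]]
    by (simp add: rep_compose[OF rep hT T] rep_hadj[OF rep T])
  then show ?thesis by (simp only: cinner_hadj_right[OF rep_bounded[OF rep T]] cinner_self)
qed

lemma rep_image_adjoint_closed:
  assumes alg: "star_algebra \<AA>" and sub: "\<BB> \<subseteq> \<AA>" "\<And>T. T \<in> \<BB> \<Longrightarrow> hadj T \<in> \<BB>"
    and rep: "representation_on \<AA> \<pi>" and A: "A \<in> \<pi> ` \<BB>"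
  shows "bounded_clinear A" "hadj A \<in> \<pi> ` \<BB>"
  using A sub rep_bounded[OF rep] rep_hadj[OF rep] by (auto simp flip: rep_hadj[OF rep])


section \<open>Translation-invariant factor states on the chain\<close>

text \<open>Invariance is stated on elementary tensors, where the formula for a finitely correlated
  state displays it; linearity extends it to \<open>chain_loc\<close>.\<close>

locale invariant_gns =
  fixes \<phi> :: "('d::finite chain \<Rightarrow> 'd chain) \<Rightarrow> complex"
    and \<pi> :: "('d chain \<Rightarrow> 'd chain) \<Rightarrow> ('h::complex_hilbert \<Rightarrow> 'h)" and \<xi> :: 'h
  assumes state: "state_on chain_alg \<phi>"
    and invariant: "\<phi> (tensor_at j As) = \<phi> (tensor_at k As)"
    and gns: "gns_triple chain_alg \<phi> \<pi> \<xi>"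
    and sep: "separating \<xi> (bicommutant (\<pi> ` chain_alg))"
    and fact: "factor (bicommutant (\<pi> ` chain_alg))"
begin

abbreviation (input) L :: "('h \<Rightarrow> 'h) set" where "L \<equiv> \<pi> ` chain_loc"

lemmas rep = gns_rep[OF gns]
lemmas alg = star_algebra_chain_alg
lemmas loc = subsetD[OF chain_loc_subset]

lemma L_bounded: "A \<in> L \<Longrightarrow> bounded_clinear A" and L_hadj: "A \<in> L \<Longrightarrow> hadj A \<in> L"
  using rep_image_adjoint_closed[OF alg chain_loc_subset star_algebra_hadj[OF star_algebra_chain_loc] rep]
  by blast+

text \<open>By contractivity the local operators have a norm-dense image, hence the same commutant.
  The ergodic argument may thus be confined to local operators, for which distant translates commute
  exactly.\<close>

lemma commutant_L: "commutant L = commutant (\<pi> ` chain_alg)"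
proof
  show "commutant (\<pi> ` chain_alg) \<subseteq> commutant L" by (intro commutant_antimono image_mono chain_loc_subset)
  have "\<pi> ` chain_alg \<subseteq> op_closure L"
    using rep_op_closure[OF alg op_closure_chain_alg rep chain_loc_subset] chain_alg_eq by blast
  then show "commutant L \<subseteq> commutant (\<pi> ` chain_alg)"
    using commutant_op_closure[OF L_bounded] commutant_antimono by blast
qed

lemma bicommutant_L: "bicommutant L = bicommutant (\<pi> ` chain_alg)"
  by (simp add: bicommutant_def commutant_L)

lemma L_cyclic: "closure ((\<lambda>T. \<pi> T \<xi>) ` chain_loc) = UNIV"
proof -
  have "(\<lambda>T. \<pi> T \<xi>) ` chain_alg \<subseteq> closure ((\<lambda>T. \<pi> T \<xi>) ` chain_loc)"
  proof (intro image_subsetI)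
    fix T :: "'d chain \<Rightarrow> 'd chain" assume T: "T \<in> chain_alg"
    show "\<pi> T \<xi> \<in> closure ((\<lambda>T. \<pi> T \<xi>) ` chain_loc)"
      unfolding closure_approachable
    proof (intro allI impI)
      fix e :: real assume e: "e > 0"
      have T': "T \<in> op_closure chain_loc" using T chain_alg_eq by blast
      have "e / (norm \<xi> + 1) > 0" using e by (simp add: add_nonneg_pos)
      then obtain A where A: "A \<in> chain_loc" "onorm (\<lambda>x. T x - A x) < e / (norm \<xi> + 1)"
        by (rule op_closure_approx[OF T'])
      have D: "(\<lambda>x. T x - A x) \<in> chain_alg" by (rule star_algebra_minus[OF alg T loc[OF A(1)]])
      have "norm (\<pi> T \<xi> - \<pi> A \<xi>) \<le> onorm (\<lambda>x. T x - A x) * norm \<xi>"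
        using rep_norm_le[OF alg op_closure_chain_alg rep D, of \<xi>]
        by (simp add: rep_minus[OF alg rep T loc[OF A(1)]])
      also have "\<dots> \<le> onorm (\<lambda>x. T x - A x) * (norm \<xi> + 1)"
        using bounded_clinear_onorm_nonneg[OF star_algebra_bounded[OF alg D]] by (intro mult_left_mono) auto
      also have "\<dots> < e" using A(2) by (simp add: less_divide_eq add_nonneg_pos)
      finally show "\<exists>y\<in>(\<lambda>T. \<pi> T \<xi>) ` chain_loc. dist y (\<pi> T \<xi>) < e"
        using A(1) by (auto simp: dist_norm norm_minus_commute)
    qed
  qed
  then have "closure ((\<lambda>T. \<pi> T \<xi>) ` chain_alg) \<subseteq> closure ((\<lambda>T. \<pi> T \<xi>) ` chain_loc)"
    by (intro closure_minimal closed_closure)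
  then show ?thesis using gns_cyclic[OF gns] by (simp add: top.extremum_unique)
qed

lemma cinner_\<xi>: "cinner \<xi> \<xi> = 1"
  using gns_state[OF gns star_algebra_id[OF alg]] rep_id[OF rep] state by (simp add: state_on_def)

section \<open>Translations on the GNS space\<close>

lemma \<phi>_translate_op:
  assumes T: "T \<in> chain_loc" shows "\<phi> (translate_op k T) = \<phi> T"
  using T
proof (induction rule: chain_loc_induct)
  case zero
  have "translate_op k (\<lambda>_. 0) = (\<lambda>_. 0 :: 'd chain)"
    using translate_op_cscale[of k 0 id] by simp
  then show ?case by simp
next
  case (add T c a As)
  have lin: "\<phi> (\<lambda>\<psi>. S \<psi> + c *\<^sub>C R \<psi>) = \<phi> S + c * \<phi> R" if "S \<in> chain_loc" "R \<in> chain_loc" for S R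
    using state loc[OF that(1)] loc[OF that(2)] loc[OF star_algebra_cscale[OF star_algebra_chain_loc that(2), of c]]
    unfolding state_on_def by fastforce
  show ?case
    unfolding translate_op_plus translate_op_cscale translate_op_tensor_at
    using add by (simp add: lin translate_op_in_chain_loc tensor_at_in_chain_loc invariant[of "a + k" As a])
qed

lemma norm_translate_op: "T \<in> chain_loc \<Longrightarrow> norm (\<pi> (translate_op k T) \<xi>) = norm (\<pi> T \<xi>)"
proof -
  assume T: "T \<in> chain_loc"
  note bT = star_algebra_bounded[OF star_algebra_chain_loc T]
  have HT: "hadj T \<circ> T \<in> chain_loc"
    by (intro star_algebra_compose[OF star_algebra_chain_loc] star_algebra_hadj[OF star_algebra_chain_loc] T)
  have "complex_of_real ((norm (\<pi> (translate_op k T) \<xi>))\<^sup>2) = \<phi> (translate_op k (hadj T \<circ> T))"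
    using gns_norm[OF alg gns loc[OF translate_op_in_chain_loc[OF T]], of k]
    by (simp only: hadj_translate_op[OF bT] translate_op_compose)
  also have "\<dots> = complex_of_real ((norm (\<pi> T \<xi>))\<^sup>2)"
    by (simp only: \<phi>_translate_op[OF HT] gns_norm[OF alg gns loc[OF T]])
  finally show ?thesis by (simp only: of_real_eq_iff power2_eq_iff_nonneg norm_ge_zero)
qed

text \<open>Invariance gives \<open>\<pi> T \<xi>\<close> and its translate equal norms, so the
  assignment is well defined on a dense subspace and extends.\<close>

lemma translation_unitary:
  obtains V where "bounded_clinear V" "\<And>T. T \<in> chain_loc \<Longrightarrow> V (\<pi> T \<xi>) = \<pi> (translate_op k T) \<xi>"
proof -
  have lin: "\<exists>R\<in>chain_loc. \<pi> R \<xi> = \<pi> S \<xi> + c *\<^sub>C \<pi> T \<xi> \<and>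
      \<pi> (translate_op k R) \<xi> = \<pi> (translate_op k S) \<xi> + c *\<^sub>C \<pi> (translate_op k T) \<xi>"
    if S: "S \<in> chain_loc" and T: "T \<in> chain_loc" for S T c
  proof (rule bexI)
    note c = star_algebra_cscale[OF star_algebra_chain_loc]
    show "(\<lambda>x. S x + c *\<^sub>C T x) \<in> chain_loc" by (intro star_algebra_plus[OF star_algebra_chain_loc] c S T)
    show "\<pi> (\<lambda>x. S x + c *\<^sub>C T x) \<xi> = \<pi> S \<xi> + c *\<^sub>C \<pi> T \<xi> \<and>
      \<pi> (translate_op k (\<lambda>x. S x + c *\<^sub>C T x)) \<xi> = \<pi> (translate_op k S) \<xi> + c *\<^sub>C \<pi> (translate_op k T) \<xi>"
      by (simp only: rep_plus_cscale[OF alg rep loc loc] S T translate_op_plus translate_op_cscale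
          translate_op_in_chain_loc)
  qed
  show ?thesis
    by (rule dense_extension[where I = chain_loc and u = "\<lambda>T. \<pi> T \<xi>"
          and v = "\<lambda>T. \<pi> (translate_op k T) \<xi>" and K = 1])
      (use lin L_cyclic norm_translate_op that in auto)
qed

lemma local_eqI:
  assumes "bounded_clinear S" "bounded_clinear T" "\<And>A. A \<in> chain_loc \<Longrightarrow> S (\<pi> A \<xi>) = T (\<pi> A \<xi>)"
  shows "S = T"
  by (rule bounded_clinear_eq_on_dense[OF assms(1,2) _ L_cyclic]) (use assms(3) in auto)

lemma site_op_in_chain_alg: "site_op i A \<in> chain_alg"
  by (rule loc[OF site_op_in_chain_loc])

text \<open>Faithfulness of the state makes the slice map \<open>X \<mapsto> (\<phi>(X e\<^sub>b\<^sub>a))\<^sub>a\<^sub>b\<close> injective, hence onto.\<close>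

lemma slice_surj:
  fixes A :: "'d cmat"
  obtains X where "\<And>a b. cinner \<xi> (\<pi> (site_op i (X ** matrix_unit b a)) \<xi>) = A $ a $ b"
proof -
  define f where "f B = cinner \<xi> (\<pi> (site_op i B) \<xi>)" for B
  have f_add: "f (A + B) = f A + f B" for A B
  proof -
    have "site_op i (A + B) = (\<lambda>\<psi>. site_op i A \<psi> + site_op i B \<psi>)"
      by (rule ext, rule ell2_eqI) (simp add: ell2_fun_site_op distrib_right sum.distrib)
    then show ?thesis
      unfolding f_def by (simp add: rep_plus[OF rep site_op_in_chain_alg site_op_in_chain_alg] cinner_add_right)
  qed
  have f_cscale: "f (cscale c B) = c * f B" for c B
  proof -
    have "site_op i (cscale c B) = (\<lambda>\<psi>. c *\<^sub>C site_op i B \<psi>)"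
      by (rule ext, rule ell2_eqI) (simp add: ell2_fun_site_op cscale_def sum_distrib_left mult.assoc)
    then show ?thesis
      unfolding f_def by (simp add: rep_cscale[OF rep site_op_in_chain_alg] cinner_scaleC_right)
  qed
  have f0: "f 0 = 0" using f_add[of 0 0] by simp
  have f_sum: "f (\<Sum>i\<in>I. g i) = (\<Sum>i\<in>I. f (g i))" for g :: "'j \<Rightarrow> 'd cmat" and I
    by (induction I rule: infinite_finite_induct) (simp_all add: f0 f_add)
  define C where "C X = (\<chi> a b. f (X ** matrix_unit b a))" for X
  \<comment> \<open>Real linearity is enough: an injective linear endomorphism of a
    finite-dimensional space is onto.\<close>
  have "linear C"
  proof (rule linearI)
    show "C (X + Y) = C X + C Y" for X Y
    proof -
      have "(X + Y) ** Z = X ** Z + Y ** Z" for Z :: "'d cmat"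
        by (simp add: vec_eq_iff matrix_matrix_mult_def distrib_right sum.distrib)
      then have "C (X + Y) $ a $ b = (C X + C Y) $ a $ b" for a b
        by (simp only: C_def vec_lambda_beta vector_add_component f_add)
      then show ?thesis by (simp add: vec_eq_iff)
    qed
    show "C (r *\<^sub>R X) = r *\<^sub>R C X" for r X
    proof -
      have "(r *\<^sub>R X) ** Y = cscale (complex_of_real r) (X ** Y)" for Y :: "'d cmat"
        by (simp only: vec_eq_iff cscale_def matrix_matrix_mult_def vec_lambda_beta vector_scaleR_component
            scaleR_conv_of_real[where 'a = complex] sum_distrib_left mult.assoc simp_thms)
      then have "C (r *\<^sub>R X) $ a $ b = (r *\<^sub>R C X) $ a $ b" for a b
        by (simp only: C_def vec_lambda_beta vector_scaleR_component f_cscale scaleR_conv_of_real[where 'a = complex])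
      then show ?thesis by (simp only: vec_eq_iff simp_thms)
    qed
  qed
  moreover have "X = 0" if "C X = 0" for X
  proof -
    have z: "f (X ** matrix_unit b a) = 0" for a b using that by (simp add: C_def vec_eq_iff)
    have decomp: "X ** Y = (\<Sum>b\<in>UNIV. \<Sum>a\<in>UNIV. cscale (Y $ b $ a) (X ** matrix_unit b a))" for Y
    proof -
      have "(\<Sum>b\<in>UNIV. \<Sum>a\<in>UNIV. cscale (Y $ b $ a) (X ** matrix_unit b a)) $ s $ t
          = (\<Sum>b\<in>UNIV. \<Sum>a\<in>UNIV. if t = a then Y $ b $ a * X $ s $ b else 0)" for s t
        unfolding sum_component cscale_def vec_lambda_beta matrix_unit_mult_right by (intro sum.cong refl) simp
      then show ?thesis by (simp add: vec_eq_iff matrix_matrix_mult_def mult.commute)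
    qed
    \<comment> \<open>The slices of \<open>X\<close> determine \<open>f (X ** Y)\<close> for every
      \<open>Y\<close>; the choice \<open>cadj X\<close> turns this value into a squared
      norm.\<close>
    have "f (X ** cadj X) = 0" unfolding decomp[of "cadj X"] f_sum f_cscale z by simp
    moreover have "f (X ** cadj X) = cinner (\<pi> (site_op i (cadj X)) \<xi>) (\<pi> (site_op i (cadj X)) \<xi>)"
    proof -
      have "\<pi> (site_op i (X ** cadj X)) = hadj (\<pi> (site_op i (cadj X))) \<circ> \<pi> (site_op i (cadj X))"
        using rep_compose[OF rep site_op_in_chain_alg site_op_in_chain_alg, of i X i "cadj X"]
          rep_hadj[OF rep site_op_in_chain_alg, of i "cadj X"]
        by (simp add: site_op_mult hadj_site_op)
      then show ?thesis
        by (simp add: f_def cinner_hadj_right[OF rep_bounded[OF rep site_op_in_chain_alg]])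
    qed
    ultimately have "\<pi> (site_op i (cadj X)) \<xi> = 0" by (simp add: cinner_self)
    moreover have "\<pi> (site_op i (cadj X)) \<in> bicommutant (\<pi> ` chain_alg)"
      using subset_bicommutant[of "\<pi> ` chain_alg"] rep_bounded[OF rep] site_op_in_chain_alg by blast
    ultimately have zero: "\<pi> (site_op i (cadj X)) = (\<lambda>_. 0)" by (intro separatingD[OF sep])
    have "cadj X $ a $ b = 0" for a b
    proof -
      \<comment> \<open>Injectivity of \<open>\<pi>\<close> on one site, by hand: an entry of
        \<open>cadj X\<close>, times the identity, is a sum of products containing
        \<open>cadj X\<close>, so it vanishes under \<open>f\<close> when \<open>cadj X\<close> is
        represented by zero.\<close>
      have "(\<Sum>c\<in>UNIV. matrix_unit c a ** cadj X ** matrix_unit b c) $ s $ t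
          = cscale (cadj X $ a $ b) (mat 1) $ s $ t" for s t
        by (simp add: matrix_unit_mult_left matrix_unit_mult_right cscale_def mat_def)
      then have "cscale (cadj X $ a $ b) (mat 1) = (\<Sum>c\<in>UNIV. matrix_unit c a ** cadj X ** matrix_unit b c)"
        by (simp add: vec_eq_iff)
      moreover have "f (matrix_unit c a ** cadj X ** matrix_unit b c) = 0" for c
        unfolding f_def site_op_mult[symmetric]
        by (simp only: rep_compose_apply[OF rep star_algebra_compose[OF alg site_op_in_chain_alg site_op_in_chain_alg]
              site_op_in_chain_alg] rep_compose_apply[OF rep site_op_in_chain_alg site_op_in_chain_alg] zero
            bounded_clinear_zero[OF rep_bounded[OF rep site_op_in_chain_alg]] cinner_zero_right)
      ultimately have "f (cscale (cadj X $ a $ b) (mat 1)) = 0" by (simp add: f_sum)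
      moreover have "f (mat 1) = 1"
        unfolding f_def site_op_1 rep_id[OF rep] by (simp add: cinner_\<xi>)
      ultimately show ?thesis by (simp only: f_cscale mult_1_right)
    qed
    then have "cadj X = 0" by (simp add: vec_eq_iff)
    then have "cadj (cadj X) = cadj 0" by simp
    then show "X = 0" by (simp add: cadj_def vec_eq_iff)
  qed
  ultimately have "surj C"
    by (intro linear_injective_imp_surjective) (auto simp: linear_injective_0)
  then obtain X where "C X = A" by (metis surjD)
  then show ?thesis by (intro that[of X]) (auto simp: C_def f_def)
qed

theorem swap_commutant_trivial:
  assumes z: "z \<in> bicommutant (\<pi> ` chain_alg)"
    and swap: "\<And>i j \<eta>. i \<noteq> j \<Longrightarrow> z (\<pi> (swap_op i j) \<eta>) = \<pi> (swap_op i j) (z \<eta>)"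
  shows "\<exists>c. z = (\<lambda>x. c *\<^sub>C x)"
proof -
  have center: "\<exists>c. y = (\<lambda>x. c *\<^sub>C x)" if "y \<in> bicommutant L" "y \<in> commutant L" for y
  proof -
    have "y \<in> commutant (bicommutant (\<pi> ` chain_alg))"
      using that(2) by (simp only: commutant_bicommutant[OF L_bounded] bicommutant_L[symmetric])
    then show ?thesis using fact that(1) unfolding factor_def bicommutant_L by blast
  qed
  obtain V where V: "bounded_clinear V" "\<And>T. T \<in> chain_loc \<Longrightarrow> V (\<pi> T \<xi>) = \<pi> (translate_op 1 T) \<xi>"
    by (rule translation_unitary[of 1]) blast
  obtain U where U: "bounded_clinear U" "\<And>T. T \<in> chain_loc \<Longrightarrow> U (\<pi> T \<xi>) = \<pi> (translate_op (-1) T) \<xi>"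
    by (rule translation_unitary[of "-1"]) blast
  have "V \<circ> U = id" "U \<circ> V = id"
    by (rule local_eqI; simp add: bounded_clinear_compose[unfolded o_def] bounded_clinear_id[unfolded id_def]
        V U o_def id_def translate_op_in_chain_loc translate_op_translate_op translate_op_0)+
  then have VU: "V (U x) = x" and UV: "U (V x) = x" for x by (simp_all add: fun_eq_iff)
  \<comment> \<open>Stated for any pair implementing translation by \<open>k\<close> and by
    \<open>- k\<close>, so that it covers \<open>V\<close> and \<open>U\<close> in either order as
    well as their powers.\<close>
  have conj: "V' \<circ> \<pi> T \<circ> U' = \<pi> (translate_op k T)"
    if T: "T \<in> chain_loc" and V': "bounded_clinear V'" "\<And>T. T \<in> chain_loc \<Longrightarrow> V' (\<pi> T \<xi>) = \<pi> (translate_op k T) \<xi>"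
      and U': "bounded_clinear U'" "\<And>T. T \<in> chain_loc \<Longrightarrow> U' (\<pi> T \<xi>) = \<pi> (translate_op (- k) T) \<xi>" for V' U' T k
  proof (rule local_eqI)
    show "bounded_clinear (V' \<circ> \<pi> T \<circ> U')"
      by (intro bounded_clinear_compose V' U' rep_bounded[OF rep] loc T)
    show "bounded_clinear (\<pi> (translate_op k T))"
      by (intro rep_bounded[OF rep] loc translate_op_in_chain_loc T)
    fix A :: "'d chain \<Rightarrow> 'd chain" assume A: "A \<in> chain_loc"
    note tA = translate_op_in_chain_loc[OF A, of "- k"]
    have "\<pi> T (\<pi> (translate_op (- k) A) \<xi>) = \<pi> (T \<circ> translate_op (- k) A) \<xi>"
      by (simp add: rep_compose[OF rep loc[OF T] loc[OF tA]])
    then have "(V' \<circ> \<pi> T \<circ> U') (\<pi> A \<xi>) = \<pi> (translate_op k (T \<circ> translate_op (- k) A)) \<xi>"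
      using V'(2)[OF star_algebra_compose[OF star_algebra_chain_loc T tA]] by (simp add: U'(2)[OF A])
    also have "translate_op k (T \<circ> translate_op (- k) A) = translate_op k T \<circ> A"
      by (simp add: translate_op_compose translate_op_translate_op translate_op_0)
    also have "\<pi> (translate_op k T \<circ> A) \<xi> = \<pi> (translate_op k T) (\<pi> A \<xi>)"
      by (rule rep_compose_apply[OF rep loc[OF translate_op_in_chain_loc[OF T]] loc[OF A]])
    finally show "(V' \<circ> \<pi> T \<circ> U') (\<pi> A \<xi>) = \<pi> (translate_op k T) (\<pi> A \<xi>)" .
  qed
  have Vpow: "(V ^^ k) (\<pi> T \<xi>) = \<pi> (translate_op (int k) T) \<xi>" if "T \<in> chain_loc" for k T
    using that by (induction k arbitrary: T)
      (simp_all add: translate_op_0 V translate_op_in_chain_loc translate_op_translate_op)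
  have Upow: "(U ^^ k) (\<pi> T \<xi>) = \<pi> (translate_op (- int k) T) \<xi>" if "T \<in> chain_loc" for k T
    using that by (induction k arbitrary: T)
      (simp_all add: translate_op_0 U translate_op_in_chain_loc translate_op_translate_op)
  have conj_pow: "(V ^^ k) (\<pi> T ((U ^^ k) \<eta>)) = \<pi> (translate_op (int k) T) \<eta>" if T: "T \<in> chain_loc" for k T \<eta>
  proof -
    have "(V ^^ k) \<circ> \<pi> T \<circ> (U ^^ k) = \<pi> (translate_op (int k) T)"
      by (rule conj[OF T]) (simp_all add: bounded_clinear_funpow V(1) U(1) Vpow Upow)
    then show ?thesis by (simp add: fun_eq_iff)
  qed
  have \<xi>: "\<pi> id \<xi> = \<xi>" by (simp add: rep_id[OF rep])
  interpret shift_system L V U \<xi>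
  proof
    show "norm (V x) = norm x" for x
      by (rule isometry_of_dense[OF V(1) _ L_cyclic]) (use V(2) norm_translate_op in auto)
    show "V \<xi> = \<xi>"
      using V(2)[OF star_algebra_id[OF star_algebra_chain_loc]] by (simp only: \<xi> translate_op_id)
    show "V \<circ> T \<circ> U \<in> L" if T: "T \<in> L" for T
    proof -
      obtain A where "A \<in> chain_loc" "T = \<pi> A" using T by blast
      then show ?thesis using conj[OF _ V U] by (auto simp: translate_op_in_chain_loc)
    qed
    show "U \<circ> T \<circ> V \<in> L" if T: "T \<in> L" for T
    proof -
      obtain A where "A \<in> chain_loc" "T = \<pi> A" using T by blast
      then show ?thesis using conj[of A U "-1" V] U V by (auto simp: translate_op_in_chain_loc)
    qed
    show "\<exists>K. \<forall>k\<ge>K. \<forall>x. S ((V ^^ k) (T ((U ^^ k) x))) = (V ^^ k) (T ((U ^^ k) (S x)))"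
      if ST: "S \<in> L" "T \<in> L" for S T
    proof -
      obtain A B where A: "A \<in> chain_loc" "S = \<pi> A" and B: "B \<in> chain_loc" "T = \<pi> B" using ST by blast
      obtain K where K: "\<And>k. k \<ge> K \<Longrightarrow> A \<circ> translate_op (int k) B = translate_op (int k) B \<circ> A"
        using chain_loc_asymptotically_abelian[OF A(1) B(1)] by blast
      have "\<pi> A \<circ> \<pi> (translate_op (int k) B) = \<pi> (translate_op (int k) B) \<circ> \<pi> A" if "k \<ge> K" for k
        using K[OF that] rep_compose[OF rep loc[OF A(1)] loc[OF translate_op_in_chain_loc[OF B(1)]], of "int k"]
          rep_compose[OF rep loc[OF translate_op_in_chain_loc[OF B(1)]] loc[OF A(1)], of "int k"] by simp
      then have "\<forall>k\<ge>K. \<forall>x. \<pi> A (\<pi> (translate_op (int k) B) x) = \<pi> (translate_op (int k) B) (\<pi> A x)"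
        by (auto simp: fun_eq_iff)
      then show ?thesis unfolding A(2) B(2) conj_pow[OF B(1)] by blast
    qed
    show "closure ((\<lambda>T. T \<xi>) ` L) = UNIV" using L_cyclic by (simp add: image_image)
    show "separating \<xi> (bicommutant L)" unfolding bicommutant_L by (rule sep)
  qed (use L_bounded L_hadj V U VU UV cinner_\<xi> center in auto)
  have zL: "z \<in> bicommutant L" using z by (simp only: bicommutant_L)
  have bz: "bounded_clinear z" by (rule bicommutant_bounded[OF z])
  have site: "z (\<pi> (site_op i A) \<eta>) = \<pi> (site_op i A) (z \<eta>)" for i A \<eta>
  proof -
    \<comment> \<open>\<open>X\<close> is chosen so that slicing the swap against it returns exactly
      \<open>A\<close>.\<close>
    obtain X where X: "\<And>a b. cinner \<xi> (\<pi> (site_op i (X ** matrix_unit b a)) \<xi>) = A $ a $ b"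
      by (rule slice_surj[of i A]) blast
    define u v where "u p = \<pi> (site_op i (matrix_unit (fst p) (snd p)))"
      and "v p = \<pi> (site_op i (matrix_unit (snd p) (fst p)))" for p :: "'d \<times> 'd"
    have xv: "\<pi> (site_op i X) \<circ> v p = \<pi> (site_op i (X ** matrix_unit (snd p) (fst p)))" for p
      unfolding v_def site_op_mult[symmetric] by (simp only: rep_compose[OF rep site_op_in_chain_alg site_op_in_chain_alg])
    have shift_v: "shift k (v p) \<eta> = \<pi> (site_op (i + int k) (matrix_unit (snd p) (fst p))) \<eta>" for k p \<eta>
      unfolding shift_def v_def by (simp add: conj_pow[OF site_op_in_chain_loc] translate_op_site_op)
    have swap_eq: "\<pi> (swap_op i (i + int k)) \<eta> = (\<Sum>p\<in>UNIV. u p (shift k (v p) \<eta>))" for k \<eta>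
    proof -
      have "\<pi> (swap_op i (i + int k)) = (\<lambda>\<eta>. \<Sum>p\<in>UNIV. \<pi> (site_op i (matrix_unit (fst p) (snd p)) \<circ>
          site_op (i + int k) (matrix_unit (snd p) (fst p))) \<eta>)"
        unfolding swap_op_def
        by (intro rep_sum[OF alg rep] star_algebra_compose[OF alg] site_op_in_chain_alg)
      then show ?thesis
        by (simp add: rep_compose[OF rep site_op_in_chain_alg site_op_in_chain_alg] shift_v u_def)
    qed
    have slice: "(\<Sum>p\<in>UNIV. cinner \<xi> (\<pi> (site_op i X) (v p \<xi>)) *\<^sub>C u p \<eta>) = \<pi> (site_op i A) \<eta>" for \<eta>
    proof -
      have coeff: "cinner \<xi> (\<pi> (site_op i X) (v p \<xi>)) = A $ fst p $ snd p" for p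
        using xv[of p] X[of "snd p" "fst p"] by (simp add: fun_eq_iff)
      have "site_op i A = (\<lambda>\<psi>. \<Sum>p\<in>UNIV. A $ fst p $ snd p *\<^sub>C site_op i (matrix_unit (fst p) (snd p)) \<psi>)"
        unfolding site_op_sum_matrix_units[of i A, abs_def]
        by (simp add: sum.cartesian_product case_prod_unfold)
      moreover have "\<pi> (\<lambda>\<psi>. \<Sum>p\<in>UNIV. A $ fst p $ snd p *\<^sub>C site_op i (matrix_unit (fst p) (snd p)) \<psi>)
          = (\<lambda>\<eta>. \<Sum>p\<in>UNIV. \<pi> (\<lambda>\<psi>. A $ fst p $ snd p *\<^sub>C site_op i (matrix_unit (fst p) (snd p)) \<psi>) \<eta>)"
        by (rule rep_sum[OF alg rep star_algebra_cscale[OF alg site_op_in_chain_alg]])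
      ultimately have "\<pi> (site_op i A) = (\<lambda>\<eta>. \<Sum>p\<in>UNIV.
          \<pi> (\<lambda>\<psi>. A $ fst p $ snd p *\<^sub>C site_op i (matrix_unit (fst p) (snd p)) \<psi>) \<eta>)" by simp
      then show ?thesis by (simp add: coeff u_def rep_cscale[OF rep site_op_in_chain_alg])
    qed
    have "z (\<Sum>p\<in>UNIV. cinner \<xi> (\<pi> (site_op i X) (v p \<xi>)) *\<^sub>C u p \<eta>)
        = (\<Sum>p\<in>UNIV. cinner \<xi> (\<pi> (site_op i X) (v p \<xi>)) *\<^sub>C u p (z \<eta>))"
    \<comment> \<open>\<open>K = 1\<close> because the swap needs \<open>i\<close> and
      \<open>i + k\<close> to be different sites.\<close>
    proof (rule commutes_with_slice[OF zL, where K = 1 and x = "\<pi> (site_op i X)" and I = UNIV and u = u and v = v])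
      show "z (\<Sum>p\<in>UNIV. u p (shift k (v p) \<eta>)) = (\<Sum>p\<in>UNIV. u p (shift k (v p) (z \<eta>)))"
        if "k \<ge> 1" for k \<eta>
        using swap[of i "i + int k" \<eta>] that by (simp add: swap_eq)
      show "id \<in> L"
        using star_algebra_id[OF star_algebra_chain_loc] rep_id[OF rep] by (metis imageI)
      show "\<pi> (site_op i X) \<circ> v p \<in> L" for p unfolding xv by (intro imageI site_op_in_chain_loc)
    qed (simp_all add: u_def v_def site_op_in_chain_loc)
    then show ?thesis by (simp only: slice)
  qed
  have tensor: "z (\<pi> (tensor_at a As) \<eta>) = \<pi> (tensor_at a As) (z \<eta>)" for a As \<eta>
  proof (induction As arbitrary: a \<eta>)
    case Nil
    then show ?case unfolding tensor_at.simps rep_id[OF rep] by simp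
  next
    case (Cons B As)
    then show ?case
      by (simp only: tensor_at.simps
          rep_compose_apply[OF rep site_op_in_chain_alg loc[OF tensor_at_in_chain_loc]] site)
  qed
  have "z (\<pi> T \<eta>) = \<pi> T (z \<eta>)" if T: "T \<in> chain_loc" for T \<eta>
    using T
  proof (induction rule: chain_loc_induct)
    case zero
    then show ?case by (simp add: rep_zero[OF alg rep] bounded_clinear_zero[OF bz])
  next
    case (add T c a As)
    note ta = loc[OF tensor_at_in_chain_loc, of a As]
    from rep_plus_cscale[OF alg rep loc[OF add(1)] ta] show ?case
      by (simp add: add bounded_clinear_add[OF bz] bounded_clinear_scaleC[OF bz] tensor)
  qed
  then have "z \<in> commutant L" by (intro commutantI bz) auto
  from center[OF zL this] show ?thesis .
qed

end


section \<open>Restriction to the gauge-invariant algebra\<close>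

text \<open>\<open>\<omega>(S) = \<langle>\<xi>, T S \<xi>\<rangle>\<close> is a positive functional on the commutant of \<open>T = hadj Y \<circ> Y\<close>, since
  \<open>\<omega>(hadj R \<circ> R) = \<parallel>Y R \<xi>\<parallel>\<^sup>2\<close>.\<close>

lemma norm_commuting_le:
  fixes Y :: "'a::complex_hilbert \<Rightarrow> 'b::complex_hilbert"
  assumes Y: "bounded_clinear Y" and T: "bounded_clinear T"
    and YT: "\<And>x y. cinner (Y x) (Y y) = cinner x (T y)"
    and z: "bounded_clinear z" and comm: "\<And>x. z (T x) = T (z x)"
  shows "norm (Y (z x)) \<le> onorm z * norm (Y x)"
proof -
  have hT: "hadj T = T"
  proof (rule hadj_eqI[OF T])
    show "cinner (T x) y = cinner x (T y)" for x y
      by (metis YT cinner_commute)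
  qed
  have alg: "star_algebra (commutant {T})"
    by (rule star_algebra_commutant) (use T hT in auto)
  have closed: "op_closure (commutant {T}) \<subseteq> commutant {T}"
    by (rule op_closure_commutant) (use T in simp)
  have zc: "z \<in> commutant {T}" by (rule commutantI[OF z]) (use comm in simp)
  show ?thesis
  proof (rule le_mult_if_greater)
    fix r assume r: "r > onorm z"
    then obtain S where S: "S \<in> commutant {T}" "hadj S = S"
      "\<And>x. S (S x) = complex_of_real (r\<^sup>2) *\<^sub>C x - hadj z (z x)"
      by (rule sqrt_norm_defect[OF alg closed zc]) blast
    have r0: "r \<ge> 0" using r bounded_clinear_onorm_nonneg[OF z] by linarith
    \<comment> \<open>\<open>R\<close>, and with it \<open>hadj R\<close>, commutes with
      \<open>T\<close>, so the quadratic form depends on \<open>R\<close> only through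
      \<open>hadj R \<circ> R\<close>. This lets the identity for \<open>S \<circ> S\<close> be
      inserted, and it is applied to \<open>S\<close> and to \<open>z\<close>.\<close>
    have quad: "cinner (Y (R x)) (Y (R x)) = cinner x (T (hadj R (R x)))" if R: "R \<in> commutant {T}" for R
    proof -
      have "cinner (Y (R x)) (Y (R x)) = cinner x (hadj R (T (R x)))"
        by (simp add: YT cinner_hadj_right[OF commutant_bounded[OF R]])
      then show ?thesis
        using commutant_apply[OF star_algebra_hadj[OF alg R], of T "R x"] by simp
    qed
    have "cinner (Y (S x)) (Y (S x)) = cinner x (T (complex_of_real (r\<^sup>2) *\<^sub>C x - hadj z (z x)))"
      using quad[OF S(1)] by (simp only: S(2,3))
    also have "\<dots> = complex_of_real (r\<^sup>2) * cinner (Y x) (Y x) - cinner (Y (z x)) (Y (z x))"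
      by (simp only: quad[OF zc] bounded_clinear_diff[OF T] bounded_clinear_scaleC[OF T]
          cinner_diff_right cinner_scaleC_right YT[of x x])
    finally have "(norm (Y (S x)))\<^sup>2 = (r * norm (Y x))\<^sup>2 - (norm (Y (z x)))\<^sup>2"
      by (simp add: norm_power2 power_mult_distrib)
    then have "(norm (Y (z x)))\<^sup>2 \<le> (r * norm (Y x))\<^sup>2" using zero_le_power2[of "norm (Y (S x))"] by linarith
    then show "norm (Y (z x)) \<le> r * norm (Y x)" by (rule power2_le_imp_le) (simp add: r0)
  qed simp
qed

text \<open>The swaps belong to the gauge-invariant algebra whatever \<open>G\<close> is, so its
  whole relative commutant in the large von Neumann algebra is scalar, and not only its
  centre.\<close>

lemma (in invariant_gns) gauge_commutant_trivial:
  assumes G: "discrete_unitary_subgroup G"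
    and z: "z \<in> bicommutant (\<pi> ` chain_alg)" "z \<in> commutant (\<pi> ` gauge_alg G)"
  shows "\<exists>c. z = (\<lambda>x. c *\<^sub>C x)"
  using z(1)
  by (rule swap_commutant_trivial)
    (rule commutant_apply[OF z(2) imageI[OF swap_op_in_gauge_alg[OF G]]])

lemma (in invariant_gns) factor_gauge_alg:
  assumes G: "discrete_unitary_subgroup G"
  shows "factor (bicommutant (\<pi> ` gauge_alg G))"
proof (rule factor_bicommutantI)
  show "bounded_clinear A" and "hadj A \<in> \<pi> ` gauge_alg G" if "A \<in> \<pi> ` gauge_alg G" for A
    using that rep_image_adjoint_closed[OF alg gauge_alg_subset star_algebra_hadj[OF star_algebra_gauge_alg[OF G]] rep]
    by blast+
  show "\<exists>c. z = (\<lambda>x. c *\<^sub>C x)"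
    if "z \<in> bicommutant (\<pi> ` gauge_alg G)" "z \<in> commutant (\<pi> ` gauge_alg G)" for z
    using that bicommutant_mono[OF image_mono[OF gauge_alg_subset]]
    by (intro gauge_commutant_trivial[OF G]) auto
qed

text \<open>A central element \<open>z\<close> of an arbitrary GNS representation \<open>\<pi>2\<close> of the restricted state lifts to
  \<open>n\<close> on the large space by \<open>n (y \<xi>) = y (W (z \<xi>2))\<close> for \<open>y \<in> \<pi>(gauge_alg G)'\<close>, where \<open>W\<close> is the
  isometric intertwiner; \<open>n\<close> lies in \<open>\<pi>(gauge_alg G)''\<close> and commutes with \<open>\<pi>(gauge_alg G)\<close>.\<close>

lemma (in invariant_gns) factor_gauge_gns:
  fixes \<pi>2 :: "('d chain \<Rightarrow> 'd chain) \<Rightarrow> ('k::complex_hilbert \<Rightarrow> 'k)" and \<xi>2 :: 'k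
  assumes G: "discrete_unitary_subgroup G"
    and gns2: "gns_triple (gauge_alg G) (restrict \<phi> (gauge_alg G)) \<pi>2 \<xi>2"
  shows "factor (bicommutant (\<pi>2 ` gauge_alg G))"
proof (rule factor_bicommutantI)
  let ?A = "gauge_alg G"
  note galg = star_algebra_gauge_alg[OF G]
  note sub = gauge_alg_subset[THEN subsetD, of _ G]
  note rep2 = gns_rep[OF gns2]
  have g: "A \<in> \<pi> ` ?A \<Longrightarrow> bounded_clinear A" "A \<in> \<pi> ` ?A \<Longrightarrow> hadj A \<in> \<pi> ` ?A" for A
    using rep_image_adjoint_closed[OF alg gauge_alg_subset star_algebra_hadj[OF galg] rep] by blast+
  have g2: "A \<in> \<pi>2 ` ?A \<Longrightarrow> bounded_clinear A" "A \<in> \<pi>2 ` ?A \<Longrightarrow> hadj A \<in> \<pi>2 ` ?A" for A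
    using rep_image_adjoint_closed[OF galg order_refl star_algebra_hadj[OF galg] rep2] by blast+
  show "bounded_clinear A" if "A \<in> \<pi>2 ` ?A" for A using g2(1) that .
  show "hadj A \<in> \<pi>2 ` ?A" if "A \<in> \<pi>2 ` ?A" for A using g2(2) that .
  have norm_eq: "norm (\<pi> T \<xi>) = norm (\<pi>2 T \<xi>2)" if T: "T \<in> ?A" for T
  proof -
    have HT: "hadj T \<circ> T \<in> ?A" by (intro star_algebra_compose[OF galg] star_algebra_hadj[OF galg] T)
    have "complex_of_real ((norm (\<pi> T \<xi>))\<^sup>2) = restrict \<phi> ?A (hadj T \<circ> T)"
      unfolding restrict_apply'[OF HT] by (rule gns_norm[OF alg gns sub[OF T], symmetric])
    also have "\<dots> = complex_of_real ((norm (\<pi>2 T \<xi>2))\<^sup>2)" by (rule gns_norm[OF galg gns2 T])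
    finally show ?thesis by (simp only: of_real_eq_iff power2_eq_iff_nonneg norm_ge_zero)
  qed
  have lin: "\<exists>R\<in>?A. \<pi>2 R \<xi>2 = \<pi>2 S \<xi>2 + c *\<^sub>C \<pi>2 T \<xi>2 \<and> \<pi> R \<xi> = \<pi> S \<xi> + c *\<^sub>C \<pi> T \<xi>"
    if S: "S \<in> ?A" and T: "T \<in> ?A" for S T c
  proof (rule bexI)
    note cT = star_algebra_cscale[OF galg T, of c]
    show "(\<lambda>x. S x + c *\<^sub>C T x) \<in> ?A" by (rule star_algebra_plus[OF galg S cT])
    show "\<pi>2 (\<lambda>x. S x + c *\<^sub>C T x) \<xi>2 = \<pi>2 S \<xi>2 + c *\<^sub>C \<pi>2 T \<xi>2 \<and>
        \<pi> (\<lambda>x. S x + c *\<^sub>C T x) \<xi> = \<pi> S \<xi> + c *\<^sub>C \<pi> T \<xi>"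
      by (simp only: rep_plus_cscale[OF galg rep2 S T] rep_plus_cscale[OF alg rep sub[OF S] sub[OF T]])
  qed
  obtain W where W: "bounded_clinear W" "\<And>T. T \<in> ?A \<Longrightarrow> W (\<pi>2 T \<xi>2) = \<pi> T \<xi>"
    by (rule dense_extension[where I = ?A and u = "\<lambda>T. \<pi>2 T \<xi>2" and v = "\<lambda>T. \<pi> T \<xi>" and K = 1])
      (use lin gns_cyclic[OF gns2] norm_eq in auto)
  have W_\<xi>2: "W \<xi>2 = \<xi>" using W(2)[OF star_algebra_id[OF galg]] by (simp add: rep_id[OF rep] rep_id[OF rep2])
  have eq2: "S = T" if "bounded_clinear S" "bounded_clinear T" "\<And>A. A \<in> ?A \<Longrightarrow> S (\<pi>2 A \<xi>2) = T (\<pi>2 A \<xi>2)"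
    for S T :: "'k \<Rightarrow> 'c::complex_hilbert"
    by (rule bounded_clinear_eq_on_dense[OF that(1,2) _ gns_cyclic[OF gns2]]) (use that(3) in auto)
  have W_int: "W (\<pi>2 T x) = \<pi> T (W x)" if T: "T \<in> ?A" for T x
  proof -
    have "W \<circ> \<pi>2 T = \<pi> T \<circ> W"
    proof (rule eq2)
      show "bounded_clinear (W \<circ> \<pi>2 T)" by (intro bounded_clinear_compose W rep_bounded[OF rep2] T)
      show "bounded_clinear (\<pi> T \<circ> W)" by (intro bounded_clinear_compose W rep_bounded[OF rep] sub T)
      show "(W \<circ> \<pi>2 T) (\<pi>2 A \<xi>2) = (\<pi> T \<circ> W) (\<pi>2 A \<xi>2)" if A: "A \<in> ?A" for A
        using W(2)[OF star_algebra_compose[OF galg T A]]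
        by (simp only: o_apply W(2)[OF A] rep_compose_apply[OF rep2 T A] rep_compose_apply[OF rep sub[OF T] sub[OF A]])
    qed
    then show ?thesis by (simp add: fun_eq_iff)
  qed
  \<comment> \<open>\<open>hadj\<close> is defined for operators on a single space; the adjoint of
    \<open>W\<close> runs between two.\<close>
  obtain Ws where Ws: "bounded_clinear Ws" "\<And>x y. cinner (W x) y = cinner x (Ws y)"
    using adjoint_exists[OF W(1)] by blast
  have W_iso: "norm (W x) = norm x" for x
    by (rule isometry_of_dense[OF W(1) _ gns_cyclic[OF gns2]]) (use W(2) norm_eq in auto)
  have WsW: "Ws (W x) = x" for x
  proof (rule cinner_extI)
    show "cinner y (Ws (W x)) = cinner y x" for y
      using isometry_cinner[OF W(1) W_iso, of y x] by (simp only: Ws(2))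
  qed
  have Ws_int: "Ws (\<pi> T x) = \<pi>2 T (Ws x)" if T: "T \<in> ?A" for T x
  proof (rule cinner_extI)
    fix y
    note hT = star_algebra_hadj[OF galg T]
    have "cinner y (Ws (\<pi> T x)) = cinner (hadj (\<pi> T) (W y)) x"
      by (simp only: Ws(2)[symmetric] cinner_hadj_left[OF rep_bounded[OF rep sub[OF T]]])
    also have "\<dots> = cinner (W (hadj (\<pi>2 T) y)) x"
      using W_int[OF hT, of y] by (simp only: rep_hadj[OF rep sub[OF T]] rep_hadj[OF rep2 T])
    also have "\<dots> = cinner y (\<pi>2 T (Ws x))"
      by (simp only: Ws(2) cinner_hadj_left[OF rep_bounded[OF rep2 T]])
    finally show "cinner y (Ws (\<pi> T x)) = cinner y (\<pi>2 T (Ws x))" .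
  qed
  have sepA: "separating \<xi> (bicommutant (\<pi> ` ?A))"
    using sep bicommutant_mono[OF image_mono[OF gauge_alg_subset], of \<pi> G] unfolding separating_def by blast
  have dense: "closure ((\<lambda>y. y \<xi>) ` commutant (\<pi> ` ?A)) = UNIV"
    by (rule separating_imp_commutant_dense[OF g sepA])
  fix z assume z: "z \<in> bicommutant (\<pi>2 ` ?A)" "z \<in> commutant (\<pi>2 ` ?A)"
  note bz = commutant_bounded[OF z(2)]
  have bound: "norm (y (W (z \<xi>2))) \<le> onorm z * norm (y \<xi>)" if y: "y \<in> commutant (\<pi> ` ?A)" for y
  proof -
    note y_bd = commutant_bounded[OF y]
    \<comment> \<open>\<open>T\<close> is the adjoint of \<open>y \<circ> W\<close> composed with
      \<open>y \<circ> W\<close>. It commutes with the algebra represented by \<open>\<pi>2\<close>,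
      hence with \<open>z\<close>, which lies in the bicommutant; so \<open>z\<close> enlarges the
      norm of \<open>y (W x)\<close> at most by the factor \<open>onorm z\<close>.\<close>
    define T where "T = Ws \<circ> (hadj y \<circ> (y \<circ> W))"
    have hy: "hadj y \<in> commutant (\<pi> ` ?A)" by (rule commutant_hadj[OF g y])
    have bT: "bounded_clinear T"
      unfolding T_def by (intro bounded_clinear_compose Ws W y_bd bounded_clinear_hadj)
    have "T \<in> commutant (\<pi>2 ` ?A)"
    proof (rule commutantI[OF bT])
      fix B x assume "B \<in> \<pi>2 ` ?A"
      then obtain S where S: "S \<in> ?A" "B = \<pi>2 S" by blast
      show "T (B x) = B (T x)"
        by (simp only: T_def S(2) o_apply W_int[OF S(1)] commutant_apply[OF y imageI[OF S(1)]]
            commutant_apply[OF hy imageI[OF S(1)]] Ws_int[OF S(1)])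
    qed
    then have zT: "z (T x) = T (z x)" for x using z(1) unfolding bicommutant_def by (intro commutant_apply)
    have "norm ((y \<circ> W) (z \<xi>2)) \<le> onorm z * norm ((y \<circ> W) \<xi>2)"
    proof (rule norm_commuting_le[OF _ bT _ bz zT])
      show "bounded_clinear (y \<circ> W)" by (intro bounded_clinear_compose W y_bd)
      show "cinner ((y \<circ> W) a) ((y \<circ> W) b) = cinner a (T b)" for a b
        by (simp add: T_def Ws(2)[symmetric] cinner_hadj_right[OF y_bd])
    qed
    then show ?thesis by (simp add: W_\<xi>2)
  qed
  have lin': "\<exists>l\<in>commutant (\<pi> ` ?A). l \<xi> = i \<xi> + c *\<^sub>C j \<xi> \<and> l (W (z \<xi>2)) = i (W (z \<xi>2)) + c *\<^sub>C j (W (z \<xi>2))"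
    if i: "i \<in> commutant (\<pi> ` ?A)" and j: "j \<in> commutant (\<pi> ` ?A)" for i j c
    by (rule bexI[OF _ commutant_plus[OF g(1) i commutant_cscale[OF g(1) j, of c]]]) auto
  obtain n where n: "bounded_clinear n" "\<And>y. y \<in> commutant (\<pi> ` ?A) \<Longrightarrow> n (y \<xi>) = y (W (z \<xi>2))"
    by (rule dense_extension[where I = "commutant (\<pi> ` ?A)" and u = "\<lambda>y. y \<xi>" and v = "\<lambda>y. y (W (z \<xi>2))"
          and K = "onorm z"])
      (use lin' dense bound in auto)
  have n_y: "n (y x) = y (n x)" if y: "y \<in> commutant (\<pi> ` ?A)" for y x
  proof -
    note y_bd = commutant_bounded[OF y]
    have "n \<circ> y = y \<circ> n"
    proof (rule bounded_clinear_eq_on_dense[OF _ _ _ dense])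
      show "bounded_clinear (n \<circ> y)" "bounded_clinear (y \<circ> n)" by (intro bounded_clinear_compose n y_bd)+
      show "(n \<circ> y) v = (y \<circ> n) v" if v: "v \<in> (\<lambda>y. y \<xi>) ` commutant (\<pi> ` ?A)" for v
      proof -
        obtain y' where y': "y' \<in> commutant (\<pi> ` ?A)" "v = y' \<xi>" using v by blast
        have "n ((y \<circ> y') \<xi>) = (y \<circ> y') (W (z \<xi>2))" by (rule n(2)[OF commutant_compose[OF y y'(1)]])
        then show ?thesis by (simp add: y'(2) n(2)[OF y'(1)])
      qed
    qed
    then show ?thesis by (simp add: fun_eq_iff)
  qed
  then have nA: "n \<in> bicommutant (\<pi> ` ?A)" unfolding bicommutant_def by (intro commutantI n(1))
  have n_\<xi>: "n \<xi> = W (z \<xi>2)" using n(2)[OF commutant_id] by simp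
  have n_T: "n (\<pi> T \<xi>) = \<pi> T (n \<xi>)" if T: "T \<in> ?A" for T
  proof -
    have zT: "z (\<pi>2 T x) = \<pi>2 T (z x)" for x by (rule commutant_apply[OF z(2) imageI[OF T]])
    \<comment> \<open>\<open>W \<circ> Ws\<close> is the projection onto the range of
      \<open>W\<close>. Since it commutes with the algebra represented by \<open>\<pi>\<close>, it
      commutes with \<open>n\<close>, so \<open>n\<close> preserves that range.\<close>
    have WWs: "W \<circ> Ws \<in> commutant (\<pi> ` ?A)"
      by (rule commutantI) (auto simp: bounded_clinear_compose W(1) Ws(1) W_int Ws_int)
    have proj: "W (Ws (n (\<pi> T \<xi>))) = n (\<pi> T \<xi>)"
      using n_y[OF WWs, of "\<pi> T \<xi>"] W(2)[OF T] WsW[of "\<pi>2 T \<xi>2"] by simp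
    have "Ws (n (\<pi> T \<xi>)) = z (\<pi>2 T \<xi>2)"
    proof -
      \<comment> \<open>Checked on the dense set of vectors \<open>y \<xi>\<close>: the compression
        \<open>Ws \<circ> (y \<circ> W)\<close> lies in the commutant on the small space, so
        \<open>z\<close> passes through it.\<close>
      have "Ws \<circ> n = z \<circ> Ws"
      proof (rule bounded_clinear_eq_on_dense[OF _ _ _ dense])
        show "bounded_clinear (Ws \<circ> n)" "bounded_clinear (z \<circ> Ws)" by (intro bounded_clinear_compose Ws n bz)+
        show "(Ws \<circ> n) v = (z \<circ> Ws) v" if v: "v \<in> (\<lambda>y. y \<xi>) ` commutant (\<pi> ` ?A)" for v
        proof -
          obtain y where y: "y \<in> commutant (\<pi> ` ?A)" "v = y \<xi>" using v by blast
          have "Ws \<circ> (y \<circ> W) \<in> commutant (\<pi>2 ` ?A)"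
          proof (rule commutantI)
            show "bounded_clinear (Ws \<circ> (y \<circ> W))"
              by (intro bounded_clinear_compose Ws W commutant_bounded[OF y(1)])
            fix B x assume "B \<in> \<pi>2 ` ?A"
            then obtain S where S: "S \<in> ?A" "B = \<pi>2 S" by blast
            show "(Ws \<circ> (y \<circ> W)) (B x) = B ((Ws \<circ> (y \<circ> W)) x)"
              by (simp only: S(2) o_apply W_int[OF S(1)] commutant_apply[OF y(1) imageI[OF S(1)]] Ws_int[OF S(1)])
          qed
          then have "z ((Ws \<circ> (y \<circ> W)) \<xi>2) = (Ws \<circ> (y \<circ> W)) (z \<xi>2)"
            using z(1) unfolding bicommutant_def by (intro commutant_apply)
          then show ?thesis by (simp add: y(2) n(2)[OF y(1)] W_\<xi>2)
        qed
      qed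
      then have "Ws (n (\<pi> T \<xi>)) = z (Ws (\<pi> T \<xi>))" by (simp add: fun_eq_iff)
      also have "Ws (\<pi> T \<xi>) = \<pi>2 T \<xi>2" using WsW[of "\<pi>2 T \<xi>2"] by (simp only: W(2)[OF T])
      finally show ?thesis .
    qed
    then have "n (\<pi> T \<xi>) = W (\<pi>2 T (z \<xi>2))" using proj by (simp only: zT)
    then show ?thesis by (simp only: W_int[OF T] n_\<xi>)
  qed
  have "n \<in> commutant (\<pi> ` ?A)"
  proof (rule commutantI[OF n(1)])
    fix B x assume "B \<in> \<pi> ` ?A"
    then obtain T where T: "T \<in> ?A" "B = \<pi> T" by blast
    have piT: "\<pi> T \<in> bicommutant (\<pi> ` ?A)" using subset_bicommutant[OF g(1)] T(1) by blast
    \<comment> \<open>Commutation is known so far only at \<open>\<xi>\<close>; the commutator lies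
      in the bicommutant, which \<open>\<xi>\<close> separates.\<close>
    have "(\<lambda>x. (n \<circ> \<pi> T) x - (\<pi> T \<circ> n) x) \<in> bicommutant (\<pi> ` ?A)"
      using nA piT by (intro bicommutant_minus bicommutant_compose)
    moreover have "(n \<circ> \<pi> T) \<xi> - (\<pi> T \<circ> n) \<xi> = 0" using n_T[OF T(1)] by simp
    ultimately have "(\<lambda>x. (n \<circ> \<pi> T) x - (\<pi> T \<circ> n) x) = (\<lambda>_. 0)" by (rule separatingD[OF sepA])
    then show "n (B x) = B (n x)" by (simp add: T(2) fun_eq_iff)
  qed
  then obtain c where c: "n = (\<lambda>x. c *\<^sub>C x)"
    using gauge_commutant_trivial[OF G] nA bicommutant_mono[OF image_mono[OF gauge_alg_subset], of \<pi> G] by blast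
  have "z (\<pi>2 T \<xi>2) = c *\<^sub>C \<pi>2 T \<xi>2" if T: "T \<in> ?A" for T
  proof -
    have "W (z (\<pi>2 T \<xi>2)) = \<pi> T (n \<xi>)"
      by (simp only: commutant_apply[OF z(2) imageI[OF T]] W_int[OF T] n_\<xi>)
    also have "\<dots> = W (c *\<^sub>C \<pi>2 T \<xi>2)"
      by (simp only: c bounded_clinear_scaleC[OF rep_bounded[OF rep sub[OF T]]] bounded_clinear_scaleC[OF W(1)] W(2)[OF T])
    finally have "Ws (W (z (\<pi>2 T \<xi>2))) = Ws (W (c *\<^sub>C \<pi>2 T \<xi>2))" by simp
    then show ?thesis by (simp only: WsW)
  qed
  then have "z = (\<lambda>x. c *\<^sub>C x)" by (intro eq2 bz bounded_clinear_scalar)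
  then show "\<exists>c. z = (\<lambda>x. c *\<^sub>C x)" by blast
qed

lemma state_on_gauge_alg:
  assumes G: "discrete_unitary_subgroup G" and state: "state_on chain_alg \<phi>"
  shows "state_on (gauge_alg G) (restrict \<phi> (gauge_alg G))"
proof -
  note galg = star_algebra_gauge_alg[OF G]
  show ?thesis
    using state gauge_alg_subset[of G] star_algebra_id[OF galg] star_algebra_plus[OF galg]
      star_algebra_cscale[OF galg] star_algebra_compose[OF galg] star_algebra_hadj[OF galg]
    unfolding state_on_def by (simp add: subset_iff)
qed

theorem mainTheorem3:
  fixes G :: "'d::finite cmat set"
    and E :: "('d \<times> 'd) cmat \<Rightarrow> 'd cmat"
    and \<rho> :: "'d cmat \<Rightarrow> complex"
    and \<phi>' :: "('d chain \<Rightarrow> 'd chain) \<Rightarrow> complex"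
    and \<pi> :: "('d chain \<Rightarrow> 'd chain) \<Rightarrow> ('h::complex_hilbert \<Rightarrow> 'h)"
    and \<xi> :: 'h
  assumes "discrete_unitary_subgroup G"
    and "finitely_correlated_state E \<rho> \<phi>'"
    and "gauge_covariant G E"
    and "gns_triple chain_alg \<phi>' \<pi> \<xi>"
    and "separating \<xi> (bicommutant (\<pi> ` chain_alg))"
    and "factor_state TYPE('h) chain_alg \<phi>'"
  shows "factor_state TYPE('k::complex_hilbert) (gauge_alg G) (restrict \<phi>' (gauge_alg G)) \<and>
         factor (bicommutant (\<pi> ` gauge_alg G))"
proof -
  \<comment> \<open>Translation invariance holds because the right side of the correlation formula
    does not mention the site \<open>k\<close> at which the tensor starts.\<close>
  interpret invariant_gns \<phi>' \<pi> \<xi>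
    using assms by unfold_locales (auto simp: finitely_correlated_state_def factor_state_def)
  show ?thesis
    unfolding factor_state_def
    using state_on_gauge_alg[OF assms(1) state] factor_gauge_alg[OF assms(1)] factor_gauge_gns[OF assms(1)]
    by blast
qed

end
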